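(* Let $H$ be a commutative monoid and let $r$ be a modular finitary weak ideal system on $H$ such that each regular $r$-ideal of $H$ is an $r$-union of $r$-invertible $r$-ideals of $H$ (i.e. equals the $r$-closure of a union of $r$-invertible $r$-ideals). The following are equivalent. (1) Every regular $r$-ideal of $H$ is an $r$-product of radical $r$-ideals. (2) Every regular prime $r$-ideal is $r$-maximal and each $r$-invertible $r$-ideal is an $r$-product of radical $r$-ideals. (3) Each regular prime $r$-ideal is $r$-maximal and contains an $r$-invertible radical $r$-ideal. (4) Each regular $r$-ideal is an $r$-product of (unique proper) radical $r$-ideals $J_1\subseteq\cdots\subseteq J_n$ (with $H$ the empty $r$-product). (5) The radical of each regular $r$-finitely generated $r$-ideal is $r$-invertible. (6) The $C$-lattice $\mathcal{I}_r(H)_{\rm reg}$ is isomorphic, as a multiplicative lattice, to $U_b(r\text{-}\max^{-1}(H)_{\rm reg})$. (7) $H$ is an $r$-Prüfer monoid and the radical of every $r$-finitely generated $r$-ideal is $r$-finitely generated.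
   Context: $H$ is a multiplicative commutative monoid with more than one element, and $z(H)$ is the set of $z\in H$ with $xz=z$ for all $x\in H$. A weak ideal system on $H$ is a map $r:\mathbb{P}(H)\to\mathbb{P}(H)$, $X\mapsto X_r$, on the power set such that for all $X,Y\subseteq H$, $c\in H$: (A) $XH\cup z(H)\subseteq X_r$; (B) $X\subseteq Y_r$ implies $X_r\subseteq Y_r$; (C) $cX_r\subseteq(cX)_r$. It is finitary if $X_r=\bigcup_{E\subseteq X,|E|<\infty}E_r$ for all $X$. $X_r$ is the $r$-closure of $X$, and $X$ is an $r$-ideal if $X_r=X$. $r$ is modular if $(I\cup J)_r\cap N\subseteq(I\cup(J\cap N))_r$ for all $r$-ideals $I,J,N$ with $I\subseteq N$. The $r$-product of $r$-ideals $I,J$ is $(IJ)_r$ (and similarly for finitely many). A cancellative element $x\in H$ is regular if $(xA)_r=xA_r$ for all $A\subseteq H$. An $r$-ideal $I$ is proper if $I\neq H$; regular if it contains a regular element; $r$-invertible if $(IJ)_r=yH$ for some $J\subseteq H$ and some regular $y\in H$; $r$-finitely generated if $I=E_r$ for some finite $E\subseteq I$; radical if $x^n\in I$ with $n\geq 1$ implies $x\in I$; prime if $I\neq H$ and $xy\in I$ implies $x\in I$ or $y\in I$; $r$-maximal if it is maximal among proper $r$-ideals. The radical of $I$ is $\{x\in H\mid x^n\in I\text{ for some }n\geq1\}$. $H$ is an $r$-Prüfer monoid if every regular $r$-finitely generated $r$-ideal is $r$-invertible. $\mathcal{I}_r(H)_{\rm reg}$ is the set of regular $r$-ideals together with the bottom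 element $\emptyset_r$, ordered by inclusion with $r$-multiplication $(I,J)\mapsto(IJ)_r$. (A $C$-lattice is a multiplicative lattice in which the compact elements contain the top element, are closed under products, and generate every element by joins.) $r\text{-}\max^{-1}(H)_{\rm reg}$ is the set of regular $r$-maximal $r$-ideals with the inverse topology, having as basis of open sets the sets $\{M\mid I\subseteq M\}$ with $I$ a compact element of $\mathcal{I}_r(H)_{\rm reg}$, i.e. a regular $r$-finitely generated $r$-ideal or $\emptyset_r$; it is Hausdorff. An isomorphism of multiplicative lattices is an order isomorphism that is also a monoid isomorphism. For a Hausdorff space $X$, $U(X)$ is the monoid, under pointwise addition, of functions $f:X\to\mathbb{N}_0$ such that $f^{-1}([k,\infty))$ is compact for all $k\geq 1$ (the compactly supported upper semicontinuous functions), ordered by $f\leq_d g$ iff $f(x)\geq g(x)$ for all $x\in X$. $U_b(X)=U(X)\cup\{b\}$, where $b:X\to\mathbb{N}_0\cup\{\infty\}$, $b(x)=\infty$ for all $x\in X$, is appended as bottom element, with $b+f=f+b=b$ for all $f$. The monoid operation of $U_b(X)$ as a multiplicative lattice is $+$ and its top element is the zero function.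
   Formalization: In (7) the radical condition is stated only for regular r-finitely generated r-ideals (false otherwise), and (6) is claimed equivalent only when ∅_r ≠ H, i.e. excluding the trivial system X_r = H, with b read as a new bottom element also when the space is empty. *)

theory Defs
  imports "HOL-Library.Set_Algebras" "HOL-Algebra.Group" "HOL-Analysis.Abstract_Topology"
begin

text \<open>
  The monoid \<open>H\<close> is a type of class \<open>comm_monoid_mult\<close>, so \<open>UNIV\<close> plays the role of \<open>H\<close>.
  Products of subsets are those of \<open>Set_Algebras\<close>: \<open>X * Y\<close> is the set of all products,
  \<open>c *o X\<close> is \<open>cX\<close>, and \<open>1 = {1}\<close> for sets.
\<close>

section \<open>Weak ideal systems\<close>

definition z_elems :: "'a::comm_monoid_mult set" where
  "z_elems = {z. \<forall>x. x * z = z}"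

locale weak_ideal_system =
  fixes r :: "'a::comm_monoid_mult set \<Rightarrow> 'a set"
  assumes closure_A: "X * UNIV \<union> z_elems \<subseteq> r X"
    and closure_B: "X \<subseteq> r Y \<Longrightarrow> r X \<subseteq> r Y"
    and closure_C: "c *o r X \<subseteq> r (c *o X)"

definition finitary :: "('a set \<Rightarrow> 'a set) \<Rightarrow> bool" where
  "finitary r \<longleftrightarrow> (\<forall>X. r X = (\<Union>E \<in> {E. E \<subseteq> X \<and> finite E}. r E))"

definition r_ideal :: "('a set \<Rightarrow> 'a set) \<Rightarrow> 'a set \<Rightarrow> bool" where
  "r_ideal r I \<longleftrightarrow> r I = I"

definition modular :: "('a set \<Rightarrow> 'a set) \<Rightarrow> bool" where
  "modular r \<longleftrightarrow>
    (\<forall>I J N. r_ideal r I \<and> r_ideal r J \<and> r_ideal r N \<and> I \<subseteq> N \<longrightarrow>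
      r (I \<union> J) \<inter> N \<subseteq> r (I \<union> (J \<inter> N)))"

section \<open>Classes of \<open>r\<close>-ideals\<close>

definition cancellative :: "'a::comm_monoid_mult \<Rightarrow> bool" where
  "cancellative x \<longleftrightarrow> (\<forall>y z. x * y = x * z \<longrightarrow> y = z)"

definition regular_element :: "('a::comm_monoid_mult set \<Rightarrow> 'a set) \<Rightarrow> 'a \<Rightarrow> bool" where
  "regular_element r x \<longleftrightarrow> cancellative x \<and> (\<forall>A. r (x *o A) = x *o r A)"

definition regular_r_ideal :: "('a::comm_monoid_mult set \<Rightarrow> 'a set) \<Rightarrow> 'a set \<Rightarrow> bool" where
  "regular_r_ideal r I \<longleftrightarrow> r_ideal r I \<and> (\<exists>x\<in>I. regular_element r x)"

definition r_invertible :: "('a::comm_monoid_mult set \<Rightarrow> 'a set) \<Rightarrow> 'a set \<Rightarrow> bool" where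
  "r_invertible r I \<longleftrightarrow>
    r_ideal r I \<and> (\<exists>J y. regular_element r y \<and> r (I * J) = y *o UNIV)"

definition r_fin_generated :: "('a set \<Rightarrow> 'a set) \<Rightarrow> 'a set \<Rightarrow> bool" where
  "r_fin_generated r I \<longleftrightarrow> r_ideal r I \<and> (\<exists>E. finite E \<and> E \<subseteq> I \<and> I = r E)"

definition radical :: "'a::comm_monoid_mult set \<Rightarrow> 'a set" where
  "radical I = {x. \<exists>n\<ge>1. x ^ n \<in> I}"

definition radical_r_ideal :: "('a::comm_monoid_mult set \<Rightarrow> 'a set) \<Rightarrow> 'a set \<Rightarrow> bool" where
  "radical_r_ideal r I \<longleftrightarrow> r_ideal r I \<and> (\<forall>x n. n \<ge> 1 \<and> x ^ n \<in> I \<longrightarrow> x \<in> I)"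

definition prime_r_ideal :: "('a::comm_monoid_mult set \<Rightarrow> 'a set) \<Rightarrow> 'a set \<Rightarrow> bool" where
  "prime_r_ideal r P \<longleftrightarrow>
    r_ideal r P \<and> P \<noteq> UNIV \<and> (\<forall>x y. x * y \<in> P \<longrightarrow> x \<in> P \<or> y \<in> P)"

definition r_maximal :: "('a set \<Rightarrow> 'a set) \<Rightarrow> 'a set \<Rightarrow> bool" where
  "r_maximal r M \<longleftrightarrow>
    r_ideal r M \<and> M \<noteq> UNIV \<and> (\<forall>N. r_ideal r N \<and> N \<noteq> UNIV \<and> M \<subseteq> N \<longrightarrow> N = M)"

text \<open>As \<open>prod_list [] = {1}\<close>, the empty \<open>r\<close>-product is \<open>r {1}\<close>, which is \<open>UNIV\<close>.\<close>

definition r_product :: "('a::comm_monoid_mult set \<Rightarrow> 'a set) \<Rightarrow> 'a set list \<Rightarrow> 'a set" where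
  "r_product r Js = r (prod_list Js)"

definition r_product_of_radicals :: "('a::comm_monoid_mult set \<Rightarrow> 'a set) \<Rightarrow> 'a set \<Rightarrow> bool" where
  "r_product_of_radicals r I \<longleftrightarrow> (\<exists>Js. (\<forall>J \<in> set Js. radical_r_ideal r J) \<and> I = r_product r Js)"

definition r_Pruefer :: "('a::comm_monoid_mult set \<Rightarrow> 'a set) \<Rightarrow> bool" where
  "r_Pruefer r \<longleftrightarrow> (\<forall>I. regular_r_ideal r I \<and> r_fin_generated r I \<longrightarrow> r_invertible r I)"

section \<open>Multiplicative lattices\<close>

record 'a mult_lattice = "'a monoid" +
  lat_le :: "'a \<Rightarrow> 'a \<Rightarrow> bool"

definition mult_lattice_isomorphic ::
    "('a, 'm) mult_lattice_scheme \<Rightarrow> ('b, 'n) mult_lattice_scheme \<Rightarrow> bool" where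
  "mult_lattice_isomorphic L K \<longleftrightarrow>
    (\<exists>\<phi> \<in> iso L K. \<phi> \<one>\<^bsub>L\<^esub> = \<one>\<^bsub>K\<^esub> \<and>
      (\<forall>x \<in> carrier L. \<forall>y \<in> carrier L. lat_le L x y \<longleftrightarrow> lat_le K (\<phi> x) (\<phi> y)))"

definition reg_ideal_lattice :: "('a::comm_monoid_mult set \<Rightarrow> 'a set) \<Rightarrow> 'a set mult_lattice" where
  "reg_ideal_lattice r =
    \<lparr>carrier = {I. regular_r_ideal r I} \<union> {r {}},
     monoid.mult = (\<lambda>I J. r (I * J)),
     one = UNIV,
     lat_le = (\<subseteq>)\<rparr>"

text \<open>The sets of regular \<open>r\<close>-maximal \<open>r\<close>-ideals below form a basis; the choice \<open>I = r {}\<close>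
  makes the whole set of regular \<open>r\<close>-maximal \<open>r\<close>-ideals the \<open>topspace\<close>.\<close>

definition r_max_inv_reg :: "('a::comm_monoid_mult set \<Rightarrow> 'a set) \<Rightarrow> 'a set topology" where
  "r_max_inv_reg r = topology_generated_by
    {{M. regular_r_ideal r M \<and> r_maximal r M \<and> I \<subseteq> M} | I.
      (regular_r_ideal r I \<and> r_fin_generated r I) \<or> I = r {}}"

text \<open>Functions on the space are represented extensionally.\<close>

definition usc_functions :: "'x topology \<Rightarrow> ('x \<Rightarrow> nat) set" where
  "usc_functions T =
    {f \<in> extensional (topspace T). \<forall>k\<ge>1. compactin T {x \<in> topspace T. k \<le> f x}}"

text \<open>\<open>None\<close> is the appended bottom element \<open>b\<close>. It is not encoded as the constant function
  \<open>\<infinity>\<close>, because on the empty space that function would coincide with the zero function.\<close>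

fun usc_add :: "'x topology \<Rightarrow> ('x \<Rightarrow> nat) option \<Rightarrow> ('x \<Rightarrow> nat) option \<Rightarrow> ('x \<Rightarrow> nat) option" where
  "usc_add T (Some f) (Some g) = Some (\<lambda>x \<in> topspace T. f x + g x)"
| "usc_add T _ _ = None"

fun usc_le :: "'x topology \<Rightarrow> ('x \<Rightarrow> nat) option \<Rightarrow> ('x \<Rightarrow> nat) option \<Rightarrow> bool" where
  "usc_le T None _ = True"
| "usc_le T (Some f) None = False"
| "usc_le T (Some f) (Some g) = (\<forall>x \<in> topspace T. f x \<ge> g x)"

definition usc_lattice :: "'x topology \<Rightarrow> ('x \<Rightarrow> nat) option mult_lattice" where
  "usc_lattice T =
    \<lparr>carrier = Some ` usc_functions T \<union> {None},
     monoid.mult = usc_add T,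
     one = Some (\<lambda>x \<in> topspace T. 0),
     lat_le = usc_le T\<rparr>"

end

theory Submission
  imports Defs
begin

text \<open>
  Invertible \<open>r\<close>-ideals can be cancelled and divide every \<open>r\<close>-ideal that they contain. An invertible
  radical ideal is therefore squarefree: if \<open>R = QS\<close>, then \<open>Q\<close> and \<open>S\<close> are comaximal as soon as
  condition (5) makes the radical of their join invertible. Dividing a regular finitely generated
  ideal by its radical repeatedly then gives an ascending product of radical ideals, in which the
  number of factors below a regular maximal ideal \<open>M\<close> is the largest \<open>k\<close> with \<open>I \<subseteq> M\<^sup>k\<close>. These
  numbers determine \<open>I\<close>. This yields uniqueness, the passage to arbitrary regular ideals by directed
  unions, and the isomorphism (6), under which radical ideals correspond to characteristic functions
  of compact sets.

  If every regular prime is maximal, a finitely generated ideal \<open>A\<close> above an invertible radical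
  ideal \<open>J\<close> is comaximal with \<open>(J : A)\<close>, so \<open>J = A (J : A)\<close> and \<open>A\<close> is invertible; this gives (5).
  Conversely, suppose that (1) holds and \<open>P\<close> is a regular prime that is not maximal. Factoring
  \<open>P \<union> J\<^sup>2\<close> for an invertible \<open>J\<close> not inside \<open>P\<close> yields a prime \<open>M\<close> above \<open>P\<close> with
  \<open>P \<subseteq> M\<^sup>2\<close> and an invertible \<open>L \<subseteq> M\<close> outside \<open>M\<^sup>2\<close>. Factoring \<open>K\<^sup>2 \<union> L\<close> for invertible \<open>K \<subseteq> P\<close>
  shows that \<open>K\<close> is locally contained in \<open>L\<close>, which is impossible for radical \<open>K\<close>.
\<close>

text \<open>With no addition at hand, neither residue rings nor the Chinese remainder theorem is
  available. One rule, \<open>comaximal_cancel\<close>, takes their place: if \<open>A\<close> and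
  \<open>B\<close> are comaximal and both \<open>A * C\<close> and \<open>B * C\<close> lie in an
  \<open>r\<close>-ideal, then so does \<open>C\<close>. Under condition (5) an invertible radical
  ideal \<open>R\<close> supplies the comaximal pairs: a regular finitely generated \<open>A\<close>
  whose radical contains \<open>R\<close> splits it as \<open>R = r (radical A * S)\<close> with
  comaximal factors, so the maximal ideals above \<open>R\<close> fall into those above
  \<open>A\<close> and those above \<open>S\<close>. This splitting bounds the exponents in the
  factorization, keeps the powers of a regular maximal ideal from collapsing, and makes the sets of
  regular maximal ideals above a regular ideal compact. Regular maximal ideals are not known to be
  finitely generated, so statements on their powers are first moved to a finite subset by
  finitarity. The numbers \<open>k\<close> determine \<open>I\<close> because the member of index
  \<open>i\<close> in the ascending product is the intersection of the regular maximal ideals with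
  number greater than \<open>i\<close>.\<close>

declare set_one [simp del]

section \<open>Products and powers of subsets of a commutative monoid\<close>

lemma one_in_set_one [simp]: "1 \<in> (1 :: 'a::one set)" and finite_set_one [simp]: "finite (1 :: 'a::one set)"
  by (simp_all add: set_one)

lemma set_pow_mono: "A \<subseteq> B \<Longrightarrow> A ^ n \<subseteq> (B::'a::comm_monoid_mult set) ^ n"
proof (induction n)
  case (Suc n)
  then show ?case using set_times_mono2[of A B "A ^ n" "B ^ n"] by simp
qed simp

lemma elem_pow_set: "x \<in> A \<Longrightarrow> x ^ n \<in> (A::'a::comm_monoid_mult set) ^ n"
  by (induction n) (auto intro!: set_times_intro)

lemma finite_set_pow: "finite A \<Longrightarrow> finite ((A::'a::comm_monoid_mult set) ^ n)"
  by (induction n) (auto intro!: finite_set_times)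

lemma elt_set_times_eq: "a *o A = {a} * (A::'a::comm_monoid_mult set)"
  by (auto simp: elt_set_times_def set_times_def)

lemma set_times_subset_iff: "A * B \<subseteq> C \<longleftrightarrow> (\<forall>a\<in>A. \<forall>b\<in>B. a * b \<in> (C::'a::comm_monoid_mult set))"
  by (auto elim!: set_times_elim)

lemma finite_subset_times:
  fixes A B :: "'a::comm_monoid_mult set"
  assumes "finite E" "E \<subseteq> A * B"
  shows "\<exists>F G. finite F \<and> finite G \<and> F \<subseteq> A \<and> G \<subseteq> B \<and> E \<subseteq> F * G"
  using assms
proof (induction E rule: finite_induct)
  case empty
  then show ?case by (intro exI[of _ "{}"]) auto
next
  case (insert x E)
  then obtain F G where FG: "finite F" "finite G" "F \<subseteq> A" "G \<subseteq> B" "E \<subseteq> F * G" by auto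
  obtain a b where "a \<in> A" "b \<in> B" "x = a * b" using insert.prems by (auto elim: set_times_elim)
  moreover have "F * G \<subseteq> insert a F * insert b G" by (intro set_times_mono2) auto
  moreover have "a * b \<in> insert a F * insert b G" by (intro set_times_intro) auto
  ultimately have "insert x E \<subseteq> insert a F * insert b G" using FG(5) by blast
  then show ?case using FG \<open>a \<in> A\<close> \<open>b \<in> B\<close>
    by (intro exI[of _ "insert a F"] exI[of _ "insert b G"]) auto
qed

lemma finite_subset_pow:
  fixes A :: "'a::comm_monoid_mult set"
  shows "finite E \<Longrightarrow> E \<subseteq> A ^ n \<Longrightarrow> \<exists>F. finite F \<and> F \<subseteq> A \<and> E \<subseteq> F ^ n"
proof (induction n arbitrary: E)
  case 0
  then show ?case by auto
next
  case (Suc n)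
  have "E \<subseteq> A * A ^ n" using Suc.prems by simp
  from finite_subset_times[OF Suc.prems(1) this]
  obtain F G where FG: "finite F" "finite G" "F \<subseteq> A" "G \<subseteq> A ^ n" "E \<subseteq> F * G" by blast
  obtain F' where F': "finite F'" "F' \<subseteq> A" "G \<subseteq> F' ^ n" using Suc.IH[OF FG(2,4)] by metis
  have "F * G \<subseteq> (F \<union> F') * (F \<union> F') ^ n"
    using F'(3) set_pow_mono[of F' "F \<union> F'" n] by (intro set_times_mono2) auto
  then show ?case using FG F' by (intro exI[of _ "F \<union> F'"]) auto
qed

text \<open>A binomial expansion without coefficients, as sets can only be united: the products are
  sorted by how often \<open>x\<close> is chosen.\<close>

lemma insert_pow_subset:
  fixes F :: "'a::comm_monoid_mult set"
  shows "insert x F ^ m \<subseteq> (\<Union>i\<le>m. {x ^ i} * F ^ (m - i))"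
proof (induction m)
  case 0
  then show ?case by (simp add: set_one set_times_def)
next
  case (Suc m)
  show ?case
  proof
    fix y assume "y \<in> insert x F ^ Suc m"
    then obtain a b where ab: "y = a * b" "a \<in> insert x F" "b \<in> insert x F ^ m"
      by (auto elim: set_times_elim)
    then obtain i f where f: "i \<le> m" "b = x ^ i * f" "f \<in> F ^ (m - i)"
      using Suc.IH by (auto elim!: set_times_elim)
    show "y \<in> (\<Union>i\<le>Suc m. {x ^ i} * F ^ (Suc m - i))"
    proof (cases "a = x")
      case True
      then have "y = x ^ Suc i * f" using ab f by (simp add: mult.assoc)
      then show ?thesis using f by (intro UN_I[of "Suc i"]) auto
    next
      case False
      then have "y = x ^ i * (a * f)" "a * f \<in> F ^ (Suc m - i)"
        using ab f by (auto simp: Suc_diff_le mult.left_commute)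
      then show ?thesis using f by (intro UN_I[of i]) auto
    qed
  qed
qed

section \<open>Closure calculus of a finitary weak ideal system\<close>

locale finitary_ideal_system = weak_ideal_system r
  for r :: "'a::comm_monoid_mult set \<Rightarrow> 'a set" +
  assumes finitary_r: "finitary r"
begin

lemma r_extensive: "X \<subseteq> r X"
proof
  fix x assume "x \<in> X"
  then have "x * 1 \<in> X * UNIV" by (intro set_times_intro) auto
  then show "x \<in> r X" using closure_A[of X] by auto
qed

lemma r_mono: "X \<subseteq> Y \<Longrightarrow> r X \<subseteq> r Y"
  using closure_B[of X Y] r_extensive[of Y] by auto

lemma r_idem [simp]: "r (r X) = r X"
  using closure_B[of "r X" X] r_extensive[of "r X"] by auto

lemma r_ideal_r [simp]: "r_ideal r (r X)"
  by (simp add: r_ideal_def)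

lemma r_ideal_eq: "r_ideal r I \<Longrightarrow> r I = I"
  by (simp add: r_ideal_def)

lemma r_subset_iff: "r X \<subseteq> r Y \<longleftrightarrow> X \<subseteq> r Y"
  using closure_B[of X Y] r_extensive[of X] by auto

lemma r_least: "r_ideal r I \<Longrightarrow> r X \<subseteq> I \<longleftrightarrow> X \<subseteq> I"
  using r_subset_iff[of X I] by (simp add: r_ideal_def)

lemma r_mult_closed: "x \<in> r X \<Longrightarrow> a * x \<in> r X"
proof -
  assume "x \<in> r X"
  then have "x * a \<in> r X * UNIV" by (intro set_times_intro) auto
  then show ?thesis using closure_A[of "r X"] by (auto simp: mult.commute)
qed

lemma r_ideal_mult: "r_ideal r I \<Longrightarrow> x \<in> I \<Longrightarrow> a * x \<in> I"
  using r_mult_closed[of x I a] by (simp add: r_ideal_def)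

lemma r_ideal_mult': "r_ideal r I \<Longrightarrow> x \<in> I \<Longrightarrow> x * a \<in> I"
  using r_ideal_mult[of I x a] by (simp add: mult.commute)

lemma r_ideal_times_subset: "r_ideal r I \<Longrightarrow> A \<subseteq> I \<Longrightarrow> A * B \<subseteq> I" "r_ideal r I \<Longrightarrow> B \<subseteq> I \<Longrightarrow> A * B \<subseteq> I"
  by (auto simp: set_times_subset_iff intro: r_ideal_mult r_ideal_mult')

lemma r_empty_subset: "r_ideal r I \<Longrightarrow> r {} \<subseteq> I"
  by (simp add: r_least)

lemma times_r_subset: "X * r Y \<subseteq> r (X * Y)"
proof -
  have "x * y \<in> r (X * Y)" if "x \<in> X" "y \<in> r Y" for x y
  proof -
    have "x * y \<in> x *o r Y" using that by auto
    also have "\<dots> \<subseteq> r (x *o Y)" by (rule closure_C)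
    also have "\<dots> \<subseteq> r (X * Y)" using that by (intro r_mono set_times_mono3)
    finally show ?thesis .
  qed
  then show ?thesis by (auto simp: set_times_subset_iff)
qed

text \<open>Axiom (C), in the form of \<open>times_r_subset\<close>, lets inner closures be dropped,
  which makes \<open>r\<close>-multiplication associative.\<close>

lemma r_times_r [simp]: "r (X * r Y) = r (X * Y)"
proof
  show "r (X * r Y) \<subseteq> r (X * Y)" using times_r_subset by (simp add: r_subset_iff)
  show "r (X * Y) \<subseteq> r (X * r Y)" by (intro r_mono set_times_mono2 r_extensive) auto
qed

lemma r_r_times [simp]: "r (r X * Y) = r (X * Y)"
  using r_times_r[of Y X] by (simp only: mult.commute)

lemma r_pow_r [simp]: "r (r X ^ n) = r (X ^ n)"
proof (induction n)
  case (Suc n)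
  have "r (r X ^ Suc n) = r (r X * r (r X ^ n))" by simp
  also have "\<dots> = r (X * X ^ n)" by (simp only: Suc.IH r_times_r r_r_times)
  finally show ?case by simp
qed simp

lemma r_Un_r [simp]: "r (X \<union> r Y) = r (X \<union> Y)"
proof
  show "r (X \<union> r Y) \<subseteq> r (X \<union> Y)"
    using r_mono[of Y "X \<union> Y"] r_extensive[of "X \<union> Y"] by (simp add: r_subset_iff)
  show "r (X \<union> Y) \<subseteq> r (X \<union> r Y)" using r_extensive[of Y] by (intro r_mono) auto
qed

lemma r_r_Un [simp]: "r (r X \<union> Y) = r (X \<union> Y)"
  using r_Un_r[of Y X] by (simp only: Un_commute)

lemma r_finite:
  assumes "finite F" "F \<subseteq> r X"
  shows "\<exists>E. finite E \<and> E \<subseteq> X \<and> F \<subseteq> r E"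
  using assms
proof (induction F rule: finite_induct)
  case (insert x F)
  then obtain E where E: "finite E" "E \<subseteq> X" "F \<subseteq> r E" by auto
  have "x \<in> (\<Union>E \<in> {E. E \<subseteq> X \<and> finite E}. r E)"
    using insert.prems finitary_r unfolding finitary_def by blast
  then obtain D where D: "finite D" "D \<subseteq> X" "x \<in> r D" by auto
  show ?case using E D r_mono[of E "E \<union> D"] r_mono[of D "E \<union> D"] by (intro exI[of _ "E \<union> D"]) auto
qed auto

lemma r_eq_UNIV_iff: "r X = UNIV \<longleftrightarrow> 1 \<in> r X"
  using r_mult_closed[of 1 X] by auto

lemma r_one [simp]: "r {1} = UNIV" "r 1 = UNIV"
  using r_extensive[of "{1}"] by (auto simp: r_eq_UNIV_iff set_one)

lemma r_UNIV [simp]: "r UNIV = UNIV"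
  using r_extensive[of UNIV] by auto

lemma r_ideal_UNIV [simp]: "r_ideal r UNIV"
  by (simp add: r_ideal_def)

lemma r_ideal_UNIV_iff: "r_ideal r I \<Longrightarrow> I = UNIV \<longleftrightarrow> 1 \<in> I"
  using r_eq_UNIV_iff[of I] by (simp add: r_ideal_def)

lemma r_UNIV_times [simp]: "r (UNIV * X) = r X" "r (X * UNIV) = r X"
proof -
  have "r (UNIV * X) = r (r 1 * X)" by simp
  also have "\<dots> = r X" by (simp only: r_r_times mult_1)
  finally show "r (UNIV * X) = r X" .
  then show "r (X * UNIV) = r X" by (simp only: mult.commute)
qed

lemma r_times_mono: "r A \<subseteq> r B \<Longrightarrow> r C \<subseteq> r D \<Longrightarrow> r (A * C) \<subseteq> r (B * D)"
  by (metis r_mono r_r_times r_times_r set_times_mono2)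

lemma r_times_mono_left: "r A \<subseteq> r B \<Longrightarrow> r (C * A) \<subseteq> r (C * B)"
  by (simp add: r_times_mono)

lemma r_Int: "r_ideal r I \<Longrightarrow> r_ideal r J \<Longrightarrow> r_ideal r (I \<inter> J)"
  using r_mono[of "I \<inter> J" I] r_mono[of "I \<inter> J" J] r_extensive[of "I \<inter> J"]
  by (auto simp: r_ideal_def)

lemma r_Inter: assumes "\<And>I. I \<in> \<A> \<Longrightarrow> r_ideal r I" shows "r_ideal r (\<Inter>\<A>)"
proof -
  have "r (\<Inter>\<A>) \<subseteq> I" if "I \<in> \<A>" for I using assms[OF that] that by (auto simp: r_least)
  then show ?thesis using r_extensive[of "\<Inter>\<A>"] by (auto simp: r_ideal_def)
qed

lemma finite_subset_directed_Union:
  assumes "finite E" "E \<subseteq> \<Union>\<C>" "\<C> \<noteq> {}" "\<And>A B. A \<in> \<C> \<Longrightarrow> B \<in> \<C> \<Longrightarrow> \<exists>C\<in>\<C>. A \<union> B \<subseteq> C"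
  shows "\<exists>C\<in>\<C>. E \<subseteq> C"
  using assms(1,2)
proof (induction E rule: finite_induct)
  case empty then show ?case using assms(3) by auto
next
  case (insert x E)
  then obtain A B where "A \<in> \<C>" "E \<subseteq> A" "B \<in> \<C>" "x \<in> B" by auto
  then show ?case using assms(4)[of A B] by blast
qed

lemma r_ideal_directed_Union:
  assumes "\<C> \<noteq> {}" "\<And>A. A \<in> \<C> \<Longrightarrow> r_ideal r A" "\<And>A B. A \<in> \<C> \<Longrightarrow> B \<in> \<C> \<Longrightarrow> \<exists>C\<in>\<C>. A \<union> B \<subseteq> C"
  shows "r_ideal r (\<Union>\<C>)"
proof -
  have "x \<in> \<Union>\<C>" if "x \<in> r (\<Union>\<C>)" for x
  proof -
    have "\<exists>E. finite E \<and> E \<subseteq> \<Union>\<C> \<and> {x} \<subseteq> r E" using that by (intro r_finite) auto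
    then obtain E where E: "finite E" "E \<subseteq> \<Union>\<C>" "x \<in> r E" by fast
    then obtain C where "C \<in> \<C>" "E \<subseteq> C" using finite_subset_directed_Union[OF E(1,2) assms(1,3)] by metis
    then have "r E \<subseteq> C" using assms(2) by (simp add: r_least)
    then show ?thesis using E(3) \<open>C \<in> \<C>\<close> by blast
  qed
  then have "r (\<Union>\<C>) \<subseteq> \<Union>\<C>" by (rule subsetI)
  then show ?thesis using r_extensive[of "\<Union>\<C>"] unfolding r_ideal_def by (rule equalityI)
qed

text \<open>Comaximality of \<open>A\<close> and \<open>B\<close> is expressed as \<open>r (A \<union> B) = UNIV\<close>.\<close>

lemma comaximal_cancel:
  assumes "r (A \<union> B) = UNIV" "A * C \<subseteq> r X" "B * C \<subseteq> r X"
  shows "C \<subseteq> r X"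
proof -
  have "r C = r (r (A \<union> B) * C)" using assms(1) by simp
  also have "\<dots> = r (A * C \<union> B * C)" by (simp add: set_times_Un_distrib)
  also have "\<dots> \<subseteq> r X" using assms by (simp add: r_subset_iff)
  finally show ?thesis using r_subset_iff by blast
qed

lemma comaximal_mono: "r (A \<union> B) = UNIV \<Longrightarrow> A \<subseteq> r A' \<Longrightarrow> B \<subseteq> r B' \<Longrightarrow> r (A' \<union> B') = UNIV"
  by (metis Un_mono r_Un_r r_mono r_r_Un top.extremum_uniqueI)

text \<open>Multiplying the comaximal pair \<open>A\<close>, \<open>B\<close> by \<open>C\<close>
  puts \<open>C\<close> itself into the join of \<open>A\<close> and \<open>B * C\<close>;
  comaximality of \<open>A\<close> and \<open>C\<close> finishes.\<close>

lemma comaximal_times: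
  assumes "r (A \<union> B) = UNIV" "r (A \<union> C) = UNIV"
  shows "r (A \<union> B * C) = UNIV"
proof -
  have "C \<subseteq> r (A \<union> B * C)"
  proof (rule comaximal_cancel[OF assms(1)])
    show "A * C \<subseteq> r (A \<union> B * C)"
      using r_ideal_times_subset(1)[of "r (A \<union> B * C)" A C] r_extensive[of "A \<union> B * C"] by auto
    show "B * C \<subseteq> r (A \<union> B * C)" using r_extensive[of "A \<union> B * C"] by auto
  qed
  then show ?thesis using comaximal_mono[OF assms(2), of "A \<union> B * C" "A \<union> B * C"] r_extensive[of "A \<union> B * C"]
    by auto
qed

lemma comaximal_pow: "r (A \<union> B) = UNIV \<Longrightarrow> r (A \<union> B ^ n) = UNIV"
proof (induction n)
  case 0
  have "1 \<in> r (A \<union> 1)" using r_extensive[of "A \<union> 1"] one_in_set_one by blast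
  then show ?case by (simp add: r_eq_UNIV_iff)
qed (simp add: comaximal_times)

section \<open>Regular and invertible ideals\<close>

lemma regular_one: "regular_element r 1"
  by (simp add: regular_element_def cancellative_def)

lemma regular_mult: "regular_element r x \<Longrightarrow> regular_element r y \<Longrightarrow> regular_element r (x * y)"
proof -
  assume x: "regular_element r x" and y: "regular_element r y"
  have "cancellative (x * y)"
    using x y unfolding regular_element_def cancellative_def by (metis mult.assoc)
  moreover have "r ((x * y) *o A) = (x * y) *o r A" for A
    using x y by (simp add: regular_element_def set_times_rearrange2[of x y, symmetric])
  ultimately show "regular_element r (x * y)" by (simp add: regular_element_def)
qed

lemma regular_r_elt: "regular_element r y \<Longrightarrow> r (y *o X) = y *o r X"
  by (simp add: regular_element_def)

lemma regular_elt_subset_iff: "regular_element r y \<Longrightarrow> y *o A \<subseteq> y *o B \<longleftrightarrow> A \<subseteq> B"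
  unfolding elt_set_times_def regular_element_def cancellative_def by blast

lemma regular_r_ideal_mono: "regular_r_ideal r I \<Longrightarrow> I \<subseteq> J \<Longrightarrow> r_ideal r J \<Longrightarrow> regular_r_ideal r J"
  by (auto simp: regular_r_ideal_def)

lemma regular_r_ideal_UNIV: "regular_r_ideal r UNIV"
  using regular_one by (auto simp: regular_r_ideal_def)

lemma regular_r_ideal_times: "regular_r_ideal r I \<Longrightarrow> regular_r_ideal r J \<Longrightarrow> regular_r_ideal r (r (I * J))"
  using regular_mult r_extensive[of "I * J"] unfolding regular_r_ideal_def by (meson r_ideal_r set_times_intro subsetD)

lemma regular_r_ideal_pow: "regular_r_ideal r I \<Longrightarrow> regular_r_ideal r (r (I ^ n))"
proof (induction n)
  case 0 then show ?case by (simp add: regular_r_ideal_UNIV)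
next
  case (Suc n)
  then show ?case using regular_r_ideal_times[of I "r (I ^ n)"] by simp
qed

lemma regular_r_idealD: "regular_r_ideal r I \<Longrightarrow> r_ideal r I"
  by (simp add: regular_r_ideal_def)

lemma r_invertibleD: "r_invertible r I \<Longrightarrow> r_ideal r I"
  by (simp add: r_invertible_def)

lemma r_fin_generatedD: "r_fin_generated r I \<Longrightarrow> r_ideal r I"
  by (simp add: r_fin_generated_def)

lemma r_fin_generatedI: "finite E \<Longrightarrow> r_fin_generated r (r E)"
  using r_extensive[of E] by (auto simp: r_fin_generated_def)

lemma r_fin_generatedE:
  assumes "r_fin_generated r I" obtains E where "finite E" "I = r E"
  using assms by (auto simp: r_fin_generated_def)

lemma r_fin_generated_Un: "r_fin_generated r I \<Longrightarrow> r_fin_generated r J \<Longrightarrow> r_fin_generated r (r (I \<union> J))"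
  by (metis finite_UnI r_fin_generatedE r_fin_generatedI r_r_Un r_Un_r)

lemma r_invertible_regular:
  assumes "r_invertible r I" shows "regular_r_ideal r I"
proof -
  obtain J y where J: "r_ideal r I" "regular_element r y" "r (I * J) = y *o UNIV"
    using assms by (auto simp: r_invertible_def)
  have "y * 1 \<in> r (I * J)" unfolding J(3) by blast
  then have "y \<in> I" using r_least[OF J(1), of "I * J"] r_ideal_times_subset(1)[OF J(1), of I J] by auto
  then show ?thesis using J by (auto simp: regular_r_ideal_def)
qed

lemma r_invertible_principal: "regular_element r y \<Longrightarrow> r_invertible r (y *o UNIV)"
  unfolding r_invertible_def
  by (intro conjI exI[of _ UNIV] exI[of _ y]) (auto simp: r_ideal_def regular_r_elt)

text \<open>Multiplication by the cofactor \<open>J\<close> replaces \<open>I\<close> by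
  \<open>y\<close>. A regular \<open>y\<close> commutes with the closure and can then be cancelled
  elementwise.\<close>

lemma r_invertible_cancel:
  assumes "r_invertible r I" "r (I * A) \<subseteq> r (I * B)"
  shows "r A \<subseteq> r B"
proof -
  obtain J y where J: "regular_element r y" "r (I * J) = y *o UNIV"
    using assms by (auto simp: r_invertible_def)
  have eq: "r (J * (I * X)) = y *o r X" for X
  proof -
    have "r (J * (I * X)) = r (r (I * J) * X)" unfolding r_r_times by (simp only: mult_ac)
    also have "\<dots> = r (y *o (UNIV * X))" unfolding J(2) set_times_rearrange3 ..
    also have "\<dots> = y *o r X" unfolding regular_r_elt[OF J(1)] by simp
    finally show ?thesis .
  qed
  have "r (J * (I * A)) \<subseteq> r (J * (I * B))" using assms(2) by (rule r_times_mono_left)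
  then show ?thesis unfolding eq using J(1) regular_elt_subset_iff by blast
qed

lemma r_invertible_cancel_eq:
  "r_invertible r I \<Longrightarrow> r (I * A) = r (I * B) \<Longrightarrow> r A = r B"
  using r_invertible_cancel by blast

lemma r_invertible_factor:
  assumes "r_invertible r (r (A * B))" "r_ideal r A"
  shows "r_invertible r A"
proof -
  obtain J y where "regular_element r y" "r (r (A * B) * J) = y *o UNIV"
    using assms by (auto simp: r_invertible_def)
  then have "regular_element r y \<and> r (A * (B * J)) = y *o UNIV" by (simp add: mult.assoc)
  then show ?thesis using assms(2) unfolding r_invertible_def by blast
qed

lemma r_invertible_times:
  assumes "r_invertible r I" "r_invertible r J"
  shows "r_invertible r (r (I * J))"
proof -
  obtain A x where A: "regular_element r x" "r (I * A) = x *o UNIV"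
    using assms by (auto simp: r_invertible_def)
  obtain B y where B: "regular_element r y" "r (J * B) = y *o UNIV"
    using assms by (auto simp: r_invertible_def)
  have "r (r (I * J) * (A * B)) = r (r (I * A) * r (J * B))"
    unfolding r_r_times r_times_r by (simp only: mult_ac)
  also have "\<dots> = (x * y) *o UNIV"
    using regular_mult[OF A(1) B(1)] unfolding A B by (simp add: set_times_rearrange regular_r_elt)
  finally show ?thesis unfolding r_invertible_def using regular_mult[OF A(1) B(1)] r_ideal_r by blast
qed

lemma r_invertible_UNIV: "r_invertible r UNIV"
  using r_invertible_principal[OF regular_one] by simp

lemma r_invertible_pow: "r_invertible r I \<Longrightarrow> r_invertible r (r (I ^ n))"
proof (induction n)
  case (Suc n)
  then show ?case using r_invertible_times[of I "r (I ^ n)"] by simp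
qed (simp add: r_invertible_UNIV)

text \<open>To contain is to divide. The cofactor is \<open>r (J * A)\<close> divided by
  \<open>y\<close>; no fractions arise, since \<open>J * A\<close> lies in
  \<open>r (I * J) = y *o UNIV\<close>.\<close>

lemma r_invertible_divides:
  assumes "r_invertible r I" "A \<subseteq> I"
  shows "\<exists>B. r_ideal r B \<and> r A = r (I * B)"
proof -
  obtain J y where J: "regular_element r y" "r (I * J) = y *o UNIV"
    using assms by (auto simp: r_invertible_def)
  define B where "B = {b. y * b \<in> r (J * A)}"
  have "r (J * A) \<subseteq> y *o UNIV"
    using set_times_mono2[OF assms(2), of J J] unfolding J(2)[symmetric]
    by (intro r_mono) (simp add: mult.commute)
  then have yB: "r (J * A) = y *o B" by (auto simp: B_def elt_set_times_def)
  have "y *o r B = y *o B" using J(1) yB by (metis r_idem regular_r_elt)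
  then have B: "r_ideal r B" using regular_elt_subset_iff[OF J(1)] unfolding r_ideal_def by blast
  have "y *o r (I * B) = r (I * (y *o B))" using J(1) by (simp add: set_times_rearrange4 regular_r_elt)
  also have "\<dots> = r (r (I * J) * A)" unfolding yB[symmetric] r_r_times r_times_r by (simp only: mult_ac)
  also have "\<dots> = y *o r A" using J(1) by (simp add: J(2) set_times_rearrange3 regular_r_elt)
  finally have "r (I * B) = r A" using regular_elt_subset_iff[OF J(1)] by blast
  then show ?thesis using B by auto
qed

text \<open>By finitarity \<open>y\<close> already lies in the closure of \<open>F * J\<close> for a
  finite \<open>F\<close> inside \<open>I\<close>. So \<open>F * J\<close> and \<open>I * J\<close>
  have the same closure, and \<open>J\<close> can be cancelled.\<close>

lemma r_invertible_fin_generated: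
  assumes "r_invertible r I" shows "r_fin_generated r I"
proof -
  obtain J y where J: "r_ideal r I" "regular_element r y" "r (I * J) = y *o UNIV"
    using assms by (auto simp: r_invertible_def)
  have "y * 1 \<in> r (I * J)" unfolding J(3) by blast
  then obtain E where "finite E" "E \<subseteq> I * J" "y \<in> r E" using r_finite[of "{y}" "I * J"] by auto
  then obtain F G where F: "finite F" "F \<subseteq> I" "G \<subseteq> J" "E \<subseteq> F * G" using finite_subset_times by metis
  have "y \<in> r (F * J)" using F \<open>y \<in> r E\<close> r_mono[of E "F * J"] set_times_mono2[of F F G J] by auto
  then have "y *o UNIV \<subseteq> r (F * J)" using r_mult_closed[of y "F * J"] by (auto simp: elt_set_times_def mult.commute)
  then have "r (r J * I) \<subseteq> r (r J * F)" using J by (simp add: mult.commute)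
  moreover have "r_invertible r (r J)"
    unfolding r_invertible_def using J by (intro conjI exI[of _ I] exI[of _ y]) (auto simp: mult.commute)
  ultimately have "r I \<subseteq> r F" by (rule r_invertible_cancel[rotated])
  then have "I = r F" using J(1) F(2) r_mono[of F I] by (auto simp: r_ideal_def)
  then show ?thesis using F(1) r_fin_generatedI by auto
qed

text \<open>The finitely many generators of \<open>r (I * B)\<close> involve only a finite part
  \<open>G\<close> of \<open>B\<close>; cancelling \<open>I\<close> shows that \<open>G\<close>
  generates \<open>B\<close>.\<close>

lemma r_fin_generated_cofactor:
  assumes "r_invertible r I" "r_fin_generated r (r (I * B))" "r_ideal r B"
  shows "r_fin_generated r B"
proof -
  obtain E where E: "finite E" "r (I * B) = r E" using assms(2) by (auto elim: r_fin_generatedE)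
  then have "E \<subseteq> r (I * B)" using r_extensive[of E] by simp
  then obtain D where D: "finite D" "D \<subseteq> I * B" "E \<subseteq> r D" using r_finite[OF E(1)] by metis
  then obtain F G where F: "finite G" "F \<subseteq> I" "G \<subseteq> B" "D \<subseteq> F * G" using finite_subset_times by metis
  have "r (I * B) \<subseteq> r D" using D E r_subset_iff by simp
  also have "\<dots> \<subseteq> r (I * G)" using F set_times_mono2[of F I G G] by (intro r_mono) auto
  finally have "r B \<subseteq> r G" by (rule r_invertible_cancel[OF assms(1)])
  then have "B = r G" using assms(3) F(3) r_mono[of G B] by (auto simp: r_ideal_def)
  then show ?thesis using F(1) r_fin_generatedI by auto
qed

section \<open>Prime and maximal ideals\<close>

text \<open>Avoiding finite sets instead of single elements covers maximal ideals, primes disjoint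
  from a multiplicative set and primes above no ideal of a given finitely generated kind. Finiteness
  is what lets unions of chains avoid them too.\<close>

lemma exists_maximal_avoiding:
  assumes "r_ideal r I" and fin: "\<And>F. F \<in> \<F> \<Longrightarrow> finite F" and avoid: "\<And>F. F \<in> \<F> \<Longrightarrow> \<not> F \<subseteq> I"
  shows "\<exists>P. r_ideal r P \<and> I \<subseteq> P \<and> (\<forall>F\<in>\<F>. \<not> F \<subseteq> P) \<and> (\<forall>N. r_ideal r N \<and> P \<subset> N \<longrightarrow> (\<exists>F\<in>\<F>. F \<subseteq> N))"
proof -
  define \<A> where "\<A> = {P. r_ideal r P \<and> I \<subseteq> P \<and> (\<forall>F\<in>\<F>. \<not> F \<subseteq> P)}"
  have "\<exists>P\<in>\<A>. \<forall>N\<in>\<A>. P \<subseteq> N \<longrightarrow> N = P"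
  proof (rule subset_Zorn_nonempty)
    show "\<A> \<noteq> {}" using assms by (auto simp: \<A>_def)
    fix \<C> assume ne: "\<C> \<noteq> {}" and chain: "subset.chain \<A> \<C>"
    have dir: "\<exists>C\<in>\<C>. A \<union> B \<subseteq> C" if "A \<in> \<C>" "B \<in> \<C>" for A B
      using chain that unfolding subset_chain_def by (metis Un_absorb1 Un_absorb2 order_refl)
    have sub: "\<C> \<subseteq> \<A>" using chain by (simp add: subset_chain_def)
    then have "r_ideal r (\<Union>\<C>)" by (intro r_ideal_directed_Union ne dir) (auto simp: \<A>_def)
    moreover have "\<not> F \<subseteq> \<Union>\<C>" if F: "F \<in> \<F>" for F
    proof
      assume "F \<subseteq> \<Union>\<C>"
      then obtain C where "C \<in> \<C>" "F \<subseteq> C" using finite_subset_directed_Union[OF fin[OF F] _ ne dir] by metis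
      then show False using sub F by (auto simp: \<A>_def)
    qed
    moreover have "I \<subseteq> \<Union>\<C>" using ne sub by (fastforce simp: \<A>_def)
    ultimately show "\<Union>\<C> \<in> \<A>" unfolding \<A>_def by blast
  qed
  then obtain P where P: "P \<in> \<A>" "\<And>N. N \<in> \<A> \<Longrightarrow> P \<subseteq> N \<Longrightarrow> N = P" by blast
  have "\<exists>F\<in>\<F>. F \<subseteq> N" if "r_ideal r N" "P \<subset> N" for N
    using P(1) P(2)[of N] that unfolding \<A>_def by blast
  then show ?thesis using P(1) unfolding \<A>_def by blast
qed

text \<open>Krull's argument: if \<open>x * y\<close> is in \<open>P\<close> but \<open>x\<close>
  and \<open>y\<close> are not, adjoining either one captures a member of \<open>\<F>\<close>, and
  the product of the two enlarged ideals falls back into \<open>P\<close>.\<close>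

lemma exists_prime_avoiding:
  assumes "r_ideal r I" and fin: "\<And>F. F \<in> \<F> \<Longrightarrow> finite F" and avoid: "\<And>F. F \<in> \<F> \<Longrightarrow> \<not> F \<subseteq> I"
    and ne: "\<F> \<noteq> {}" and mult: "\<And>F G. F \<in> \<F> \<Longrightarrow> G \<in> \<F> \<Longrightarrow> \<exists>H\<in>\<F>. H \<subseteq> r (F * G)"
  shows "\<exists>P. prime_r_ideal r P \<and> I \<subseteq> P \<and> (\<forall>F\<in>\<F>. \<not> F \<subseteq> P)"
proof -
  obtain P where P: "r_ideal r P" "I \<subseteq> P" "\<forall>F\<in>\<F>. \<not> F \<subseteq> P"
    and max: "\<And>N. r_ideal r N \<Longrightarrow> P \<subset> N \<Longrightarrow> \<exists>F\<in>\<F>. F \<subseteq> N"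
    using exists_maximal_avoiding[OF assms(1-3)] by metis
  have "x \<in> P \<or> y \<in> P" if xy: "x * y \<in> P" for x y
  proof (rule ccontr)
    assume no: "\<not> (x \<in> P \<or> y \<in> P)"
    have ext: "\<exists>F\<in>\<F>. F \<subseteq> r (insert z P)" if "z \<notin> P" for z
      using that r_extensive[of "insert z P"] by (intro max) auto
    obtain F where F: "F \<in> \<F>" "F \<subseteq> r (insert x P)" using ext no by blast
    obtain G where G: "G \<in> \<F>" "G \<subseteq> r (insert y P)" using ext no by blast
    obtain H where H: "H \<in> \<F>" "H \<subseteq> r (F * G)" using mult F(1) G(1) by blast
    have "insert x P * insert y P \<subseteq> P"
      using xy P(1) by (auto simp: set_times_subset_iff intro: r_ideal_mult r_ideal_mult')
    then have "r (insert x P * insert y P) \<subseteq> P" using P(1) by (simp add: r_least)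
    moreover have "r (F * G) \<subseteq> r (insert x P * insert y P)"
      using r_times_mono[of F "insert x P" G "insert y P"] F(2) G(2) by (simp add: r_subset_iff)
    ultimately show False using H P(3) by blast
  qed
  moreover have "P \<noteq> UNIV" using ne P(3) by auto
  ultimately show ?thesis using P unfolding prime_r_ideal_def by blast
qed

lemma exists_r_maximal:
  assumes "r_ideal r I" "I \<noteq> UNIV" shows "\<exists>M. r_maximal r M \<and> I \<subseteq> M"
proof -
  obtain P where P: "r_ideal r P" "I \<subseteq> P" "1 \<notin> P" "\<And>N. r_ideal r N \<Longrightarrow> P \<subset> N \<Longrightarrow> 1 \<in> N"
    using exists_maximal_avoiding[of I "{{1}}"] assms by (auto simp: r_ideal_UNIV_iff)
  then have "r_maximal r P" unfolding r_maximal_def using r_ideal_UNIV_iff by blast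
  then show ?thesis using P(2) by blast
qed

lemma r_maximal_comaximal:
  assumes "r_maximal r M" "\<not> A \<subseteq> M" shows "r (M \<union> A) = UNIV"
proof (rule ccontr)
  assume "r (M \<union> A) \<noteq> UNIV"
  then have "r (M \<union> A) = M" using assms(1) r_extensive[of "M \<union> A"] unfolding r_maximal_def by simp
  then show False using assms(2) r_extensive[of "M \<union> A"] by auto
qed

lemma r_maximal_prime:
  assumes M: "r_maximal r M" shows "prime_r_ideal r M"
proof -
  have "x \<in> M \<or> y \<in> M" if "x * y \<in> M" for x y
  proof (rule ccontr)
    assume "\<not> (x \<in> M \<or> y \<in> M)"
    then have "r (M \<union> {x} * {y}) = UNIV"
      using r_maximal_comaximal[OF M, of "{x}"] r_maximal_comaximal[OF M, of "{y}"]
      by (intro comaximal_times) auto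
    moreover have "M \<union> {x} * {y} = M" using that by (auto simp: set_times_def)
    ultimately show False using M by (auto simp: r_maximal_def r_ideal_def)
  qed
  then show ?thesis using M unfolding prime_r_ideal_def r_maximal_def by blast
qed

lemma eq_UNIV_if_no_r_maximal:
  assumes "r_ideal r I" "\<And>M. r_maximal r M \<Longrightarrow> I \<subseteq> M \<Longrightarrow> False" shows "I = UNIV"
  using exists_r_maximal[OF assms(1)] assms(2) by blast

lemma prime_r_idealD: "prime_r_ideal r P \<Longrightarrow> r_ideal r P"
  by (simp add: prime_r_ideal_def)

lemma prime_one: "prime_r_ideal r P \<Longrightarrow> 1 \<notin> P"
  using r_ideal_UNIV_iff by (auto simp: prime_r_ideal_def)

lemma prime_mult: "prime_r_ideal r P \<Longrightarrow> x * y \<in> P \<longleftrightarrow> x \<in> P \<or> y \<in> P"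
  unfolding prime_r_ideal_def by (meson r_ideal_mult r_ideal_mult')

lemma prime_times_subset: "prime_r_ideal r P \<Longrightarrow> A * B \<subseteq> P \<Longrightarrow> A \<subseteq> P \<or> B \<subseteq> P"
  using prime_mult by (fastforce simp: set_times_subset_iff)

lemma prime_r_times_subset: "prime_r_ideal r P \<Longrightarrow> r (A * B) \<subseteq> P \<Longrightarrow> A \<subseteq> P \<or> B \<subseteq> P"
  using prime_times_subset r_extensive by (meson subset_trans)

lemma prime_power: "prime_r_ideal r P \<Longrightarrow> x ^ n \<in> P \<Longrightarrow> x \<in> P"
  by (induction n) (auto simp: prime_mult dest: prime_one)

lemma prime_prod_list: "prime_r_ideal r P \<Longrightarrow> prod_list As \<subseteq> P \<Longrightarrow> \<exists>A\<in>set As. A \<subseteq> P"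
proof (induction As)
  case Nil
  then show ?case using prime_one by (auto simp: set_one)
next
  case (Cons A As)
  then show ?case using prime_times_subset[of P A "prod_list As"] by auto
qed

lemma prime_radical: "prime_r_ideal r P \<Longrightarrow> radical_r_ideal r P"
  unfolding radical_r_ideal_def using prime_power prime_r_idealD by blast

section \<open>Radicals\<close>

lemma subset_radical: "I \<subseteq> radical I"
  unfolding radical_def by (auto intro!: exI[of _ 1])

lemma pow_subset_if_subset_radical:
  assumes I: "r_ideal r I" and "finite E" "E \<subseteq> radical I"
  shows "\<exists>k. E ^ k \<subseteq> I"
  using assms(2,3)
proof (induction E rule: finite_induct)
  case empty
  then show ?case by (intro exI[of _ 1]) (auto simp: set_times_def)
next
  case (insert x F)
  then obtain k n where k: "F ^ k \<subseteq> I" and n: "x ^ n \<in> I" by (auto simp: radical_def)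
  \<comment> \<open>With exponent \<open>n + k\<close> each term contains either at least
    \<open>n\<close> factors \<open>x\<close> or at least \<open>k\<close> factors from
    \<open>F\<close>.\<close>
  have "{x ^ i} * F ^ (n + k - i) \<subseteq> I" if "i \<le> n + k" for i
  proof (cases "n \<le> i")
    case True
    then have "x ^ i = x ^ (i - n) * x ^ n" by (simp flip: power_add)
    then show ?thesis using r_ideal_times_subset(1)[OF I] r_ideal_mult[OF I n] by simp
  next
    case False
    then have "F ^ (n + k - i) = F ^ (n - i) * F ^ k" by (simp flip: power_add)
    then have "F ^ (n + k - i) \<subseteq> I" using r_ideal_times_subset(2)[OF I k] by simp
    then show ?thesis by (rule r_ideal_times_subset(2)[OF I])
  qed
  then have "(\<Union>i\<le>n + k. {x ^ i} * F ^ (n + k - i)) \<subseteq> I" by blast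
  then have "insert x F ^ (n + k) \<subseteq> I" using insert_pow_subset[of x F "n + k"] by (rule subset_trans[rotated])
  then show ?case by blast
qed

lemma radical_r_ideal_radical:
  assumes I: "r_ideal r I" shows "radical_r_ideal r (radical I)"
proof -
  have "r (radical I) \<subseteq> radical I"
  proof
    fix x assume "x \<in> r (radical I)"
    then have "\<exists>E. finite E \<and> E \<subseteq> radical I \<and> {x} \<subseteq> r E" by (intro r_finite) auto
    then obtain E where E: "finite E" "E \<subseteq> radical I" "x \<in> r E" by fast
    obtain k where "E ^ k \<subseteq> I" using pow_subset_if_subset_radical[OF I E(1,2)] by blast
    then have "r (r E ^ k) \<subseteq> I" unfolding r_pow_r by (simp add: r_least I)
    then have "x ^ k \<in> I" using elem_pow_set[OF E(3), of k] r_extensive[of "r E ^ k"] by blast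
    \<comment> \<open>Here \<open>k\<close> may be 0, while \<open>radical\<close> asks for a
      positive exponent.\<close>
    then have "x ^ Suc k \<in> I" using r_ideal_mult[OF I] by simp
    then show "x \<in> radical I" unfolding radical_def by (intro CollectI exI[of _ "Suc k"]) auto
  qed
  then have "r_ideal r (radical I)" using r_extensive[of "radical I"] by (auto simp: r_ideal_def)
  moreover have "x \<in> radical I" if "n \<ge> 1" "x ^ n \<in> radical I" for x n
  proof -
    obtain m where "m \<ge> 1" "(x ^ n) ^ m \<in> I" using \<open>x ^ n \<in> radical I\<close> by (auto simp: radical_def)
    then have "n * m \<ge> 1 \<and> x ^ (n * m) \<in> I" using \<open>n \<ge> 1\<close> by (simp add: power_mult)
    then show ?thesis unfolding radical_def by blast
  qed
  ultimately show ?thesis unfolding radical_r_ideal_def by blast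
qed

lemma radical_r_idealD: "radical_r_ideal r J \<Longrightarrow> r_ideal r J"
  by (simp add: radical_r_ideal_def)

lemma r_ideal_radical: "r_ideal r I \<Longrightarrow> r_ideal r (radical I)"
  by (simp add: radical_r_ideal_radical radical_r_idealD)

text \<open>Exponent 0 is harmless, as \<open>1 \<in> J\<close> makes \<open>J\<close> the whole
  monoid; this spares later arguments a case distinction.\<close>

lemma radical_power: "radical_r_ideal r J \<Longrightarrow> x ^ n \<in> J \<Longrightarrow> x \<in> J"
proof (cases "n = 0")
  case True
  assume J: "radical_r_ideal r J" "x ^ n \<in> J"
  then have "J = UNIV" using True r_ideal_UNIV_iff[of J] by (simp add: radical_r_ideal_def)
  then show ?thesis by simp
next
  case False
  assume "radical_r_ideal r J" "x ^ n \<in> J"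
  moreover have "n \<ge> 1" using False by simp
  ultimately show ?thesis unfolding radical_r_ideal_def by blast
qed

lemma radical_pow_subset: "radical_r_ideal r J \<Longrightarrow> A ^ n \<subseteq> J \<Longrightarrow> A \<subseteq> J"
  using elem_pow_set radical_power by blast

lemma radical_least: "radical_r_ideal r J \<Longrightarrow> I \<subseteq> J \<Longrightarrow> radical I \<subseteq> J"
  unfolding radical_def using radical_power by blast

lemma radical_UNIV_iff: "r_ideal r I \<Longrightarrow> radical I = UNIV \<longleftrightarrow> I = UNIV"
proof
  assume I: "r_ideal r I" and "radical I = UNIV"
  then have "1 \<in> radical I" by simp
  then show "I = UNIV" using r_ideal_UNIV_iff[OF I] by (auto simp: radical_def)
qed (use subset_radical[of I] in auto)

lemma radical_Inter: "(\<And>J. J \<in> \<A> \<Longrightarrow> radical_r_ideal r J) \<Longrightarrow> radical_r_ideal r (\<Inter>\<A>)"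
  using r_Inter[of \<A>] unfolding radical_r_ideal_def by blast

lemma radical_r_ideal_UNIV: "radical_r_ideal r UNIV"
  by (simp add: radical_r_ideal_def)

lemma fin_generated_pow_subset:
  assumes "r_ideal r I" "r_fin_generated r A" "A \<subseteq> radical I"
  shows "\<exists>k. A ^ k \<subseteq> I"
proof -
  obtain E where E: "finite E" "A = r E" using assms(2) by (rule r_fin_generatedE)
  then have "E \<subseteq> radical I" using assms(3) r_extensive[of E] by blast
  then obtain k where "E ^ k \<subseteq> I" using pow_subset_if_subset_radical assms(1) E(1) by blast
  then have "r (A ^ k) \<subseteq> I" unfolding E(2) r_pow_r by (simp add: r_least assms(1))
  then show ?thesis using r_extensive[of "A ^ k"] by blast
qed

section \<open>Products of lists of ideals\<close>

lemma r_product_Nil [simp]: "r_product r [] = UNIV"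
  by (simp add: r_product_def)

lemma r_product_Cons: "r_product r (A # As) = r (A * r_product r As)"
  by (simp add: r_product_def)

lemma r_product_append: "r_product r (As @ Bs) = r (r_product r As * r_product r Bs)"
  by (simp add: r_product_def)

lemma r_product_singleton: "r_ideal r A \<Longrightarrow> r_product r [A] = A"
  by (simp add: r_product_Cons r_ideal_def)

lemma r_ideal_r_product [simp]: "r_ideal r (r_product r As)"
  by (simp add: r_product_def)

lemma prod_list_subset_r_product: "prod_list As \<subseteq> r_product r As"
  by (simp add: r_product_def r_extensive)

lemma r_product_subset: "A \<in> set As \<Longrightarrow> r_ideal r A \<Longrightarrow> r_product r As \<subseteq> A"
proof (induction As)
  case (Cons B Bs)
  then consider "A = B" | "A \<in> set Bs" by auto
  then have "B * r_product r Bs \<subseteq> A"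
    using Cons by cases (simp_all add: r_ideal_times_subset)
  then show ?case using Cons.prems(2) by (simp add: r_product_Cons r_least)
qed simp

lemma r_invertible_r_product: "(\<And>A. A \<in> set As \<Longrightarrow> r_invertible r A) \<Longrightarrow> r_invertible r (r_product r As)"
  by (induction As) (auto simp: r_product_Cons r_invertible_UNIV intro: r_invertible_times)

lemma r_invertible_r_product_factor:
  "r_invertible r (r_product r As) \<Longrightarrow> A \<in> set As \<Longrightarrow> r_ideal r A \<Longrightarrow> r_invertible r A"
proof (induction As)
  case (Cons B Bs)
  have "r_invertible r (r_product r Bs)"
    using Cons.prems(1) by (intro r_invertible_factor[of "r_product r Bs" B]) (auto simp: r_product_Cons mult.commute)
  moreover have "r_invertible r A" if "A = B"
    using Cons.prems that by (intro r_invertible_factor[of A "r_product r Bs"]) (auto simp: r_product_Cons)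
  ultimately show ?case using Cons by auto
qed simp

lemma regular_r_product: "(\<And>A. A \<in> set As \<Longrightarrow> regular_r_ideal r A) \<Longrightarrow> regular_r_ideal r (r_product r As)"
  by (induction As) (auto simp: r_product_Cons regular_r_ideal_UNIV intro: regular_r_ideal_times)

lemma r_product_mono: "list_all2 (\<subseteq>) As Bs \<Longrightarrow> r_product r As \<subseteq> r_product r Bs"
proof (induction rule: list_all2_induct)
  case (Cons A As B Bs)
  then show ?case unfolding r_product_Cons by (intro r_mono set_times_mono2)
qed simp

lemma r_product_filter_proper: "r_product r (filter (\<lambda>A. A \<noteq> UNIV) As) = r_product r As"
  by (induction As) (auto simp: r_product_Cons r_ideal_eq)

section \<open>Localization\<close>

text \<open>The contraction to the monoid of the localization of \<open>A\<close> at
  \<open>M\<close>. Staying inside the monoid avoids constructing a quotient monoid with an ideal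
  system on it.\<close>

definition localize :: "'a set \<Rightarrow> 'a set \<Rightarrow> 'a set" where
  "localize M A = {x. \<exists>s. s \<notin> M \<and> s * x \<in> A}"

lemma localize_finite:
  assumes M: "prime_r_ideal r M" and A: "r_ideal r A" and "finite E" "E \<subseteq> localize M A"
  shows "\<exists>s. s \<notin> M \<and> s *o E \<subseteq> A"
  using assms(3,4)
proof (induction E rule: finite_induct)
  case empty
  then show ?case using prime_one[OF M] by (auto simp: elt_set_times_def)
next
  case (insert x E)
  then obtain s t where st: "s \<notin> M" "s *o E \<subseteq> A" "t \<notin> M" "t * x \<in> A" by (auto simp: localize_def)
  have "s * t * y \<in> A" if "y \<in> insert x E" for y
  proof (cases "y = x")
    case True
    then show ?thesis using r_ideal_mult[OF A st(4), of s] by (simp add: mult.assoc)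
  next
    case False
    then have "s * y \<in> A" using that st(2) by (auto simp: elt_set_times_def)
    then show ?thesis using r_ideal_mult[OF A, of "s * y" t] by (simp add: mult_ac)
  qed
  moreover have "s * t \<notin> M" using st prime_mult[OF M] by blast
  ultimately show ?case by (intro exI[of _ "s * t"]) (auto simp: elt_set_times_def)
qed

lemma elt_r_subset: "r_ideal r A \<Longrightarrow> s *o E \<subseteq> A \<Longrightarrow> s *o r E \<subseteq> A"
  using closure_C[of s E] by (meson r_least subset_trans)

lemma r_ideal_localize:
  assumes M: "prime_r_ideal r M" and A: "r_ideal r A"
  shows "r_ideal r (localize M A)"
proof -
  have "r (localize M A) \<subseteq> localize M A"
  proof
    fix x assume "x \<in> r (localize M A)"
    then have "\<exists>E. finite E \<and> E \<subseteq> localize M A \<and> {x} \<subseteq> r E" by (intro r_finite) auto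
    then obtain E where E: "finite E" "E \<subseteq> localize M A" "x \<in> r E" by fast
    obtain s where s: "s \<notin> M" "s *o E \<subseteq> A" using localize_finite[OF M A E(1,2)] by blast
    then have "s * x \<in> A" using elt_r_subset[OF A s(2)] E(3) by (auto simp: elt_set_times_def)
    then show "x \<in> localize M A" using s(1) by (auto simp: localize_def)
  qed
  then show ?thesis using r_extensive[of "localize M A"] by (auto simp: r_ideal_def)
qed

text \<open>Finitely many generators admit a common multiplier, whereas the multipliers in
  \<open>localize\<close> may vary with the element.\<close>

lemma localize_fin_generated:
  assumes "prime_r_ideal r M" "r_ideal r A" "r_fin_generated r K" "K \<subseteq> localize M A"
  shows "\<exists>s. s \<notin> M \<and> s *o K \<subseteq> A"
proof -
  obtain E where E: "finite E" "K = r E" using assms(3) by (rule r_fin_generatedE)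
  then have "E \<subseteq> localize M A" using assms(4) r_extensive[of E] by blast
  then obtain s where "s \<notin> M" "s *o E \<subseteq> A" using localize_finite[OF assms(1,2) E(1)] by blast
  then show ?thesis using E(2) elt_r_subset[OF assms(2)] by blast
qed

text \<open>The last conjunct says that \<open>Q\<close> is minimal over \<open>I\<close>.\<close>

lemma exists_minimal_prime:
  assumes I: "r_ideal r I" "I \<noteq> UNIV"
  shows "\<exists>Q. prime_r_ideal r Q \<and> I \<subseteq> Q \<and> (\<forall>x\<in>Q. \<exists>s n. s \<notin> Q \<and> s * x ^ n \<in> I)"
proof -
  \<comment> \<open>Minimal primes over \<open>I\<close> are the complements of maximal
    multiplicative sets disjoint from \<open>I\<close>, so Zorn's lemma is applied to such
    sets.\<close>
  define \<A> where "\<A> = {S. 1 \<in> S \<and> (\<forall>x\<in>S. \<forall>y\<in>S. x * y \<in> S) \<and> S \<inter> I = {}}"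
  have "\<exists>S\<in>\<A>. \<forall>T\<in>\<A>. S \<subseteq> T \<longrightarrow> T = S"
  proof (rule subset_Zorn_nonempty)
    show "\<A> \<noteq> {}" using I r_ideal_UNIV_iff by (auto simp: \<A>_def intro!: exI[of _ "{1}"])
    fix \<C> assume ne: "\<C> \<noteq> {}" and chain: "subset.chain \<A> \<C>"
    have sub: "\<C> \<subseteq> \<A>" using chain by (simp add: subset_chain_def)
    have "x * y \<in> \<Union>\<C>" if xy: "x \<in> \<Union>\<C>" "y \<in> \<Union>\<C>" for x y
    proof -
      obtain X Y where XY: "X \<in> \<C>" "x \<in> X" "Y \<in> \<C>" "y \<in> Y" using xy by blast
      have "X \<subseteq> Y \<or> Y \<subseteq> X" using chain XY by (simp add: subset_chain_def)
      then obtain Z where "Z \<in> \<C>" "x \<in> Z" "y \<in> Z" using XY by blast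
      then show ?thesis using sub by (auto simp: \<A>_def)
    qed
    then show "\<Union>\<C> \<in> \<A>" using ne sub by (fastforce simp: \<A>_def)
  qed
  then obtain S where S: "S \<in> \<A>" and max: "\<And>T. T \<in> \<A> \<Longrightarrow> S \<subseteq> T \<Longrightarrow> T = S" by blast
  have "\<exists>Q. prime_r_ideal r Q \<and> I \<subseteq> Q \<and> (\<forall>F\<in>(\<lambda>s. {s}) ` S. \<not> F \<subseteq> Q)"
  proof (rule exists_prime_avoiding[OF I(1)])
    fix F G assume "F \<in> (\<lambda>s. {s}) ` S" "G \<in> (\<lambda>s. {s}) ` S"
    then obtain s t where st: "s \<in> S" "t \<in> S" "F = {s}" "G = {t}" by blast
    then have "s * t \<in> S" "{s * t} \<subseteq> r (F * G)" using S r_extensive[of "F * G"] by (auto simp: \<A>_def set_times_def)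
    then show "\<exists>H\<in>(\<lambda>s. {s}) ` S. H \<subseteq> r (F * G)" by blast
  qed (use S in \<open>auto simp: \<A>_def\<close>)
  then obtain Q where Q: "prime_r_ideal r Q" "I \<subseteq> Q" and "\<forall>F\<in>(\<lambda>s. {s}) ` S. \<not> F \<subseteq> Q" by metis
  then have "Q \<inter> S = {}" by auto
  have "- Q \<in> \<A>" using Q prime_mult[OF Q(1)] prime_one[OF Q(1)] by (auto simp: \<A>_def)
  then have SQ: "- Q = S" using max \<open>Q \<inter> S = {}\<close> by blast
  have "\<exists>s n. s \<notin> Q \<and> s * x ^ n \<in> I" if x: "x \<in> Q" for x
  proof (rule ccontr)
    assume no: "\<not> ?thesis"
    \<comment> \<open>The multiplicative set generated by \<open>S\<close> and \<open>x\<close>.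
      Were it disjoint from \<open>I\<close>, it would equal \<open>S\<close> by maximality, but
      \<open>x\<close> is outside \<open>S\<close>.\<close>
    define T where "T = {s * x ^ n | s n. s \<in> S}"
    have "S \<subseteq> T" using mult_1_right power_0 unfolding T_def by (metis (mono_tags, lifting) mem_Collect_eq subsetI)
    moreover have "u * v \<in> T" if uv: "u \<in> T" "v \<in> T" for u v
    proof -
      obtain s m t n where "u = s * x ^ m" "v = t * x ^ n" "s \<in> S" "t \<in> S" using uv unfolding T_def by blast
      then have "u * v = (s * t) * x ^ (m + n)" "s * t \<in> S" using S by (auto simp: power_add mult_ac \<A>_def)
      then show ?thesis unfolding T_def by blast
    qed
    moreover have "T \<inter> I = {}" using no SQ by (auto simp: T_def)
    ultimately have "T \<in> \<A>" using S by (auto simp: \<A>_def)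
    then have "T = S" using max \<open>S \<subseteq> T\<close> by blast
    moreover have "1 * x ^ 1 \<in> T" using S unfolding T_def \<A>_def by blast
    ultimately show False using SQ x by auto
  qed
  then show ?thesis using Q by blast
qed

section \<open>Radical factorization forces dimension one\<close>

text \<open>This is how the hypothesis on \<open>r\<close>-unions enters: the failure of an
  inclusion is witnessed by an invertible ideal.\<close>

lemma exists_invertible_not_subset:
  assumes "\<exists>\<A>. (\<forall>J\<in>\<A>. r_invertible r J) \<and> N = r (\<Union>\<A>)" "r_ideal r Q" "\<not> N \<subseteq> Q"
  shows "\<exists>J. r_invertible r J \<and> J \<subseteq> N \<and> \<not> J \<subseteq> Q"
proof (rule ccontr)
  assume no: "\<not> ?thesis"
  obtain \<A> where \<A>: "\<forall>J\<in>\<A>. r_invertible r J" "N = r (\<Union>\<A>)" using assms(1) by metis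
  have "\<Union>\<A> \<subseteq> Q" using no \<A> r_extensive[of "\<Union>\<A>"] by blast
  then show False using assms(2,3) \<A>(2) by (simp add: r_least)
qed

text \<open>This is the only use of modularity.\<close>

lemma modular_invertible:
  assumes mod: "modular r" and K: "r_invertible r K" and J: "r_ideal r J"
    and s: "s *o K \<subseteq> r (J \<union> K * K)"
  shows "\<exists>T. r_ideal r T \<and> J \<inter> K = r (K * T) \<and> s \<in> r (K \<union> T)"
proof -
  have Ki: "r_ideal r K" using K by (rule r_invertibleD)
  obtain T where T: "r_ideal r T" "r (J \<inter> K) = r (K * T)"
    using r_invertible_divides[OF K, of "J \<inter> K"] by auto
  then have JK: "J \<inter> K = r (K * T)" using r_Int[OF J Ki] by (simp add: r_ideal_eq)
  have "r (K * K) \<subseteq> K" using Ki by (simp add: r_least r_ideal_times_subset)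
  \<comment> \<open>As \<open>K * K\<close> lies inside \<open>K\<close>, modularity splits the
    intersection into \<open>K * K\<close> and \<open>J \<inter> K\<close>, both multiples of
    \<open>K\<close>; cancelling \<open>K\<close> leaves \<open>r (K \<union> T)\<close>.\<close>
  then have "r (r (K * K) \<union> J) \<inter> K \<subseteq> r (r (K * K) \<union> (J \<inter> K))"
    using mod Ki J unfolding modular_def by (metis r_ideal_r)
  moreover have "s *o K \<subseteq> K" using Ki by (auto simp: elt_set_times_def r_ideal_mult)
  moreover have "r (r (K * K) \<union> (J \<inter> K)) = r (K * (K \<union> T))"
    unfolding JK r_r_Un r_Un_r set_times_Un_distrib ..
  ultimately have "K * {s} \<subseteq> r (K * (K \<union> T))"
    using s by (simp add: elt_set_times_eq mult.commute Un_commute) blast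
  then have "r (K * {s}) \<subseteq> r (K * (K \<union> T))" by (simp add: r_subset_iff)
  then have "r {s} \<subseteq> r (K \<union> T)" by (rule r_invertible_cancel[OF K])
  then show ?thesis using T JK r_extensive[of "{s}"] by blast
qed

text \<open>The cases count the factors inside \<open>M\<close>: none, one, or at least two. Factors
  outside \<open>M\<close> are units locally, and the multiplier \<open>s\<close> collects one
  element from each.\<close>

lemma r_product_at_prime_cases:
  assumes M: "prime_r_ideal r M" and "\<And>A. A \<in> set As \<Longrightarrow> r_ideal r A"
  shows "(\<exists>s. s \<notin> M \<and> s \<in> r_product r As) \<or>
    (\<exists>s A. s \<notin> M \<and> A \<in> set As \<and> A \<subseteq> M \<and> s *o A \<subseteq> r_product r As) \<or> r_product r As \<subseteq> r (M * M)"
  using assms(2)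
proof (induction As)
  case Nil
  then show ?case using prime_one[OF M] by auto
next
  case (Cons B Bs)
  have prod: "B * r_product r Bs \<subseteq> r_product r (B # Bs)" by (simp add: r_product_Cons r_extensive)
  consider (unit) s where "s \<notin> M" "s \<in> r_product r Bs"
    | (one) s A where "s \<notin> M" "A \<in> set Bs" "A \<subseteq> M" "s *o A \<subseteq> r_product r Bs"
    | (two) "r_product r Bs \<subseteq> r (M * M)"
    using Cons by (metis list.set_intros(2))
  then show ?case
  proof cases
    case unit
    show ?thesis
    proof (cases "B \<subseteq> M")
      case True
      have "s *o B \<subseteq> B * r_product r Bs" using unit by (intro set_times_mono4)
      then show ?thesis using unit True prod by (meson list.set_intros(1) subset_trans)
    next
      case False
      then obtain b where "b \<in> B" "b \<notin> M" by blast
      then have "b * s \<notin> M" "b * s \<in> B * r_product r Bs" using unit prime_mult[OF M] by auto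
      then show ?thesis using prod by blast
    qed
  next
    case one
    show ?thesis
    proof (cases "B \<subseteq> M")
      case True
      have "r_product r Bs \<subseteq> M" using r_product_subset[OF one(2)] one Cons.prems by fastforce
      then have "r_product r (B # Bs) \<subseteq> r (M * M)"
        unfolding r_product_Cons using True by (intro r_mono set_times_mono2)
      then show ?thesis by blast
    next
      case False
      then obtain b where b: "b \<in> B" "b \<notin> M" by blast
      have "(b * s) *o A = b *o (s *o A)" by (simp add: set_times_rearrange2)
      also have "\<dots> \<subseteq> B * r_product r Bs" using one b(1) by (intro set_times_mono5)
      also note prod
      finally show ?thesis using one b prime_mult[OF M] by (meson list.set_intros(2))
    qed
  next
    case two
    have "r_product r (B # Bs) \<subseteq> r_product r Bs"
      by (simp add: r_product_Cons r_least r_ideal_times_subset)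
    then show ?thesis using two by blast
  qed
qed

text \<open>Every factor contains \<open>radical I\<close>. If only one factor lies in
  \<open>M\<close>, some \<open>s\<close> outside \<open>M\<close> multiplies it into
  \<open>I\<close>, and with it \<open>radical I\<close>: locally \<open>I\<close> is radical.
  \<open>I \<subseteq> M\<close> excludes the case of no such factor.\<close>

lemma radical_product_at_prime_cases:
  assumes M: "prime_r_ideal r M" and "r_product_of_radicals r I" "I \<subseteq> M"
  shows "I \<subseteq> r (M * M) \<or> (\<exists>s. s \<notin> M \<and> s *o radical I \<subseteq> I)"
proof -
  obtain As where As: "\<And>A. A \<in> set As \<Longrightarrow> radical_r_ideal r A" "I = r_product r As"
    using assms(2) by (auto simp: r_product_of_radicals_def)
  have "radical I \<subseteq> A" if "A \<in> set As" for A
    using As that r_product_subset[OF that] by (intro radical_least) (auto dest: radical_r_idealD)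
  then have "s *o radical I \<subseteq> s *o A" if "A \<in> set As" for s A
    using that by (intro set_times_mono) auto
  then show ?thesis
    using r_product_at_prime_cases[OF M, of As] As assms(3) radical_r_idealD by (metis subsetD subset_trans)
qed

lemma pow_subset_localize_r_product:
  assumes "prime_r_ideal r M" "\<And>A. A \<in> set As \<Longrightarrow> M \<subseteq> localize M A"
  shows "M ^ length As \<subseteq> localize M (r_product r As)"
  using assms(2)
proof (induction As)
  case Nil
  then show ?case using prime_one[OF assms(1)] by (auto simp: localize_def)
next
  case (Cons A As)
  have "x * y \<in> localize M (r_product r (A # As))" if xy: "x \<in> M" "y \<in> M ^ length As" for x y
  proof -
    obtain s where s: "s \<notin> M" "s * x \<in> A" using Cons.prems[of A] xy(1) by (auto simp: localize_def)
    obtain t where t: "t \<notin> M" "t * y \<in> r_product r As" 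
      using Cons.IH[OF Cons.prems] xy(2) by (auto simp: localize_def)
    have "(s * x) * (t * y) \<in> A * r_product r As" using s t by (intro set_times_intro)
    then have "(s * t) * (x * y) \<in> r_product r (A # As)"
      using r_extensive[of "A * r_product r As"] by (auto simp: r_product_Cons mult_ac)
    then show ?thesis using s t prime_mult[OF assms(1)] unfolding localize_def by blast
  qed
  then show ?case by (auto simp: set_times_subset_iff)
qed

text \<open>\<open>J\<close> has order exactly one at \<open>M\<close>. This forces every invertible
  ideal inside \<open>P\<close> into \<open>J\<close> locally. For a radical one, \<open>K\<close>,
  dividing \<open>t *o K\<close> by \<open>J\<close> leaves a cofactor that is again locally in
  \<open>K\<close>, so \<open>K\<close> can be cancelled and \<open>J\<close> meets the complement
  of \<open>M\<close>.\<close>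

lemma no_prime_below_with_simple_invertible:
  assumes mod: "modular r"
    and gen: "\<And>I. regular_r_ideal r I \<Longrightarrow> \<exists>\<A>. (\<forall>J \<in> \<A>. r_invertible r J) \<and> I = r (\<Union>\<A>)"
    and fact: "\<And>I. regular_r_ideal r I \<Longrightarrow> r_product_of_radicals r I"
    and P: "regular_r_ideal r P" "prime_r_ideal r P" and M: "prime_r_ideal r M" "P \<subseteq> M"
    and J: "r_invertible r J" "J \<subseteq> M" "\<not> J \<subseteq> P" "\<not> J \<subseteq> r (M * M)"
  shows False
proof -
  have Ji: "r_ideal r J" using J(1) by (rule r_invertibleD)
  have Mi: "r_ideal r M" using M(1) by (rule prime_r_idealD)
  \<comment> \<open>As \<open>J\<close> escapes \<open>r (M * M)\<close>, so does \<open>I\<close>,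
    and \<open>I\<close> is locally radical at \<open>M\<close>; hence \<open>K\<close> lies locally
    in \<open>r (J \<union> K * K)\<close>. Modularity then discards \<open>K * K\<close>, in the
    manner of Nakayama.\<close>
  have step: "\<exists>t. t \<notin> M \<and> t *o K \<subseteq> J" if K: "r_invertible r K" "K \<subseteq> P" for K
  proof -
    define I where "I = r (J \<union> K * K)"
    have JI: "J \<subseteq> I" and KI: "K * K \<subseteq> I" using r_extensive[of "J \<union> K * K"] by (auto simp: I_def)
    have "regular_r_ideal r I"
      using regular_r_ideal_mono[OF r_invertible_regular[OF J(1)] JI] by (simp add: I_def)
    moreover have KM: "K \<subseteq> M" using K(2) M(2) by blast
    then have "I \<subseteq> M" using J(2) r_ideal_times_subset[OF Mi] unfolding I_def by (simp add: r_least Mi)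
    ultimately obtain s where s: "s \<notin> M" "s *o radical I \<subseteq> I"
      using radical_product_at_prime_cases[OF M(1) fact] JI J(4) by blast
    have "K \<subseteq> radical I"
    proof
      fix x assume "x \<in> K"
      then have "x ^ 2 \<in> I" using KI by (auto simp: power2_eq_square)
      then show "x \<in> radical I" unfolding radical_def by (intro CollectI exI[of _ 2]) auto
    qed
    then have "s *o K \<subseteq> r (J \<union> K * K)" using s(2) set_times_mono[of K "radical I" s] unfolding I_def by blast
    then obtain T where T: "J \<inter> K = r (K * T)" "s \<in> r (K \<union> T)"
      using modular_invertible[OF mod K(1) Ji] by blast
    have "\<not> T \<subseteq> M" using T(2) s(1) KM r_least[OF Mi, of "K \<union> T"] by blast
    then obtain t where t: "t \<in> T" "t \<notin> M" by blast
    have "t *o K \<subseteq> K * T" using t(1) by (rule set_times_mono4)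
    then have "t *o K \<subseteq> J" using T(1) r_extensive[of "K * T"] by blast
    then show ?thesis using t by blast
  qed
  have PJ: "P \<subseteq> localize M J"
  proof (rule ccontr)
    assume "\<not> P \<subseteq> localize M J"
    then obtain K where K: "r_invertible r K" "K \<subseteq> P" "\<not> K \<subseteq> localize M J"
      using exists_invertible_not_subset[OF gen[OF P(1)] r_ideal_localize[OF M(1) Ji]] by blast
    obtain t where "t \<notin> M" "t *o K \<subseteq> J" using step K by blast
    then have "K \<subseteq> localize M J" by (auto simp: localize_def elt_set_times_def)
    then show False using K(3) by simp
  qed
  \<comment> \<open>Source of a radical invertible ideal inside \<open>P\<close>: all factors of the
    invertible ideal \<open>y *o UNIV\<close> are invertible, and the prime \<open>P\<close>
    contains one of them.\<close>
  obtain y where y: "y \<in> P" "regular_element r y" using P(1) by (auto simp: regular_r_ideal_def)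
  have yi: "r_invertible r (y *o UNIV)" using r_invertible_principal[OF y(2)] .
  obtain Bs where Bs: "\<And>B. B \<in> set Bs \<Longrightarrow> radical_r_ideal r B" "y *o UNIV = r_product r Bs"
    using fact[OF r_invertible_regular[OF yi]] by (auto simp: r_product_of_radicals_def)
  have "y *o UNIV \<subseteq> P" using y(1) r_ideal_mult'[OF prime_r_idealD[OF P(2)]] by (auto simp: elt_set_times_def)
  then have "prod_list Bs \<subseteq> P" using prod_list_subset_r_product Bs(2) by blast
  then obtain K where K: "K \<in> set Bs" "K \<subseteq> P" using prime_prod_list[OF P(2)] by blast
  have Krad: "radical_r_ideal r K" using Bs(1) K(1) .
  then have Ki: "r_ideal r K" by (rule radical_r_idealD)
  have Kinv: "r_invertible r K" using r_invertible_r_product_factor[OF _ K(1) Ki] yi Bs(2) by simp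
  obtain t where t: "t \<notin> M" "t *o K \<subseteq> J" using step Kinv K(2) by blast
  obtain T where T: "r_ideal r T" "r (t *o K) = r (J * T)" using r_invertible_divides[OF J(1) t(2)] by blast
  have "t *o K \<subseteq> K" using Ki by (auto simp: elt_set_times_def r_ideal_mult)
  then have JTK: "r (J * T) \<subseteq> K" using T(2) Ki r_least by metis
  have TP: "T \<subseteq> P" using prime_r_times_subset[OF P(2), of J T] JTK K(2) J(3) by blast
  obtain E where E: "finite E" "K = r E" using r_invertible_fin_generated[OF Kinv] by (rule r_fin_generatedE)
  have "r (J * T) = r ({t} * E)" using T(2) E(2) by (simp add: elt_set_times_eq)
  then have "r_fin_generated r (r (J * T))" using E(1) by (simp add: r_fin_generatedI finite_set_times)
  then have Tfg: "r_fin_generated r T" by (rule r_fin_generated_cofactor[OF J(1) _ T(1)])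
  \<comment> \<open>For \<open>a\<close> in \<open>T\<close> some \<open>u * a\<close> with
    \<open>u\<close> outside \<open>M\<close> lies in \<open>J\<close>, so
    \<open>(u * a) * a\<close> lies in \<open>J * T\<close>, hence in \<open>K\<close>. Thus the
    square of \<open>u * a\<close> is in the radical ideal \<open>K\<close>.\<close>
  have "T \<subseteq> localize M K"
  proof
    fix a assume a: "a \<in> T"
    then obtain u where u: "u \<notin> M" "u * a \<in> J" using TP PJ by (auto simp: localize_def)
    have "(u * a) * a \<in> K" using a u(2) JTK r_extensive[of "J * T"] by blast
    then have "u * ((u * a) * a) \<in> K" by (rule r_ideal_mult[OF Ki])
    then have "(u * a) ^ 2 \<in> K" by (simp add: power2_eq_square mult_ac)
    then show "a \<in> localize M K" using u(1) radical_power[OF Krad] by (auto simp: localize_def)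
  qed
  then obtain u where u: "u \<notin> M" "u *o T \<subseteq> K"
    using localize_fin_generated[OF M(1) Ki Tfg] by blast
  \<comment> \<open>Multiplying \<open>K\<close> by \<open>u * t\<close> lands in
    \<open>r (K * J)\<close>; cancelling \<open>K\<close> would put \<open>u * t\<close> into
    \<open>J\<close>, hence into \<open>M\<close>.\<close>
  have "r (K * {u * t}) = r ({u} * r ({t} * K))" 
  proof -
    have "{u * t} = {u} * {t}" by (auto simp: set_times_def)
    then show ?thesis unfolding r_times_r by (simp only: mult_ac)
  qed
  also have "\<dots> = r ({u} * (J * T))" using T(2) by (simp add: elt_set_times_eq)
  also have "\<dots> = r (J * (u *o T))" unfolding elt_set_times_eq by (simp only: mult_ac)
  also have "\<dots> \<subseteq> r (J * K)" using u(2) by (intro r_mono set_times_mono2) auto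
  also have "r (J * K) = r (K * J)" by (simp only: mult.commute)
  finally have "r {u * t} \<subseteq> r J" by (rule r_invertible_cancel[OF Kinv])
  then have "u * t \<in> J" using Ji r_extensive[of "{u * t}"] by (auto simp: r_ideal_eq)
  then show False using J(2) u(1) t(1) prime_mult[OF M(1)] by blast
qed

theorem regular_prime_r_maximal_if_radical_factorization:
  assumes mod: "modular r"
    and gen: "\<And>I. regular_r_ideal r I \<Longrightarrow> \<exists>\<A>. (\<forall>J \<in> \<A>. r_invertible r J) \<and> I = r (\<Union>\<A>)"
    and fact: "\<And>I. regular_r_ideal r I \<Longrightarrow> r_product_of_radicals r I"
    and P: "regular_r_ideal r P" "prime_r_ideal r P"
  shows "r_maximal r P"
proof (rule ccontr)
  assume "\<not> r_maximal r P"
  then obtain N where N: "r_ideal r N" "N \<noteq> UNIV" "P \<subseteq> N" "N \<noteq> P"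
    using P(2) unfolding r_maximal_def prime_r_ideal_def by blast
  have Pi: "r_ideal r P" using P(2) by (rule prime_r_idealD)
  obtain J where J: "r_invertible r J" "J \<subseteq> N" "\<not> J \<subseteq> P"
    using exists_invertible_not_subset[OF gen Pi, of N] N regular_r_ideal_mono[OF P(1)] by blast
  define I where "I = r (P \<union> J * J)"
  have PI: "P \<subseteq> I" and JJI: "J * J \<subseteq> I" using r_extensive[of "P \<union> J * J"] by (auto simp: I_def)
  have Ii: "r_ideal r I" by (simp add: I_def)
  have Ireg: "regular_r_ideal r I" using regular_r_ideal_mono[OF P(1) PI Ii] .
  have "I \<subseteq> N" using N(1,3) J(2) r_ideal_times_subset[OF N(1)] unfolding I_def by (simp add: r_least)
  then have "I \<noteq> UNIV" using N(2) by blast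
  then obtain M where M: "prime_r_ideal r M" "I \<subseteq> M" and min: "\<And>x. x \<in> M \<Longrightarrow> \<exists>s n. s \<notin> M \<and> s * x ^ n \<in> I"
    using exists_minimal_prime[OF Ii] by metis
  have Mi: "r_ideal r M" using M(1) by (rule prime_r_idealD)
  have JM: "J \<subseteq> M" using prime_times_subset[OF M(1), of J J] JJI M(2) by blast
  \<comment> \<open>\<open>J\<close> is not locally contained in \<open>I\<close>, although
    \<open>J * J\<close> is: modularity would put \<open>s\<close> into the join of \<open>J\<close>
    and some \<open>T\<close> inside \<open>P\<close>, both inside \<open>M\<close>. So
    \<open>I\<close> is not locally radical and must lie in \<open>r (M * M)\<close>.\<close>
  have notin: "s \<in> M" if s: "s *o J \<subseteq> I" for s
  proof -
    obtain T where T: "P \<inter> J = r (J * T)" "s \<in> r (J \<union> T)"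
      using modular_invertible[OF mod J(1) Pi s[unfolded I_def]] by blast
    have "T \<subseteq> P" using prime_r_times_subset[OF P(2), of J T] T(1) J(3) by blast
    then have "r (J \<union> T) \<subseteq> M" using JM PI M(2) Mi by (simp add: r_least)
    then show ?thesis using T(2) by blast
  qed
  have "J \<subseteq> radical I"
  proof
    fix x assume "x \<in> J"
    then have "x ^ 2 \<in> I" using JJI by (auto simp: power2_eq_square)
    then show "x \<in> radical I" unfolding radical_def by (intro CollectI exI[of _ 2]) auto
  qed
  then have "s \<in> M" if "s *o radical I \<subseteq> I" for s
    using that notin[of s] set_times_mono[of J "radical I" s] by blast
  then have "I \<subseteq> r (M * M)" using radical_product_at_prime_cases[OF M(1) fact[OF Ireg] M(2)] by blast
  then have PMM: "P \<subseteq> r (M * M)" using PI by blast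
  \<comment> \<open>Otherwise \<open>M\<close> lies in the closure of each of its powers. As
    \<open>M\<close> is minimal over \<open>I\<close>, every radical factor of \<open>I\<close>
    locally contains \<open>M\<close>, so the power of \<open>M\<close> with one factor for each of
    them lies locally in \<open>I\<close>. Then so does \<open>J\<close>, contrary to
    \<open>notin\<close>.\<close>
  have MMM: "\<not> M \<subseteq> r (M * M)"
  proof
    assume MM: "M \<subseteq> r (M * M)"
    have Mn: "M \<subseteq> r (M ^ n)" for n
    proof (induction n)
      case (Suc n)
      have "r (M * M) \<subseteq> r (M * r (M ^ n))" using Suc by (intro r_mono set_times_mono2) auto
      then show ?case using MM by simp
    qed simp
    obtain As where As: "\<And>A. A \<in> set As \<Longrightarrow> radical_r_ideal r A" "I = r_product r As"
      using fact[OF Ireg] by (auto simp: r_product_of_radicals_def)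
    have "M \<subseteq> localize M A" if A: "A \<in> set As" for A
    proof
      fix x assume "x \<in> M"
      then obtain s n where s: "s \<notin> M" "s * x ^ n \<in> I" using min by blast
      then have "s * x ^ n \<in> A" using As r_product_subset[OF A] A by (auto dest: radical_r_idealD)
      then have "(s ^ n * x) * (s * x ^ n) \<in> A" using As(1)[OF A] r_ideal_mult[of A "s * x ^ n"] by (blast dest: radical_r_idealD)
      then have "(s * x) ^ Suc n \<in> A" by (simp add: power_mult_distrib mult_ac)
      then have "s * x \<in> A" by (rule radical_power[OF As(1)[OF A]])
      then show "x \<in> localize M A" using s(1) by (auto simp: localize_def)
    qed
    then have "M ^ length As \<subseteq> localize M I" using pow_subset_localize_r_product[OF M(1)] As(2) by blast
    then have "r (M ^ length As) \<subseteq> localize M I" by (simp add: r_least r_ideal_localize M(1) Ii)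
    then have "J \<subseteq> localize M I" using JM Mn by blast
    then obtain s where "s \<notin> M" "s *o J \<subseteq> I"
      using localize_fin_generated[OF M(1) Ii r_invertible_fin_generated[OF J(1)]] by blast
    then show False using notin by blast
  qed
  have "regular_r_ideal r M" using regular_r_ideal_mono[OF P(1) _ Mi] PI M(2) by blast
  then obtain L where L: "r_invertible r L" "L \<subseteq> M" "\<not> L \<subseteq> r (M * M)"
    using exists_invertible_not_subset[OF gen r_ideal_r MMM] by blast
  moreover have "\<not> L \<subseteq> P" using L(3) PMM by blast
  moreover have "P \<subseteq> M" using PI M(2) by blast
  ultimately show False
    using no_prime_below_with_simple_invertible[OF mod gen fact P M(1)] by blast
qed

section \<open>Invertible radical ideals in dimension one\<close>

text \<open>Invertible radical ideals are squarefree: with \<open>X = TA\<close> and \<open>Y = TB\<close> the square of \<open>TAB\<close> lies in \<open>R\<close>.\<close>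

lemma coprime_factors_of_invertible_radical:
  assumes R: "radical_r_ideal r R" "r_invertible r R" "R = r (X * Y)"
    and T: "r_invertible r T" "r_ideal r X" "r_ideal r Y" "X \<subseteq> T" "Y \<subseteq> T"
  shows "T = UNIV"
proof -
  obtain A where A: "r X = r (T * A)" using r_invertible_divides[OF T(1,4)] by blast
  obtain B where B: "r Y = r (T * B)" using r_invertible_divides[OF T(1,5)] by blast
  define W where "W = T * (A * B)"
  have RW: "R = r (r W * T)"
  proof -
    have "R = r (r X * r Y)" using R(3) by simp
    also have "\<dots> = r (r W * T)" unfolding A B r_r_times r_times_r W_def by (simp only: mult_ac)
    finally show ?thesis .
  qed
  have "W ^ 2 = W * T * (A * B)" unfolding W_def by (simp add: power2_eq_square mult_ac)
  also have "\<dots> \<subseteq> R"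
    using RW R(2) r_extensive[of "W * T"] by (intro r_ideal_times_subset(1)[of R "W * T"]) (auto dest: r_invertibleD)
  finally have "W \<subseteq> R" by (rule radical_pow_subset[OF R(1)])
  then have "r (r W * UNIV) \<subseteq> r (r W * T)" using RW R(1) by (simp add: r_subset_iff)
  moreover have "r_invertible r (r W)" using R(2) unfolding RW by (rule r_invertible_factor) simp
  ultimately have "r UNIV \<subseteq> r T" using r_invertible_cancel by blast
  then show ?thesis using r_invertibleD[OF T(1)] by (auto simp: r_ideal_eq)
qed

lemma coprime_factors_comaximal:
  assumes R: "radical_r_ideal r R" "r_invertible r R" "R = r (X * Y)"
    and "r_ideal r X" "r_ideal r Y" "r_invertible r (radical (r (X \<union> Y)))"
  shows "r (X \<union> Y) = UNIV"
proof -
  have "X \<union> Y \<subseteq> radical (r (X \<union> Y))" using r_extensive[of "X \<union> Y"] subset_radical by blast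
  then have "radical (r (X \<union> Y)) = UNIV"
    using assms by (intro coprime_factors_of_invertible_radical[of R X Y]) auto
  then show ?thesis by (simp add: radical_UNIV_iff)
qed

text \<open>Comaximality of \<open>A\<close> with the quotient \<open>S\<close> of \<open>J\<close>
  by \<open>A\<close> comes from dimension one: a maximal ideal above both would contain a prime
  above \<open>J\<close> but not above \<open>A\<close>, which is regular and hence maximal
  itself.\<close>

lemma fin_generated_above_invertible_radical:
  assumes dim1: "\<And>P. regular_r_ideal r P \<Longrightarrow> prime_r_ideal r P \<Longrightarrow> r_maximal r P"
    and J: "r_invertible r J" "radical_r_ideal r J" and A: "r_fin_generated r A" "J \<subseteq> A"
  shows "r_invertible r A \<and> radical_r_ideal r A"
proof -
  obtain E where E: "finite E" "A = r E" using A(1) by (rule r_fin_generatedE)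
  have Ji: "r_ideal r J" using J(1) by (rule r_invertibleD)
  have Ai: "r_ideal r A" using A(1) by (rule r_fin_generatedD)
  define S where "S = {x. \<forall>a\<in>A. x * a \<in> J}"
  have AS: "A * S \<subseteq> J" by (auto simp: S_def set_times_subset_iff mult.commute)
  have JS: "J \<subseteq> S" using r_ideal_mult'[OF Ji] by (auto simp: S_def)
  have SI: "x \<in> S" if "x *o E \<subseteq> J" for x
    using elt_r_subset[OF Ji that] E(2) by (auto simp: S_def elt_set_times_def)
  have comax: "r (A \<union> S) = UNIV"
  proof (rule eq_UNIV_if_no_r_maximal)
    fix M assume M: "r_maximal r M" "r (A \<union> S) \<subseteq> M"
    then have AM: "A \<subseteq> M" and SM: "S \<subseteq> M" using r_extensive[of "A \<union> S"] by auto
    have Mp: "prime_r_ideal r M" using M(1) by (rule r_maximal_prime)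
    \<comment> \<open>A prime avoiding these sets lies inside \<open>M\<close> (take
      \<open>k = 0\<close>) and does not contain \<open>E\<close> (take \<open>x = 1\<close> and
      \<open>k = 1\<close>). \<open>J\<close> avoids them because
      \<open>x *o (E ^ k) \<subseteq> J\<close> gives \<open>x \<in> S\<close>, \<open>J\<close>
      being radical, and \<open>S\<close> lies inside \<open>M\<close>.\<close>
    define \<F> where "\<F> = {x *o (E ^ k) | x k. x \<notin> M}"
    have "\<exists>Q. prime_r_ideal r Q \<and> J \<subseteq> Q \<and> (\<forall>F\<in>\<F>. \<not> F \<subseteq> Q)"
    proof (rule exists_prime_avoiding[OF Ji])
      show "finite F" if "F \<in> \<F>" for F
        using that E(1) unfolding \<F>_def elt_set_times_eq by (auto intro: finite_set_times finite_set_pow)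
      show "\<not> F \<subseteq> J" if "F \<in> \<F>" for F
      proof
        assume "F \<subseteq> J"
        obtain x k where xk: "F = x *o (E ^ k)" "x \<notin> M" using \<open>F \<in> \<F>\<close> unfolding \<F>_def by blast
        have "x * a \<in> J" if "a \<in> E" for a
        proof -
          have "x * a ^ k \<in> J" using elem_pow_set[OF that, of k] xk \<open>F \<subseteq> J\<close> by (auto simp: elt_set_times_def)
          then have "(x ^ k * a) * (x * a ^ k) \<in> J" by (rule r_ideal_mult[OF Ji])
          then have "(x * a) ^ Suc k \<in> J" by (simp add: power_mult_distrib mult_ac)
          then show ?thesis by (rule radical_power[OF J(2)])
        qed
        then have "x \<in> S" by (intro SI) (auto simp: elt_set_times_def)
        then show False using SM xk(2) by blast
      qed
      show "\<F> \<noteq> {}" using prime_one[OF Mp] unfolding \<F>_def by blast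
      fix F G assume "F \<in> \<F>" "G \<in> \<F>"
      then obtain x k z l where "F = x *o (E ^ k)" "x \<notin> M" "G = z *o (E ^ l)" "z \<notin> M" unfolding \<F>_def by blast
      then have "F * G = (x * z) *o (E ^ (k + l))" "x * z \<notin> M"
        using prime_mult[OF Mp] by (auto simp: set_times_rearrange power_add)
      then have "F * G \<in> \<F>" unfolding \<F>_def by blast
      then show "\<exists>H\<in>\<F>. H \<subseteq> r (F * G)" using r_extensive[of "F * G"] by blast
    qed
    then obtain Q where Q: "prime_r_ideal r Q" "J \<subseteq> Q" and avoid: "\<forall>F\<in>\<F>. \<not> F \<subseteq> Q" by metis
    have avoid': "\<not> x *o (E ^ k) \<subseteq> Q" if "x \<notin> M" for x k using avoid that unfolding \<F>_def by blast
    have "regular_r_ideal r Q"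
      using r_invertible_regular[OF J(1)] regular_r_ideal_mono Q prime_r_idealD by blast
    then have "r_maximal r Q" using dim1 Q(1) by blast
    moreover have "Q \<subseteq> M" using avoid'[of _ 0] by (auto simp: elt_set_times_def set_one)
    ultimately have "Q = M" using M(1) unfolding r_maximal_def by blast
    then have "E \<subseteq> Q" using AM E(2) r_extensive[of E] by blast
    then show False using avoid'[of 1 1] prime_one[OF Mp] by simp
  qed simp
  have "J \<subseteq> r (A * S)"
  proof (rule comaximal_cancel[OF comax])
    show "A * J \<subseteq> r (A * S)" using JS set_times_mono2[of A A J S] r_extensive[of "A * S"] by blast
    show "S * J \<subseteq> r (A * S)"
      using A(2) set_times_mono2[of S S J A] r_extensive[of "A * S"] by (simp add: mult.commute)
  qed
  then have JAS: "J = r (A * S)" using AS Ji r_least by blast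
  then have "r_invertible r A" using J(1) r_invertible_factor Ai by blast
  \<comment> \<open>\<open>S\<close> multiplies \<open>x ^ n\<close> into \<open>J\<close>, hence,
    \<open>J\<close> being radical, also \<open>x\<close>; comaximality of \<open>A\<close> and
    \<open>S\<close> then puts \<open>x\<close> into \<open>A\<close>.\<close>
  moreover have "x \<in> A" if x: "n \<ge> 1" "x ^ n \<in> A" for x n
  proof -
    have "{x} \<subseteq> r A"
    proof (rule comaximal_cancel[OF comax])
      show "A * {x} \<subseteq> r A" using r_ideal_times_subset(1)[OF Ai, of A "{x}"] Ai by (simp add: r_ideal_eq)
      have "s * x \<in> J" if "s \<in> S" for s
      proof -
        have "s * x ^ n \<in> J" using that x(2) by (auto simp: S_def)
        then have "(s ^ n * x) * (s * x ^ n) \<in> J" by (rule r_ideal_mult[OF Ji])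
        then have "(s * x) ^ Suc n \<in> J" by (simp add: power_mult_distrib mult_ac)
        then show ?thesis by (rule radical_power[OF J(2)])
      qed
      then show "S * {x} \<subseteq> r A" using A(2) Ai by (auto simp: set_times_subset_iff r_ideal_eq)
    qed
    then show ?thesis using Ai by (simp add: r_ideal_eq)
  qed
  ultimately show ?thesis unfolding radical_r_ideal_def using Ai by blast
qed

text \<open>Divide \<open>A\<close> and \<open>B\<close> by their join \<open>D\<close>, with
  cofactors \<open>A'\<close> and \<open>B'\<close>. Then \<open>B'\<close> is comaximal with
  \<open>A'\<close> (cancel \<open>D\<close>) and with \<open>D\<close> (\<open>B\<close> is
  squarefree), hence with \<open>A\<close>, and the intersection is the product of \<open>A\<close>
  and \<open>B'\<close>.\<close>

lemma r_invertible_Int_radical: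
  assumes dim1: "\<And>P. regular_r_ideal r P \<Longrightarrow> prime_r_ideal r P \<Longrightarrow> r_maximal r P"
    and A: "r_invertible r A" "radical_r_ideal r A" and B: "r_invertible r B" "radical_r_ideal r B"
  shows "r_invertible r (A \<inter> B)"
proof -
  note fg = r_invertible_fin_generated
  have Ai: "r_ideal r A" and Bi: "r_ideal r B" using A(1) B(1) by (auto dest: r_invertibleD)
  define D where "D = r (A \<union> B)"
  have AD: "A \<subseteq> D" and BD: "B \<subseteq> D" using r_extensive[of "A \<union> B"] by (auto simp: D_def)
  have D: "r_invertible r D"
    using fin_generated_above_invertible_radical[OF dim1 A _ AD] r_fin_generated_Un[OF fg[OF A(1)] fg[OF B(1)]]
    unfolding D_def by blast
  obtain A' where A': "r_ideal r A'" "A = r (D * A')"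
    using r_invertible_divides[OF D AD] Ai by (auto simp: r_ideal_eq)
  obtain B' where B': "r_ideal r B'" "B = r (D * B')"
    using r_invertible_divides[OF D BD] Bi by (auto simp: r_ideal_eq)
  have A'inv: "r_invertible r A'" using A(1) A' by (metis mult.commute r_invertible_factor)
  have B'inv: "r_invertible r B'" using B(1) B' by (metis mult.commute r_invertible_factor)
  have AA': "A \<subseteq> A'" using A' r_ideal_times_subset(2)[of A' A' D] by (simp add: r_least)
  have BB': "B \<subseteq> B'" using B' r_ideal_times_subset(2)[of B' B' D] by (simp add: r_least)
  have "r (D * (A' \<union> B')) = r (A \<union> B)"
    unfolding A'(2) B'(2) r_r_Un r_Un_r set_times_Un_distrib ..
  also have "\<dots> = r (D * UNIV)" unfolding r_UNIV_times by (simp add: D_def)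
  finally have co1: "r (A' \<union> B') = UNIV" using r_invertible_cancel_eq[OF D] r_UNIV by metis
  \<comment> \<open>Both factors of \<open>B = r (D * B')\<close> lie in \<open>Q\<close>, which is
    invertible because it lies above \<open>B\<close>; squarefreeness of \<open>B\<close> makes
    \<open>Q\<close> trivial.\<close>
  define Q where "Q = r (D \<union> B')"
  have BQ: "B \<subseteq> Q" using BD r_extensive[of "D \<union> B'"] by (auto simp: Q_def)
  have "r_invertible r Q"
    using fin_generated_above_invertible_radical[OF dim1 B _ BQ] r_fin_generated_Un[OF fg[OF D] fg[OF B'inv]]
    unfolding Q_def by blast
  then have "Q = UNIV"
    using r_extensive[of "D \<union> B'"] B' D
    by (intro coprime_factors_of_invertible_radical[OF B(2,1) B'(2)]) (auto simp: Q_def dest: r_invertibleD)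
  then have "r (B' \<union> D * A') = UNIV"
    using co1 by (intro comaximal_times) (auto simp: Q_def Un_commute)
  then have co: "r (B' \<union> A) = UNIV" unfolding A'(2) r_Un_r .
  have "A \<inter> B \<subseteq> r (A * B')"
  proof (rule comaximal_cancel[OF co])
    show "B' * (A \<inter> B) \<subseteq> r (A * B')"
      using set_times_mono2[of B' B' "A \<inter> B" A] r_extensive[of "A * B'"] by (simp add: mult.commute)
    show "A * (A \<inter> B) \<subseteq> r (A * B')"
      using BB' set_times_mono2[of A A "A \<inter> B" B'] r_extensive[of "A * B'"] by blast
  qed
  moreover have "r (A * B') \<subseteq> B"
  proof -
    have "A * B' \<subseteq> D * B'" using AD by (intro set_times_mono2) auto
    then show ?thesis unfolding B'(2) by (rule r_mono)
  qed
  moreover have "r (A * B') \<subseteq> A" using Ai by (simp add: r_least r_ideal_times_subset)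
  ultimately have "A \<inter> B = r (A * B')" by blast
  then show ?thesis using r_invertible_times[OF A(1) B'inv] by simp
qed

text \<open>Otherwise the finite generating sets of all such products form a multiplicative family
  avoided by \<open>I\<close>. Krull's argument then gives a regular prime avoiding them, yet this
  prime contains an invertible radical ideal, a product with one factor.\<close>

lemma contains_product_of_invertible_radicals:
  assumes prime: "\<And>P. regular_r_ideal r P \<Longrightarrow> prime_r_ideal r P \<Longrightarrow>
      \<exists>J. r_invertible r J \<and> radical_r_ideal r J \<and> J \<subseteq> P"
    and I: "regular_r_ideal r I"
  shows "\<exists>As. (\<forall>A\<in>set As. r_invertible r A \<and> radical_r_ideal r A) \<and> r_product r As \<subseteq> I"
proof (rule ccontr)
  assume no: "\<not> ?thesis"
  define good where "good = (\<lambda>As. \<forall>A\<in>set As. r_invertible r A \<and> radical_r_ideal r A)"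
  define \<F> where "\<F> = {E. finite E \<and> (\<exists>As. good As \<and> r E = r_product r As)}"
  have Ii: "r_ideal r I" using I by (rule regular_r_idealD)
  have "\<exists>Q. prime_r_ideal r Q \<and> I \<subseteq> Q \<and> (\<forall>F\<in>\<F>. \<not> F \<subseteq> Q)"
  proof (rule exists_prime_avoiding[OF Ii])
    show "\<not> F \<subseteq> I" if F: "F \<in> \<F>" for F
    proof -
      obtain As where "good As" "r F = r_product r As" using F unfolding \<F>_def by blast
      then show ?thesis using no r_least[OF Ii, of F] unfolding good_def by metis
    qed
    have "{1} \<in> \<F>" unfolding \<F>_def by (auto simp: good_def intro!: exI[of _ "[]"])
    then show "\<F> \<noteq> {}" by blast
    fix F G assume "F \<in> \<F>" "G \<in> \<F>"
    then obtain As Bs where "good As" "good Bs" "r F = r_product r As" "r G = r_product r Bs" "finite F" "finite G"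
      unfolding \<F>_def by blast
    then have "finite (F * G) \<and> good (As @ Bs) \<and> r (F * G) = r_product r (As @ Bs)"
      unfolding r_product_append by (metis good_def Un_iff finite_set_times r_r_times r_times_r set_append)
    then have "F * G \<in> \<F>" unfolding \<F>_def by blast
    then show "\<exists>H\<in>\<F>. H \<subseteq> r (F * G)" using r_extensive[of "F * G"] by blast
  qed (simp add: \<F>_def)
  then obtain Q where Q: "prime_r_ideal r Q" "I \<subseteq> Q" and avoid: "\<forall>F\<in>\<F>. \<not> F \<subseteq> Q" by metis
  obtain J where J: "r_invertible r J" "radical_r_ideal r J" "J \<subseteq> Q"
    using prime[OF _ Q(1)] regular_r_ideal_mono[OF I Q(2)] prime_r_idealD[OF Q(1)] by blast
  obtain E where E: "finite E" "J = r E" using r_invertible_fin_generated[OF J(1)] by (rule r_fin_generatedE)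
  have "E \<in> \<F>"
    unfolding \<F>_def good_def using E J by (auto intro!: exI[of _ "[J]"] simp: r_product_singleton)
  then show False using avoid J(3) E(2) r_extensive[of E] by blast
qed

text \<open>In the expanded product every term has a factor from \<open>I\<close>, except the
  product of all members of \<open>As\<close>.\<close>

lemma r_product_map_Un_subset: "r_product r (map (\<lambda>J. r (I \<union> J)) As) \<subseteq> r (I \<union> r_product r As)"
proof (induction As)
  case Nil
  show ?case using r_mono[of UNIV "I \<union> UNIV"] by simp
next
  case (Cons A As)
  define X where "X = r (I \<union> r_product r (A # As))"
  have IX: "I \<subseteq> X" and AX: "A * r_product r As \<subseteq> X"
    using r_extensive[of "I \<union> r_product r (A # As)"] r_extensive[of "A * r_product r As"]
    by (auto simp: X_def r_product_Cons)
  have Xi: "r_ideal r X" by (simp add: X_def)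
  have "a * b \<in> X" if "a \<in> I \<union> A" "b \<in> I \<union> r_product r As" for a b
    using that IX AX r_ideal_mult[OF Xi] r_ideal_mult'[OF Xi] set_times_intro[of a A b "r_product r As"] by blast
  then have "r ((I \<union> A) * (I \<union> r_product r As)) \<subseteq> X"
    using Xi by (auto simp: r_least set_times_subset_iff)
  moreover have "r_product r (map (\<lambda>J. r (I \<union> J)) (A # As)) \<subseteq> r ((I \<union> A) * (I \<union> r_product r As))"
    unfolding list.map r_product_Cons
    using Cons.IH by (metis r_mono r_r_times r_times_r set_times_mono2 subset_refl)
  ultimately show ?case unfolding X_def by blast
qed

text \<open>Joining \<open>I\<close> to each factor of a product of invertible radicals inside
  \<open>I\<close> keeps the factors invertible and radical. The new product is still inside
  \<open>I\<close>, and all factors now contain \<open>I\<close>, so their intersection is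
  \<open>radical I\<close>.\<close>

theorem radical_invertible_if_dim_one:
  assumes dim1: "\<And>P. regular_r_ideal r P \<Longrightarrow> prime_r_ideal r P \<Longrightarrow> r_maximal r P"
    and prime: "\<And>P. regular_r_ideal r P \<Longrightarrow> prime_r_ideal r P \<Longrightarrow>
      \<exists>J. r_invertible r J \<and> radical_r_ideal r J \<and> J \<subseteq> P"
    and I: "regular_r_ideal r I" "r_fin_generated r I"
  shows "r_invertible r (radical I)"
proof -
  have Ii: "r_ideal r I" using I by (simp add: regular_r_idealD)
  obtain As where As: "\<And>A. A \<in> set As \<Longrightarrow> r_invertible r A \<and> radical_r_ideal r A" "r_product r As \<subseteq> I"
    using contains_product_of_invertible_radicals[OF prime I(1)] by blast
  define Bs where "Bs = map (\<lambda>J. r (I \<union> J)) As"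
  have Bs: "r_invertible r B \<and> radical_r_ideal r B \<and> I \<subseteq> B" if B: "B \<in> set Bs" for B
  proof -
    obtain J where J: "J \<in> set As" "B = r (I \<union> J)" using B by (auto simp: Bs_def)
    have fg: "r_fin_generated r B"
      unfolding J(2) using As(1)[OF J(1)] I(2) by (blast intro: r_fin_generated_Un r_invertible_fin_generated)
    have "I \<subseteq> B" "J \<subseteq> B" using r_extensive[of "I \<union> J"] J(2) by auto
    then show ?thesis using fin_generated_above_invertible_radical[OF dim1 _ _ fg] As(1)[OF J(1)] by blast
  qed
  have inv: "r_invertible r (\<Inter>(set Cs))"
    if "\<And>B. B \<in> set Cs \<Longrightarrow> r_invertible r B \<and> radical_r_ideal r B" for Cs
    using that
  proof (induction Cs)
    case (Cons C Cs)
    then show ?case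
      using r_invertible_Int_radical[OF dim1, of C "\<Inter>(set Cs)"] radical_Inter[of "set Cs"] by simp
  qed (simp add: r_invertible_UNIV)
  have "r_product r Bs \<subseteq> r (I \<union> r_product r As)" unfolding Bs_def by (rule r_product_map_Un_subset)
  also have "\<dots> = I" using As(2) Ii by (simp add: Un_absorb2 r_ideal_eq)
  finally have prod: "r_product r Bs \<subseteq> I" .
  have pow: "x ^ length Cs \<in> prod_list Cs" if "\<And>C. C \<in> set Cs \<Longrightarrow> x \<in> C" for x and Cs :: "'a set list"
    using that by (induction Cs) (auto intro!: set_times_intro)
  have "\<Inter>(set Bs) \<subseteq> radical I"
  proof
    fix x assume "x \<in> \<Inter>(set Bs)"
    then have "x ^ length Bs \<in> radical I"
      using pow[of Bs x] prod prod_list_subset_r_product[of Bs] subset_radical[of I] by blast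
    then show "x \<in> radical I" by (rule radical_power[OF radical_r_ideal_radical[OF Ii]])
  qed
  moreover have "radical I \<subseteq> \<Inter>(set Bs)" using Bs by (intro radical_least radical_Inter) auto
  ultimately show ?thesis using inv[of Bs] Bs by (metis subset_antisym)
qed

end

text \<open>Along such a list \<open>P\<close> holds on an initial segment. For an ascending chain
  and the property of lying in \<open>M\<close>, the number of members inside \<open>M\<close> thus
  tells which they are.\<close>

lemma nth_iff_less_length_filter:
  "sorted_wrt (\<lambda>x y. P y \<longrightarrow> P x) xs \<Longrightarrow> i < length xs \<Longrightarrow> P (xs ! i) \<longleftrightarrow> i < length (filter P xs)"
proof (induction xs arbitrary: i)
  case (Cons x xs)
  show ?case
  proof (cases "P x")
    case True
    then show ?thesis using Cons by (cases i) auto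
  next
    case False
    then have none: "\<not> P y" if "y \<in> set xs" for y using Cons.prems(1) that by auto
    then have "filter P xs = []" by (simp add: filter_empty_conv)
    moreover have "\<not> P ((x # xs) ! i)" using none False Cons.prems(2) by (cases i) auto
    ultimately show ?thesis using False by simp
  qed
qed simp

lemma prod_list_partition:
  "prod_list xs = prod_list (filter P xs) * prod_list (filter (\<lambda>x. \<not> P x) xs)"
  for xs :: "'b::comm_monoid_mult list"
  by (induction xs) (auto simp: mult_ac)

context finitary_ideal_system
begin

definition regular_maximals :: "'a set set" where
  "regular_maximals = {M. regular_r_ideal r M \<and> r_maximal r M}"

lemma regular_maximalsD:
  assumes "M \<in> regular_maximals"
  shows "regular_r_ideal r M" "r_maximal r M" "prime_r_ideal r M" "r_ideal r M"
  using assms r_maximal_prime regular_r_idealD by (auto simp: regular_maximals_def)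

end

section \<open>Factorization of finitely generated ideals\<close>

text \<open>Condition (5) as a locale, because (4), (6) and (7) are all derived from it.\<close>

locale invertible_radical_system = finitary_ideal_system +
  assumes radical_invertible: "regular_r_ideal r I \<Longrightarrow> r_fin_generated r I \<Longrightarrow> r_invertible r (radical I)"
begin

text \<open>A prime \<open>r\<close>-ideal above \<open>R\<close> lies above exactly one of
  \<open>radical A\<close> and \<open>S\<close>, so \<open>S\<close> plays the role of the
  complement of \<open>A\<close> within \<open>R\<close>.\<close>

lemma comaximal_complement:
  assumes R: "r_invertible r R" "radical_r_ideal r R"
    and A: "regular_r_ideal r A" "r_fin_generated r A" "R \<subseteq> radical A"
  shows "\<exists>S. r_ideal r S \<and> R = r (radical A * S) \<and> r (radical A \<union> S) = UNIV"
proof -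
  define Q where "Q = radical A"
  have Q: "r_invertible r Q" using radical_invertible A by (simp add: Q_def)
  have Qi: "r_ideal r Q" using Q by (rule r_invertibleD)
  obtain S where S: "r_ideal r S" "r R = r (Q * S)"
    using r_invertible_divides[OF Q, of R] A(3) by (auto simp: Q_def)
  have R_eq: "R = r (Q * S)" using S(2) R(2) by (simp add: r_ideal_eq radical_r_idealD)
  have "r_invertible r S" using R(1) R_eq S(1) by (metis mult.commute r_invertible_factor)
  then have "r_fin_generated r (r (Q \<union> S))" using Q by (blast intro: r_fin_generated_Un r_invertible_fin_generated)
  moreover have "regular_r_ideal r (r (Q \<union> S))"
    using regular_r_ideal_mono[OF r_invertible_regular[OF Q]] r_extensive[of "Q \<union> S"] by simp
  ultimately have "r (Q \<union> S) = UNIV"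
    using radical_invertible by (intro coprime_factors_comaximal[OF R(2,1) R_eq Qi S(1)])
  then show ?thesis using S(1) R_eq unfolding Q_def by blast
qed

lemma fin_generated_factorization:
  assumes "regular_r_ideal r I" "r_fin_generated r I" "radical I ^ k \<subseteq> I"
  shows "\<exists>As. (\<forall>A\<in>set As. r_invertible r A \<and> radical_r_ideal r A \<and> radical I \<subseteq> A) \<and>
    sorted_wrt (\<subseteq>) As \<and> I = r_product r As"
  using assms
proof (induction k arbitrary: I)
  case 0
  then have "I = UNIV" using r_ideal_UNIV_iff[of I] by (auto simp: set_one dest: regular_r_idealD)
  then show ?case by (intro exI[of _ "[]"]) simp
next
  case (Suc k)
  have Ii: "r_ideal r I" using Suc.prems(1) by (rule regular_r_idealD)
  define R where "R = radical I"
  have R: "r_invertible r R" "radical_r_ideal r R"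
    using radical_invertible Suc.prems radical_r_ideal_radical Ii by (auto simp: R_def)
  have IR: "I \<subseteq> R" unfolding R_def by (rule subset_radical)
  obtain B where B: "r_ideal r B" "I = r (R * B)"
    using r_invertible_divides[OF R(1) IR] Ii by (auto simp: r_ideal_eq)
  have IB: "I \<subseteq> B" unfolding B(2) using B(1) by (simp add: r_least r_ideal_times_subset)
  have Breg: "regular_r_ideal r B" using regular_r_ideal_mono Suc.prems(1) IB B(1) by blast
  have Bfg: "r_fin_generated r B" using r_fin_generated_cofactor[OF R(1)] Suc.prems(2) B by blast
  have "R * R ^ k \<subseteq> I" using Suc.prems(3) by (simp add: R_def)
  then have "r (R * R ^ k) \<subseteq> r (R * B)" using Ii unfolding B(2)[symmetric] by (simp add: r_least)
  then have "r (R ^ k) \<subseteq> r B" by (rule r_invertible_cancel[OF R(1)])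
  then have RB: "r (R ^ k) \<subseteq> B" using B(1) by (simp add: r_ideal_eq)
  define Q where "Q = radical B"
  have Q: "r_invertible r Q" "radical_r_ideal r Q"
    using radical_invertible Breg Bfg radical_r_ideal_radical B(1) by (auto simp: Q_def)
  have RQ: "R \<subseteq> Q" unfolding R_def
    using radical_least[OF Q(2)] IB subset_radical[of B] by (simp add: Q_def)
  obtain S where S: "R = r (Q * S)" "r (Q \<union> S) = UNIV"
    using comaximal_complement[OF R Breg Bfg] RQ unfolding Q_def by metis
  \<comment> \<open>Only the existence of some \<open>j\<close> is known here; comaximality with
    \<open>S ^ k\<close> sharpens the exponent to the \<open>k\<close> of the induction
    hypothesis.\<close>
  obtain j where j: "Q ^ j \<subseteq> B"
    using fin_generated_pow_subset[OF B(1) r_invertible_fin_generated[OF Q(1)]] unfolding Q_def by blast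
  have "r (S ^ k \<union> Q) = UNIV" using comaximal_pow[OF S(2)] by (simp add: Un_commute)
  then have co: "r (S ^ k \<union> Q ^ j) = UNIV" by (rule comaximal_pow)
  have "Q ^ k \<subseteq> r B"
  proof (rule comaximal_cancel[OF co])
    have "S ^ k * Q ^ k \<subseteq> r ((Q * S) ^ k)" using r_extensive by (simp add: power_mult_distrib mult.commute)
    also have "\<dots> = r (R ^ k)" unfolding S(1) by simp
    finally show "S ^ k * Q ^ k \<subseteq> r B" using RB B(1) by (simp add: r_ideal_eq)
    show "Q ^ j * Q ^ k \<subseteq> r B" using j B(1) by (simp add: r_ideal_eq r_ideal_times_subset)
  qed
  then obtain As where As: "\<forall>A\<in>set As. r_invertible r A \<and> radical_r_ideal r A \<and> Q \<subseteq> A"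
      "sorted_wrt (\<subseteq>) As" "B = r_product r As"
    using Suc.IH[OF Breg Bfg] B(1) unfolding Q_def by (auto simp: r_ideal_eq)
  then have "I = r_product r (R # As)" using B(2) by (simp add: r_product_Cons)
  then show ?case using As RQ R unfolding R_def[symmetric] by (intro exI[of _ "R # As"]) auto
qed

lemma r_pow_antimono: "k \<le> n \<Longrightarrow> r (M ^ n) \<subseteq> r (M ^ k)"
proof -
  assume "k \<le> n"
  then have "M ^ n = M ^ k * M ^ (n - k)" by (simp flip: power_add)
  then show ?thesis using r_ideal_times_subset(1)[of "r (M ^ k)" "M ^ k"] r_extensive[of "M ^ k"]
    by (simp add: r_subset_iff)
qed

text \<open>With \<open>n = length As\<close>, an invertible radical \<open>R\<close> below
  \<open>M\<close> and all of \<open>As\<close> reduces the claim to \<open>R ^ n\<close>.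
  Finitarity replaces \<open>M\<close> by a finite subset, and this by an invertible radical
  \<open>Q\<close> inside \<open>M\<close>. Writing \<open>R = r (Q * S)\<close> and cancelling
  \<open>Q ^ n\<close> leaves \<open>S ^ n\<close> inside \<open>Q\<close>, against
  comaximality.\<close>

lemma radical_products_not_subset_higher_power:
  assumes M: "M \<in> regular_maximals" and y: "regular_element r y"
    and As: "\<And>A. A \<in> set As \<Longrightarrow> radical_r_ideal r A \<and> y \<in> A"
  shows "\<not> prod_list As \<subseteq> r (M ^ Suc (length As))"
proof
  assume sub: "prod_list As \<subseteq> r (M ^ Suc (length As))"
  define n where "n = length As"
  note M = regular_maximalsD[OF M]
  obtain m where m: "m \<in> M" "regular_element r m" using M(1) by (auto simp: regular_r_ideal_def)
  \<comment> \<open>The factor \<open>m\<close> brings the radical of \<open>Y\<close> into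
    \<open>M\<close>, the factor \<open>y\<close> into all members of \<open>As\<close>.\<close>
  define Y where "Y = (y * m) *o (UNIV :: 'a set)"
  have Yinv: "r_invertible r Y" unfolding Y_def by (intro r_invertible_principal regular_mult y m)
  have Ysub: "Y \<subseteq> I" if "r_ideal r I" "y \<in> I \<or> m \<in> I" for I
    using that r_ideal_mult r_ideal_mult' unfolding Y_def elt_set_times_def by blast
  define R where "R = radical Y"
  have R: "r_invertible r R" "radical_r_ideal r R"
    using radical_invertible r_invertible_regular r_invertible_fin_generated radical_r_ideal_radical
      r_invertibleD Yinv by (auto simp: R_def)
  have RA: "R \<subseteq> A" if "A \<in> set As" for A
    unfolding R_def using As[OF that] by (intro radical_least Ysub) (auto dest: radical_r_idealD)
  have RM: "R \<subseteq> M" unfolding R_def using m M by (intro radical_least prime_radical Ysub) auto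
  have "R ^ length Bs \<subseteq> prod_list Bs" if "\<And>B. B \<in> set Bs \<Longrightarrow> R \<subseteq> B" for Bs
    using that
  proof (induction Bs)
    case (Cons B Bs)
    then show ?case using set_times_mono2[of R B "R ^ length Bs" "prod_list Bs"] by simp
  qed simp
  then have "R ^ n \<subseteq> r (M ^ Suc n)" using RA sub unfolding n_def by blast
  moreover have "r_fin_generated r (r (R ^ n))" by (intro r_invertible_fin_generated r_invertible_pow R)
  then obtain F where F: "finite F" "r (R ^ n) = r F" by (rule r_fin_generatedE)
  ultimately have "F \<subseteq> r (M ^ Suc n)" by (metis r_subset_iff)
  then obtain D where D: "finite D" "D \<subseteq> M ^ Suc n" "F \<subseteq> r D" using r_finite[OF F(1)] by metis
  obtain E where E: "finite E" "E \<subseteq> M" "D \<subseteq> E ^ Suc n" using finite_subset_pow[OF D(1,2)] by metis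
  define A where "A = r (r E \<union> R)"
  have ERA: "E \<subseteq> A" "R \<subseteq> A" using r_extensive[of "E \<union> R"] by (auto simp: A_def)
  have Afg: "r_fin_generated r A"
    unfolding A_def by (intro r_fin_generated_Un r_fin_generatedI r_invertible_fin_generated E R)
  have Areg: "regular_r_ideal r A"
    using regular_r_ideal_mono[OF r_invertible_regular[OF R(1)] ERA(2)] by (simp add: A_def)
  have "A \<subseteq> M" unfolding A_def using E(2) RM M(4) by (simp add: r_least)
  define Q where "Q = radical A"
  have Q: "r_invertible r Q" using radical_invertible Areg Afg by (simp add: Q_def)
  have QM: "Q \<subseteq> M" unfolding Q_def using \<open>A \<subseteq> M\<close> M by (intro radical_least prime_radical)
  have AQ: "A \<subseteq> Q" unfolding Q_def by (rule subset_radical)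
  obtain S where S: "R = r (Q * S)" "r (Q \<union> S) = UNIV"
    using comaximal_complement[OF R Areg Afg] subset_trans[OF ERA(2) AQ] unfolding Q_def by metis
  have "r (r (Q ^ n) * S ^ n) = r (r (Q * S) ^ n)" by (simp add: power_mult_distrib)
  also have "\<dots> = r F" using F(2) S(1) by simp
  also have "\<dots> \<subseteq> r D" using D(3) by (simp add: r_subset_iff)
  also have "\<dots> \<subseteq> r (Q ^ Suc n)"
    using E(3) set_pow_mono[of E Q "Suc n"] ERA(1) AQ by (intro r_mono) blast
  also have "\<dots> = r (r (Q ^ n) * Q)" by (simp add: mult.commute)
  finally have "r (S ^ n) \<subseteq> r Q" by (rule r_invertible_cancel[OF r_invertible_pow[OF Q]])
  moreover have "r (Q \<union> S ^ n) = UNIV" using S(2) by (rule comaximal_pow)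
  ultimately have "r Q = UNIV" by (metis Un_upper1 comaximal_mono r_subset_iff r_extensive sup.idem)
  then have "Q = UNIV" using r_invertibleD[OF Q] by (simp add: r_ideal_eq)
  then show False using QM M(2) by (auto simp: r_maximal_def)
qed

section \<open>Chains of radical ideals\<close>

abbreviation factor_count :: "'a set \<Rightarrow> 'a set list \<Rightarrow> nat" where
  "factor_count M As \<equiv> length (filter (\<lambda>A. A \<subseteq> M) As)"

lemma r_product_subset_pow: "r_product r As \<subseteq> r (M ^ factor_count M As)"
proof (induction As)
  case (Cons A As)
  have "r_product r (A # As) \<subseteq> r_product r As"
    by (simp add: r_product_Cons r_least r_ideal_times_subset)
  moreover have "r_product r (A # As) \<subseteq> r (M * r (M ^ factor_count M As))" if "A \<subseteq> M"
    unfolding r_product_Cons using that Cons by (intro r_mono set_times_mono2)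
  ultimately show ?case using Cons by auto
qed simp

lemma regular_r_product_obtain:
  assumes "regular_r_ideal r (r_product r As)" "\<And>A. A \<in> set As \<Longrightarrow> r_ideal r A"
  obtains y where "regular_element r y" "\<And>A. A \<in> set As \<Longrightarrow> y \<in> A"
  using assms r_product_subset unfolding regular_r_ideal_def by blast

lemma r_product_subset_pow_iff:
  assumes M: "M \<in> regular_maximals" and As: "\<And>A. A \<in> set As \<Longrightarrow> radical_r_ideal r A"
    and reg: "regular_r_ideal r (r_product r As)"
  shows "r_product r As \<subseteq> r (M ^ k) \<longleftrightarrow> k \<le> factor_count M As"
proof
  assume "k \<le> factor_count M As"
  then show "r_product r As \<subseteq> r (M ^ k)" using r_product_subset_pow[of As M] r_pow_antimono by blast
next
  assume sub: "r_product r As \<subseteq> r (M ^ k)"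
  show "k \<le> factor_count M As"
  proof (rule ccontr)
    assume "\<not> k \<le> factor_count M As"
    define c where "c = factor_count M As"
    obtain y where y: "regular_element r y" "\<And>A. A \<in> set As \<Longrightarrow> y \<in> A"
      using regular_r_product_obtain[OF reg] As radical_r_idealD by metis
    define B where "B = prod_list (filter (\<lambda>A. \<not> A \<subseteq> M) As)"
    define C where "C = prod_list (filter (\<lambda>A. A \<subseteq> M) As)"
    have "Suc c \<le> k" using \<open>\<not> k \<le> factor_count M As\<close> by (simp add: c_def)
    then have "prod_list As \<subseteq> r (M ^ Suc c)"
      using sub r_pow_antimono[of "Suc c" k M] prod_list_subset_r_product[of As] by blast
    then have BC: "B * C \<subseteq> r (M ^ Suc c)"
      using prod_list_partition[of As "\<lambda>A. A \<subseteq> M"] by (simp add: B_def C_def mult.commute)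
    have "\<not> B \<subseteq> M" unfolding B_def using prime_prod_list regular_maximalsD(3)[OF M] by fastforce
    then have "r (B \<union> M) = UNIV" using r_maximal_comaximal[OF regular_maximalsD(2)[OF M]] by (simp add: Un_commute)
    then have "r (B \<union> M ^ Suc c) = UNIV" by (rule comaximal_pow)
    then have "C \<subseteq> r (M ^ Suc c)"
      by (rule comaximal_cancel[OF _ BC]) (intro r_ideal_times_subset r_ideal_r r_extensive)
    then show False
      using radical_products_not_subset_higher_power[OF M y(1), of "filter (\<lambda>A. A \<subseteq> M) As"] As y(2)
      by (simp add: C_def c_def)
  qed
qed

text \<open>Split an invertible radical \<open>R\<close> inside \<open>J\<close> as
  \<open>r (Q * S)\<close> with \<open>Q\<close> the radical of \<open>r {x, y}\<close>. A maximal
  ideal above \<open>J\<close> contains \<open>x\<close> and \<open>y\<close>, hence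
  \<open>Q\<close>, hence not \<open>S\<close>. So \<open>J\<close> and \<open>S\<close> are
  comaximal, while \<open>S * {x}\<close> lies in \<open>R\<close> and thus in
  \<open>J\<close>.\<close>

lemma radical_eq_Inter_maximals:
  assumes J: "regular_r_ideal r J" "radical_r_ideal r J"
    and x: "\<And>M. M \<in> regular_maximals \<Longrightarrow> J \<subseteq> M \<Longrightarrow> x \<in> M"
  shows "x \<in> J"
proof -
  have Ji: "r_ideal r J" using J(1) by (rule regular_r_idealD)
  obtain y where y: "y \<in> J" "regular_element r y" using J(1) by (auto simp: regular_r_ideal_def)
  define R where "R = radical (y *o (UNIV :: 'a set))"
  have yinv: "r_invertible r (y *o UNIV)" using y(2) by (rule r_invertible_principal)
  have R: "r_invertible r R" "radical_r_ideal r R"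
    using radical_invertible r_invertible_regular r_invertible_fin_generated radical_r_ideal_radical
      r_invertibleD yinv by (auto simp: R_def)
  have RJ: "R \<subseteq> J"
    unfolding R_def using y(1) r_ideal_mult'[OF Ji] by (intro radical_least[OF J(2)]) (auto simp: elt_set_times_def)
  define A where "A = r {x, y}"
  have xy: "x \<in> A" "y \<in> A" using r_extensive[of "{x, y}"] by (auto simp: A_def)
  have Ai: "r_ideal r A" and Afg: "r_fin_generated r A" by (simp_all add: A_def r_fin_generatedI)
  have Areg: "regular_r_ideal r A" using xy(2) y(2) Ai by (auto simp: regular_r_ideal_def)
  define Q where "Q = radical A"
  have AQ: "A \<subseteq> Q" unfolding Q_def by (rule subset_radical)
  have "y *o UNIV \<subseteq> A" using xy(2) r_ideal_mult'[OF Ai] by (auto simp: elt_set_times_def)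
  then have "R \<subseteq> Q"
    unfolding R_def Q_def using subset_radical[of A] by (intro radical_least radical_r_ideal_radical Ai) auto
  then obtain S where S: "R = r (Q * S)" "r (Q \<union> S) = UNIV"
    using comaximal_complement[OF R Areg Afg] unfolding Q_def by metis
  have "r (J \<union> S) = UNIV"
  proof (rule eq_UNIV_if_no_r_maximal)
    fix M assume M: "r_maximal r M" "r (J \<union> S) \<subseteq> M"
    then have JM: "J \<subseteq> M" and SM: "S \<subseteq> M" using r_extensive[of "J \<union> S"] by auto
    have Mi: "r_ideal r M" using M(1) by (simp add: r_maximal_def)
    have "M \<in> regular_maximals" using M(1) regular_r_ideal_mono[OF J(1) JM Mi] by (simp add: regular_maximals_def)
    then have "x \<in> M" using x JM by blast
    then have "A \<subseteq> M" using y(1) JM Mi by (auto simp: A_def r_least)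
    then have "Q \<subseteq> M" unfolding Q_def using M(1) by (intro radical_least prime_radical r_maximal_prime)
    then have "r (Q \<union> S) \<subseteq> M" using SM Mi by (simp add: r_least)
    then show False using S(2) M(1) by (auto simp: r_maximal_def)
  qed simp
  then have "{x} \<subseteq> r J"
  proof (rule comaximal_cancel)
    show "J * {x} \<subseteq> r J" using Ji by (simp add: r_ideal_eq r_ideal_times_subset)
    have "S * {x} \<subseteq> S * Q" using xy(1) AQ by (intro set_times_mono2) auto
    then have "S * {x} \<subseteq> Q * S" by (simp add: mult.commute)
    then show "S * {x} \<subseteq> r J" using S(1) RJ r_extensive[of "Q * S"] Ji by (auto simp: r_ideal_eq)
  qed
  then show ?thesis using Ji by (simp add: r_ideal_eq)
qed

text \<open>\<open>UNIV\<close> is excluded because it can be added to any \<open>r\<close>-product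
  without changing it, which would destroy uniqueness.\<close>

definition radical_chain :: "'a set list \<Rightarrow> bool" where
  "radical_chain As \<longleftrightarrow> (\<forall>A\<in>set As. radical_r_ideal r A \<and> A \<noteq> UNIV) \<and> sorted_wrt (\<subseteq>) As"

lemma radical_chain_nth_subset_iff:
  assumes "radical_chain As" "i < length As"
  shows "As ! i \<subseteq> M \<longleftrightarrow> i < factor_count M As"
proof (rule nth_iff_less_length_filter[OF _ assms(2)])
  have "sorted_wrt (\<subseteq>) As" using assms(1) by (simp add: radical_chain_def)
  then show "sorted_wrt (\<lambda>A B. B \<subseteq> M \<longrightarrow> A \<subseteq> M) As" by (rule sorted_wrt_mono_rel[rotated]) blast
qed

text \<open>A member of a chain is the intersection of the regular maximal ideals whose count
  exceeds its index, so larger counts give smaller members. A maximal ideal above the last member of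
  \<open>Bs\<close> counts all of \<open>Bs\<close>, which compares the lengths.\<close>

lemma radical_chain_le:
  assumes As: "radical_chain As" and Bs: "radical_chain Bs" "regular_r_ideal r (r_product r Bs)"
    and le: "\<And>M. M \<in> regular_maximals \<Longrightarrow> factor_count M Bs \<le> factor_count M As"
  shows "length Bs \<le> length As \<and> (\<forall>i<length Bs. As ! i \<subseteq> Bs ! i)"
proof -
  have Brad: "radical_r_ideal r (Bs ! i)" "Bs ! i \<noteq> UNIV" if "i < length Bs" for i
    using Bs(1) that by (auto simp: radical_chain_def)
  have Breg: "regular_r_ideal r (Bs ! i)" if "i < length Bs" for i
    using regular_r_ideal_mono[OF Bs(2)] r_product_subset[of "Bs ! i" Bs] Brad(1)[OF that] that
    by (simp add: radical_r_idealD)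
  have "length Bs \<le> length As"
  proof (cases "Bs = []")
    case False
    then have l: "length Bs - 1 < length Bs" by simp
    obtain M where M: "r_maximal r M" "Bs ! (length Bs - 1) \<subseteq> M"
      using exists_r_maximal Brad[OF l] radical_r_idealD by blast
    have "M \<in> regular_maximals"
      using M regular_r_ideal_mono[OF Breg[OF l]] by (auto simp: regular_maximals_def r_maximal_def)
    then have "length Bs - 1 < factor_count M As"
      using le[of M] radical_chain_nth_subset_iff[OF Bs(1) l, of M] M(2) by linarith
    then show ?thesis using length_filter_le[of "\<lambda>A. A \<subseteq> M" As] by linarith
  qed simp
  moreover have "As ! i \<subseteq> Bs ! i" if i: "i < length Bs" for i
  proof
    fix x assume x: "x \<in> As ! i"
    show "x \<in> Bs ! i"
    proof (rule radical_eq_Inter_maximals[OF Breg[OF i] Brad(1)[OF i]])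
      fix M assume M: "M \<in> regular_maximals" "Bs ! i \<subseteq> M"
      then have "i < factor_count M As"
        using le[of M] radical_chain_nth_subset_iff[OF Bs(1) i, of M] by linarith
      then have "As ! i \<subseteq> M"
        using radical_chain_nth_subset_iff[OF As, of i M] i \<open>length Bs \<le> length As\<close> by simp
      then show "x \<in> M" using x by blast
    qed
  qed
  ultimately show ?thesis by blast
qed

lemma radical_chain_product_mono:
  assumes As: "radical_chain As" and Bs: "radical_chain Bs" "regular_r_ideal r (r_product r Bs)"
    and le: "\<And>M. M \<in> regular_maximals \<Longrightarrow> factor_count M Bs \<le> factor_count M As"
  shows "r_product r As \<subseteq> r_product r Bs"
proof -
  have *: "length Bs \<le> length As" "\<forall>i<length Bs. As ! i \<subseteq> Bs ! i"
    using radical_chain_le[OF assms] by auto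
  have "r_product r As = r_product r (take (length Bs) As @ drop (length Bs) As)" by simp
  also have "\<dots> \<subseteq> r_product r (take (length Bs) As)"
    unfolding r_product_append by (simp add: r_least r_ideal_times_subset)
  also have "\<dots> \<subseteq> r_product r Bs"
    using * by (intro r_product_mono) (auto simp: list_all2_conv_all_nth)
  finally show ?thesis .
qed

lemma radical_chainD: "radical_chain As \<Longrightarrow> A \<in> set As \<Longrightarrow> radical_r_ideal r A"
  by (simp add: radical_chain_def)

lemma factor_count_mono:
  assumes As: "\<And>A. A \<in> set As \<Longrightarrow> radical_r_ideal r A" and Bs: "\<And>A. A \<in> set Bs \<Longrightarrow> radical_r_ideal r A"
    and "regular_r_ideal r (r_product r As)" "r_product r As \<subseteq> r_product r Bs" "M \<in> regular_maximals"
  shows "factor_count M Bs \<le> factor_count M As"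
proof -
  have "regular_r_ideal r (r_product r Bs)" using regular_r_ideal_mono assms by simp
  then have "r_product r Bs \<subseteq> r (M ^ factor_count M Bs)" using r_product_subset_pow_iff assms by blast
  then have "r_product r As \<subseteq> r (M ^ factor_count M Bs)" using assms(4) by blast
  then show ?thesis using r_product_subset_pow_iff assms by blast
qed

lemma radical_chain_unique:
  assumes As: "radical_chain As" and Bs: "radical_chain Bs"
    and eq: "r_product r As = r_product r Bs" and reg: "regular_r_ideal r (r_product r As)"
  shows "As = Bs"
proof -
  have c: "factor_count M As = factor_count M Bs" if "M \<in> regular_maximals" for M
    using factor_count_mono[of As Bs M] factor_count_mono[of Bs As M] radical_chainD As Bs eq reg that
    by (metis order_antisym order_refl)
  have "length As = length Bs \<and> (\<forall>i<length As. As ! i = Bs ! i)"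
    using radical_chain_le[OF As Bs] radical_chain_le[OF Bs As] c eq reg by (simp add: order_antisym)
  then show ?thesis by (simp add: list_eq_iff_nth_eq)
qed

lemma radical_chain_filter_proper:
  assumes "\<And>A. A \<in> set As \<Longrightarrow> radical_r_ideal r A" "sorted_wrt (\<subseteq>) As"
  shows "radical_chain (filter (\<lambda>A. A \<noteq> UNIV) As)"
  using assms by (auto simp: radical_chain_def sorted_wrt_filter)

lemma fin_generated_chain_of_invertibles:
  assumes I: "regular_r_ideal r I" "r_fin_generated r I"
  shows "\<exists>As. (\<forall>A\<in>set As. r_invertible r A \<and> radical_r_ideal r A) \<and> sorted_wrt (\<subseteq>) As \<and> I = r_product r As"
proof -
  have Ii: "r_ideal r I" using I(1) by (rule regular_r_idealD)
  obtain k where "radical I ^ k \<subseteq> I"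
    using fin_generated_pow_subset[OF Ii r_invertible_fin_generated[OF radical_invertible[OF I]]] by blast
  then show ?thesis using fin_generated_factorization[OF I] by blast
qed

lemma fin_generated_radical_chain:
  assumes I: "regular_r_ideal r I" "r_fin_generated r I"
  shows "\<exists>As. radical_chain As \<and> I = r_product r As"
proof -
  obtain As where "\<forall>A\<in>set As. radical_r_ideal r A" "sorted_wrt (\<subseteq>) As" "I = r_product r As"
    using fin_generated_chain_of_invertibles[OF I] by blast
  then have "radical_chain (filter (\<lambda>A. A \<noteq> UNIV) As)" "I = r_product r (filter (\<lambda>A. A \<noteq> UNIV) As)"
    by (auto simp: r_product_filter_proper intro: radical_chain_filter_proper)
  then show ?thesis by blast
qed

lemma prod_list_directed_Union:
  assumes "\<D> \<noteq> {}" and dir: "\<And>A B. A \<in> \<D> \<Longrightarrow> B \<in> \<D> \<Longrightarrow> \<exists>C\<in>\<D>. A \<union> B \<subseteq> C"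
    and mono: "\<And>A B k. A \<in> \<D> \<Longrightarrow> B \<in> \<D> \<Longrightarrow> A \<subseteq> B \<Longrightarrow> g A k \<subseteq> g B k"
    and "x \<in> prod_list (map (\<lambda>k. \<Union>A\<in>\<D>. g A k) ks)"
  shows "\<exists>A\<in>\<D>. x \<in> prod_list (map (g A) ks)"
  using assms(4)
proof (induction ks arbitrary: x)
  case Nil
  then show ?case using assms(1) by auto
next
  case (Cons k ks)
  obtain a b where x: "x = a * b" "a \<in> (\<Union>A\<in>\<D>. g A k)" "b \<in> prod_list (map (\<lambda>k. \<Union>A\<in>\<D>. g A k) ks)"
    using Cons.prems unfolding list.map prod_list.Cons by (rule set_times_elim)
  obtain A where A: "A \<in> \<D>" "a \<in> g A k" using x(2) by blast
  obtain B where B: "B \<in> \<D>" "b \<in> prod_list (map (g B) ks)" using Cons.IH[OF x(3)] by blast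
  obtain C where C: "C \<in> \<D>" "A \<union> B \<subseteq> C" using dir[OF A(1) B(1)] by blast
  have "prod_list (map (g B) js) \<subseteq> prod_list (map (g C) js)" for js
  proof (induction js)
    case (Cons j js)
    have "B \<subseteq> C" using C(2) by blast
    then show ?case using set_times_mono2[OF mono[OF B(1) C(1)] Cons.IH] by simp
  qed simp
  then have "b \<in> prod_list (map (g C) ks)" using B(2) by blast
  moreover have "a \<in> g C k" using A(2) mono[OF A(1) C(1)] C(2) by blast
  ultimately show ?case using C(1) x(1) by auto
qed

text \<open>\<open>I\<close> is the directed union of the finitely generated ideals between
  \<open>y *o UNIV\<close> and \<open>I\<close>. Their chains grow with the ideal, position by
  position. The union along each position is radical, and an element of the product of these unions
  already lies in a product for a single ideal.\<close>

theorem radical_chain_exists: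
  assumes I: "regular_r_ideal r I"
  shows "\<exists>As. radical_chain As \<and> I = r_product r As"
proof -
  have Ii: "r_ideal r I" using I by (rule regular_r_idealD)
  obtain y where y: "y \<in> I" "regular_element r y" using I by (auto simp: regular_r_ideal_def)
  define \<D> where "\<D> = {A. r_fin_generated r A \<and> y \<in> A \<and> A \<subseteq> I}"
  have reg: "regular_r_ideal r A" if "A \<in> \<D>" for A
    using that y(2) by (auto simp: \<D>_def regular_r_ideal_def r_fin_generatedD)
  define f where "f = (\<lambda>A. SOME As. radical_chain As \<and> A = r_product r As)"
  have f: "radical_chain (f A)" "r_product r (f A) = A" if "A \<in> \<D>" for A
    using someI_ex[OF fin_generated_radical_chain[OF reg[OF that]]] that by (auto simp: f_def \<D>_def)
  \<comment> \<open>Missing positions are filled with \<open>UNIV\<close>, the neutral element of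
    the \<open>r\<close>-product. This keeps \<open>g\<close> monotone, because a larger ideal has a
    chain of at most the same length.\<close>
  define g where "g = (\<lambda>A k. if k < length (f A) then f A ! k else UNIV)"
  have le: "length (f B) \<le> length (f A) \<and> (\<forall>i<length (f B). f A ! i \<subseteq> f B ! i)"
    if AB: "A \<in> \<D>" "B \<in> \<D>" "A \<subseteq> B" for A B
  proof (rule radical_chain_le)
    show "regular_r_ideal r (r_product r (f B))" using f(2) reg AB by simp
    show "factor_count M (f B) \<le> factor_count M (f A)" if "M \<in> regular_maximals" for M
      using f AB that reg by (intro factor_count_mono) (auto dest: radical_chainD)
  qed (use f AB in auto)
  have g_mono: "g A k \<subseteq> g B k" if "A \<in> \<D>" "B \<in> \<D>" "A \<subseteq> B" for A B k
    using le[OF that] by (auto simp: g_def)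
  have dir: "\<exists>C\<in>\<D>. A \<union> B \<subseteq> C" if "A \<in> \<D>" "B \<in> \<D>" for A B
  proof
    show "A \<union> B \<subseteq> r (A \<union> B)" by (rule r_extensive)
    then show "r (A \<union> B) \<in> \<D>" using that Ii by (auto simp: \<D>_def r_least r_fin_generated_Un)
  qed
  \<comment> \<open>The least member of \<open>\<D>\<close>. No chain is longer than its chain, so
    one length \<open>N\<close> serves for all.\<close>
  define Y where "Y = y *o (UNIV :: 'a set)"
  have Y: "Y \<in> \<D>"
    unfolding \<D>_def Y_def using y r_invertible_fin_generated[OF r_invertible_principal] r_ideal_mult'[OF Ii]
    by (auto simp: elt_set_times_def intro: exI[of _ 1])
  then have ne: "\<D> \<noteq> {}" by blast
  have YA: "Y \<subseteq> A" if "A \<in> \<D>" for A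
    using that r_ideal_mult' by (auto simp: \<D>_def Y_def elt_set_times_def dest: r_fin_generatedD)
  define N where "N = length (f Y)"
  have N: "length (f A) \<le> N" if "A \<in> \<D>" for A using le[OF Y that YA[OF that]] by (simp add: N_def)
  define J where "J = (\<lambda>k. \<Union>A\<in>\<D>. g A k)"
  have g_rad: "radical_r_ideal r (g A k)" if "A \<in> \<D>" for A k
    using f(1)[OF that] by (auto simp: g_def radical_r_ideal_UNIV radical_chain_def)
  have "r_ideal r (J k)" for k
    unfolding J_def
  proof (rule r_ideal_directed_Union)
    fix X Z assume "X \<in> (\<lambda>A. g A k) ` \<D>" "Z \<in> (\<lambda>A. g A k) ` \<D>"
    then obtain A B where AB: "A \<in> \<D>" "B \<in> \<D>" "X = g A k" "Z = g B k" by blast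
    then obtain C where C: "C \<in> \<D>" "A \<subseteq> C" "B \<subseteq> C" using dir[of A B] by blast
    have "X \<union> Z \<subseteq> g C k" unfolding AB using g_mono[OF AB(1) C(1,2)] g_mono[OF AB(2) C(1,3)] by (rule Un_least)
    then show "\<exists>C\<in>(\<lambda>A. g A k) ` \<D>. X \<union> Z \<subseteq> C" using C(1) by (intro bexI[OF _ imageI])
  qed (use ne g_rad radical_r_idealD in auto)
  moreover have "x \<in> J k" if x: "x ^ n \<in> J k" for x n k
  proof -
    obtain A where A: "A \<in> \<D>" "x ^ n \<in> g A k" using x unfolding J_def by blast
    have "x \<in> g A k" using radical_power[OF g_rad[OF A(1)] A(2)] .
    then show ?thesis using A(1) unfolding J_def by blast
  qed
  ultimately have J_rad: "radical_r_ideal r (J k)" for k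
    unfolding radical_r_ideal_def by blast
  have "g A i \<subseteq> g A j" if "A \<in> \<D>" "i < j" for A i j
    using f(1)[OF that(1)] that(2) sorted_wrt_nth_less[of "(\<subseteq>)" "f A" i j] by (auto simp: g_def radical_chain_def)
  then have "J i \<subseteq> J j" if "i < j" for i j unfolding J_def using that by (intro UN_mono) auto
  then have "sorted_wrt (\<subseteq>) (map J [0..<N])"
    unfolding sorted_wrt_map by (intro sorted_wrt_mono_rel[OF _ sorted_wrt_upt]) auto
  then have chain: "radical_chain (filter (\<lambda>A. A \<noteq> UNIV) (map J [0..<N]))"
    using J_rad by (intro radical_chain_filter_proper) auto
  have prod_g: "r_product r (map (g A) [0..<N]) = A" if A: "A \<in> \<D>" for A
  proof -
    define l where "l = length (f A)"
    have "[0..<N] = [0..<l] @ [l..<N]" using upt_add_eq_append[of 0 l "N - l"] N[OF A] by (simp add: l_def)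
    moreover have "map (g A) [0..<l] = f A" by (auto simp: g_def l_def intro: nth_equalityI)
    moreover have "r_product r (map (g A) [l..<m]) = UNIV" for m
      using r_invertible_r_product by (induction m) (auto simp: g_def l_def r_product_append r_product_singleton)
    ultimately show ?thesis using f(2)[OF A] regular_r_idealD[OF reg[OF A]] by (simp add: r_product_append r_ideal_eq)
  qed
  have "I = r_product r (map J [0..<N])"
  proof
    show "I \<subseteq> r_product r (map J [0..<N])"
    proof
      fix x assume x: "x \<in> I"
      have "r {x, y} \<subseteq> I" using x y(1) Ii by (simp add: r_least)
      then have A: "r {x, y} \<in> \<D>" using r_extensive[of "{x, y}"] by (auto simp: \<D>_def r_fin_generatedI)
      have "r_product r (map (g (r {x, y})) [0..<N]) \<subseteq> r_product r (map J [0..<N])"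
        using A by (intro r_product_mono) (auto simp: list_all2_conv_all_nth J_def)
      then show "x \<in> r_product r (map J [0..<N])" using prod_g[OF A] r_extensive[of "{x, y}"] by auto
    qed
    have "x \<in> I" if x: "x \<in> prod_list (map J [0..<N])" for x
    proof -
      obtain A where A: "A \<in> \<D>" "x \<in> prod_list (map (g A) [0..<N])"
        using prod_list_directed_Union[of \<D> g x "[0..<N]", OF ne dir g_mono] x unfolding J_def by blast
      then have "x \<in> A" using prod_g[OF A(1)] prod_list_subset_r_product by blast
      then show ?thesis using A(1) by (auto simp: \<D>_def)
    qed
    then show "r_product r (map J [0..<N]) \<subseteq> I" unfolding r_product_def using Ii by (auto simp: r_least)
  qed
  then show ?thesis using chain r_product_filter_proper by metis
qed

end

context finitary_ideal_system
begin

section \<open>The inverse topology\<close>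

abbreviation maximals_above :: "'a set \<Rightarrow> 'a set set" where
  "maximals_above I \<equiv> {M \<in> regular_maximals. I \<subseteq> M}"

lemma topspace_r_max_inv_reg [simp]: "topspace (r_max_inv_reg r) = regular_maximals"
  using r_empty_subset regular_r_idealD
  unfolding r_max_inv_reg_def topology_generated_by_topspace regular_maximals_def by blast

lemma openin_maximals_above:
  "regular_r_ideal r I \<Longrightarrow> r_fin_generated r I \<Longrightarrow> openin (r_max_inv_reg r) (maximals_above I)"
  unfolding r_max_inv_reg_def regular_maximals_def by (rule topology_generated_by_Basis) auto

text \<open>Regular basic sets suffice: the one of \<open>r {}\<close>, the whole space, is replaced
  around \<open>M\<close> by that of \<open>y *o UNIV\<close> for a regular \<open>y\<close> in
  \<open>M\<close>. Intersections correspond to joins of ideals.\<close>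

lemma fin_generated_basic_open:
  assumes "openin (r_max_inv_reg r) U" "M \<in> U"
  shows "\<exists>I. regular_r_ideal r I \<and> r_fin_generated r I \<and> I \<subseteq> M \<and> maximals_above I \<subseteq> U"
  using openin_topology_generated_by[OF assms(1)[unfolded r_max_inv_reg_def]] assms(2)
proof (induction rule: generate_topology_on.induct)
  case (Int A B)
  obtain I where I: "regular_r_ideal r I" "r_fin_generated r I" "I \<subseteq> M" "maximals_above I \<subseteq> A"
    using Int.IH(1) Int.prems by blast
  obtain J where J: "regular_r_ideal r J" "r_fin_generated r J" "J \<subseteq> M" "maximals_above J \<subseteq> B"
    using Int.IH(2) Int.prems by blast
  have "M \<in> topspace (r_max_inv_reg r)" using assms openin_subset by blast
  then have "r_ideal r M" using regular_maximalsD by simp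
  then have "r (I \<union> J) \<subseteq> M" using I J by (simp add: r_least)
  moreover have sub: "I \<subseteq> r (I \<union> J)" "J \<subseteq> r (I \<union> J)" using r_extensive[of "I \<union> J"] by auto
  then have "maximals_above (r (I \<union> J)) \<subseteq> A \<inter> B" using I(4) J(4) by blast
  moreover have "regular_r_ideal r (r (I \<union> J))" using regular_r_ideal_mono[OF I(1) sub(1)] by simp
  ultimately show ?case using r_fin_generated_Un[OF I(2) J(2)] by (intro exI[of _ "r (I \<union> J)"] conjI)
next
  case (UN K)
  then obtain k where k: "k \<in> K" "M \<in> k" by blast
  obtain I where "regular_r_ideal r I" "r_fin_generated r I" "I \<subseteq> M" "maximals_above I \<subseteq> k"
    using UN.IH[OF k] by metis
  moreover from this k(1) have "maximals_above I \<subseteq> \<Union>K" by blast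
  ultimately show ?case by metis
next
  case (Basis s)
  then obtain I where I: "(regular_r_ideal r I \<and> r_fin_generated r I) \<or> I = r {}" "s = maximals_above I"
    by (auto simp: regular_maximals_def)
  show ?case
  proof (cases "regular_r_ideal r I \<and> r_fin_generated r I")
    case True
    then show ?thesis using I Basis.prems by blast
  next
    case False
    have M: "M \<in> regular_maximals" using Basis.prems I(2) by blast
    then obtain y where y: "y \<in> M" "regular_element r y"
      using regular_maximalsD(1) by (auto simp: regular_r_ideal_def)
    have "y *o UNIV \<subseteq> M"
      using r_ideal_mult'[OF regular_maximalsD(4)[OF M] y(1)] by (auto simp: elt_set_times_def)
    moreover have "maximals_above (y *o UNIV) \<subseteq> s"
      using I False r_empty_subset regular_maximalsD(4) by auto
    ultimately show ?thesis
      using r_invertible_principal[OF y(2)] r_invertible_regular r_invertible_fin_generated by blast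
  qed
qed simp

text \<open>The basic sets of the ideals \<open>r {s, y}\<close> cover \<open>K\<close>, where
  \<open>y\<close> serves to make the ideal regular. Finitely many of them suffice, and the product
  of their \<open>s\<close> lies in every member of \<open>K\<close>.\<close>

lemma compact_common_element:
  assumes K: "compactin (r_max_inv_reg r) K"
    and S: "1 \<in> S" "\<And>s t. s \<in> S \<Longrightarrow> t \<in> S \<Longrightarrow> s * t \<in> S"
    and meet: "\<And>M. M \<in> K \<Longrightarrow> \<exists>s\<in>S. s \<in> M"
  shows "\<exists>s\<in>S. \<forall>M\<in>K. s \<in> M"
proof -
  define \<U> where "\<U> = {maximals_above (r {s, y}) | s y. s \<in> S \<and> regular_element r y}"
  have "openin (r_max_inv_reg r) U" if U: "U \<in> \<U>" for U
  proof -
    obtain s y where s: "U = maximals_above (r {s, y})" "regular_element r y" using U by (auto simp: \<U>_def)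
    have "y \<in> r {s, y}" using r_extensive[of "{s, y}"] by simp
    then have "regular_r_ideal r (r {s, y})" using s(2) by (auto simp: regular_r_ideal_def)
    then show ?thesis unfolding s(1) by (intro openin_maximals_above r_fin_generatedI) auto
  qed
  moreover have "K \<subseteq> \<Union>\<U>"
  proof
    fix M assume "M \<in> K"
    then have M: "M \<in> regular_maximals" using compactin_subset_topspace[OF K] by auto
    obtain s where s: "s \<in> S" "s \<in> M" using meet[OF \<open>M \<in> K\<close>] by blast
    obtain y where y: "y \<in> M" "regular_element r y"
      using regular_maximalsD(1)[OF M] by (auto simp: regular_r_ideal_def)
    have "M \<in> maximals_above (r {s, y})" using M s(2) y(1) regular_maximalsD(4)[OF M] by (simp add: r_least)
    then show "M \<in> \<Union>\<U>" using s(1) y(2) unfolding \<U>_def by blast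
  qed
  ultimately obtain \<F> where \<F>: "finite \<F>" "\<F> \<subseteq> \<U>" "K \<subseteq> \<Union>\<F>"
    using K unfolding compactin_def by metis
  have "\<exists>s\<in>S. \<forall>M\<in>\<Union>\<F>. s \<in> M"
    using \<F>(1,2)
  proof (induction \<F> rule: finite_induct)
    case empty
    then show ?case using S(1) by auto
  next
    case (insert U \<F>)
    obtain t where t: "t \<in> S" "\<forall>M\<in>\<Union>\<F>. t \<in> M" using insert by auto
    obtain s y where s: "s \<in> S" "U = maximals_above (r {s, y})" using insert.prems by (auto simp: \<U>_def)
    have ideal: "r_ideal r M" if "M \<in> \<Union>(insert U \<F>)" for M
      using that insert.prems regular_maximalsD(4) by (auto simp: \<U>_def)
    have "s \<in> M" if "M \<in> U" for M using that r_extensive[of "{s, y}"] unfolding s(2) by auto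
    then have "\<forall>M\<in>\<Union>(insert U \<F>). s * t \<in> M" using t(2) ideal r_ideal_mult r_ideal_mult' by (metis Union_insert Un_iff)
    then show ?case using S(2) s(1) t(1) by blast
  qed
  then show ?thesis using \<F>(3) by blast
qed

text \<open>\<open>compact_common_element\<close> is applied twice: to the regular elements, which
  yields a regular element of the intersection, and to the complement of a regular maximal
  \<open>N\<close> outside \<open>K\<close>, which yields an element of the intersection outside
  \<open>N\<close>.\<close>

lemma compact_eq_maximals_above:
  assumes K: "compactin (r_max_inv_reg r) K"
  shows "regular_r_ideal r (\<Inter>K)" "maximals_above (\<Inter>K) = K" "radical_r_ideal r (\<Inter>K)"
proof -
  have KX: "K \<subseteq> regular_maximals" using compactin_subset_topspace[OF K] by simp
  show rad: "radical_r_ideal r (\<Inter>K)" using KX regular_maximalsD(3) by (intro radical_Inter prime_radical) auto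
  have "\<exists>s\<in>{y. regular_element r y}. \<forall>M\<in>K. s \<in> M"
    using KX regular_maximalsD(1) by (intro compact_common_element[OF K])
      (auto simp: regular_one regular_mult regular_r_ideal_def)
  then show "regular_r_ideal r (\<Inter>K)" using rad by (auto simp: regular_r_ideal_def radical_r_idealD)
  have "N \<in> K" if N: "N \<in> regular_maximals" "\<Inter>K \<subseteq> N" for N
  proof (rule ccontr)
    assume "N \<notin> K"
    have "\<exists>s\<in>- N. \<forall>M\<in>K. s \<in> M"
    proof (rule compact_common_element[OF K])
      show "1 \<in> - N" using prime_one regular_maximalsD(3)[OF N(1)] by blast
      show "s * t \<in> - N" if "s \<in> - N" "t \<in> - N" for s t
        using that prime_mult regular_maximalsD(3)[OF N(1)] by blast
      show "\<exists>s\<in>- N. s \<in> M" if "M \<in> K" for M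
      proof (rule ccontr)
        assume "\<not> ?thesis"
        then have "M \<subseteq> N" by blast
        moreover have "M \<in> regular_maximals" using KX that by blast
        ultimately have "N = M" using N(1) unfolding regular_maximals_def r_maximal_def by blast
        then show False using that \<open>N \<notin> K\<close> by blast
      qed
    qed
    then show False using N(2) by blast
  qed
  then show "maximals_above (\<Inter>K) = K" using KX by blast
qed

lemma usc_compact:
  "f \<in> usc_functions (r_max_inv_reg r) \<Longrightarrow> k \<ge> 1 \<Longrightarrow> compactin (r_max_inv_reg r) {M \<in> regular_maximals. k \<le> f M}"
  by (simp add: usc_functions_def)

text \<open>The intersections of the superlevel sets form an increasing sequence of ideals. A
  maximal ideal above their union would belong to every superlevel set. So \<open>1\<close> lies in
  one of the intersections, and the corresponding set is empty.\<close>

lemma usc_bounded: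
  assumes f: "f \<in> usc_functions (r_max_inv_reg r)"
  shows "\<exists>N. \<forall>M\<in>regular_maximals. f M \<le> N"
proof -
  define K where "K = (\<lambda>k. {M \<in> regular_maximals. Suc k \<le> f M})"
  have K: "compactin (r_max_inv_reg r) (K k)" for k using usc_compact[OF f] by (simp add: K_def)
  define I where "I = (\<Union>k. \<Inter>(K k))"
  have "r_ideal r I"
    unfolding I_def
  proof (rule r_ideal_directed_Union)
    show "r_ideal r A" if "A \<in> range (\<lambda>k. \<Inter>(K k))" for A
      using that compact_eq_maximals_above(1)[OF K] regular_r_idealD by auto
    fix A B assume "A \<in> range (\<lambda>k. \<Inter>(K k))" "B \<in> range (\<lambda>k. \<Inter>(K k))"
    then obtain i j where ij: "A = \<Inter>(K i)" "B = \<Inter>(K j)" by blast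
    have "K (max i j) \<subseteq> K i" "K (max i j) \<subseteq> K j" by (auto simp: K_def)
    then have "A \<union> B \<subseteq> \<Inter>(K (max i j))" unfolding ij by blast
    then show "\<exists>C\<in>range (\<lambda>k. \<Inter>(K k)). A \<union> B \<subseteq> C" by blast
  qed simp
  then have "I = UNIV"
  proof (rule eq_UNIV_if_no_r_maximal)
    fix M assume M: "r_maximal r M" "I \<subseteq> M"
    have KM: "\<Inter>(K k) \<subseteq> M" for k using M(2) by (auto simp: I_def)
    then have "regular_r_ideal r M"
      using regular_r_ideal_mono[OF compact_eq_maximals_above(1)[OF K[of 0]]] M(1) by (simp add: r_maximal_def)
    then have "M \<in> maximals_above (\<Inter>(K (f M)))" using M(1) KM by (simp add: regular_maximals_def)
    then have "M \<in> K (f M)" using compact_eq_maximals_above(2)[OF K] by blast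
    then show False by (simp add: K_def)
  qed
  then have "1 \<in> (\<Union>k. \<Inter>(K k))" by (simp add: I_def)
  then obtain k where k: "1 \<in> \<Inter>(K k)" by blast
  have "K k = {}" using k prime_one regular_maximalsD(3) unfolding K_def by blast
  then have "\<forall>M\<in>regular_maximals. f M \<le> k" by (force simp: K_def)
  then show ?thesis ..
qed

text \<open>Since \<open>y *o {}\<close> is empty, \<open>r {}\<close> is stable under division by a
  regular \<open>y\<close>; if it contains \<open>y\<close>, it contains \<open>1\<close>.\<close>

lemma regular_r_empty: "regular_r_ideal r (r {}) \<Longrightarrow> r {} = UNIV"
proof -
  assume "regular_r_ideal r (r {})"
  then obtain y where y: "y \<in> r {}" "regular_element r y" by (auto simp: regular_r_ideal_def)
  have "r {} = y *o r {}" using regular_r_elt[OF y(2), of "{}"] by (simp add: elt_set_times_def)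
  then obtain t where "t \<in> r {}" "y = y * t" using y(1) unfolding elt_set_times_def by blast
  then have "1 \<in> r {}" using y(2) unfolding regular_element_def cancellative_def by (metis mult_1_right)
  then show "r {} = UNIV" by (simp add: r_eq_UNIV_iff)
qed

text \<open>Under the isomorphism, the preimage of the characteristic function of a compact set is a
  radical ideal, and every element of \<open>usc_functions\<close> is a finite sum of such functions.\<close>

theorem radical_factorization_if_isomorphic:
  assumes ne: "r {} \<noteq> UNIV"
    and iso: "mult_lattice_isomorphic (reg_ideal_lattice r) (usc_lattice (r_max_inv_reg r))"
    and I: "regular_r_ideal r I"
  shows "r_product_of_radicals r I"
proof -
  define T where "T = r_max_inv_reg r"
  have topT: "topspace T = regular_maximals" by (simp add: T_def)
  define C where "C = {I. regular_r_ideal r I} \<union> {r {}}"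
  obtain \<phi> where \<phi>: "\<phi> \<in> iso (reg_ideal_lattice r) (usc_lattice T)"
      "\<phi> \<one>\<^bsub>reg_ideal_lattice r\<^esub> = \<one>\<^bsub>usc_lattice T\<^esub>"
      "\<forall>x \<in> carrier (reg_ideal_lattice r). \<forall>y \<in> carrier (reg_ideal_lattice r).
        lat_le (reg_ideal_lattice r) x y \<longleftrightarrow> lat_le (usc_lattice T) (\<phi> x) (\<phi> y)"
    using iso unfolding mult_lattice_isomorphic_def T_def by blast
  have carrier_C: "carrier (reg_ideal_lattice r) = C" by (simp add: reg_ideal_lattice_def C_def)
  have \<phi>_mult: "\<phi> (r (A * B)) = usc_add T (\<phi> A) (\<phi> B)" if "A \<in> C" "B \<in> C" for A B
    using \<phi>(1) that hom_mult[of \<phi> "reg_ideal_lattice r" "usc_lattice T" A B] unfolding iso_def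
    by (simp add: carrier_C) (simp add: reg_ideal_lattice_def usc_lattice_def)
  have \<phi>_bij: "bij_betw \<phi> C (Some ` usc_functions T \<union> {None})"
    using \<phi>(1) unfolding iso_def by (simp add: reg_ideal_lattice_def usc_lattice_def C_def)
  have \<phi>_one: "\<phi> UNIV = Some (\<lambda>M\<in>regular_maximals. 0)"
    using \<phi>(2) by (simp add: reg_ideal_lattice_def usc_lattice_def topT)
  have \<phi>_le: "A \<subseteq> B \<longleftrightarrow> usc_le T (\<phi> A) (\<phi> B)" if "A \<in> C" "B \<in> C" for A B
    using \<phi>(3)[unfolded carrier_C] that by (simp add: reg_ideal_lattice_def usc_lattice_def)
  have regC: "A \<in> C" if "regular_r_ideal r A" for A using that by (simp add: C_def)
  have "None \<in> \<phi> ` C" using \<phi>_bij by (simp add: bij_betw_def)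
  then obtain B where B: "B \<in> C" "\<phi> B = None" by auto
  \<comment> \<open>The bottoms correspond, because only \<open>None\<close> lies below
    \<open>None\<close>.\<close>
  have "r {} \<subseteq> B" using B(1) r_empty_subset by (auto simp: C_def dest: regular_r_idealD)
  then have "usc_le T (\<phi> (r {})) None" using \<phi>_le[of "r {}" B] B by (simp add: C_def)
  then have bot: "\<phi> (r {}) = None" by (cases "\<phi> (r {})") auto
  have Some_ex: "\<exists>h. \<phi> A = Some h \<and> h \<in> usc_functions T" if A: "regular_r_ideal r A" for A
  proof -
    have "A \<noteq> r {}" using A ne regular_r_empty by blast
    then have "\<phi> A \<noteq> None"
      using bot bij_betw_imp_inj_on[OF \<phi>_bij] regC[OF A] unfolding inj_on_def C_def by auto
    then show ?thesis using bij_betw_apply[OF \<phi>_bij regC[OF A]] by auto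
  qed
  have ind: "\<exists>J. regular_r_ideal r J \<and> radical_r_ideal r J \<and>
      \<phi> J = Some (\<lambda>M\<in>regular_maximals. if M \<in> K then 1 else 0)"
    if K: "compactin T K" for K
  proof -
    define u where "u = (\<lambda>M\<in>regular_maximals. if M \<in> K then 1 else (0::nat))"
    have KX: "K \<subseteq> regular_maximals" using compactin_subset_topspace[OF K] topT by simp
    have "compactin T {M \<in> regular_maximals. k \<le> u M}" if "k \<ge> 1" for k
    proof (cases "k = 1")
      case True
      then have "{M \<in> regular_maximals. k \<le> u M} = K" using KX by (auto simp: u_def)
      then show ?thesis using K by simp
    next
      case False
      then have empty: "{M \<in> regular_maximals. k \<le> u M} = {}" using that by (auto simp: u_def)
      show ?thesis unfolding empty by simp
    qed
    then have "u \<in> usc_functions T" by (simp add: usc_functions_def topT u_def)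
    then have "Some u \<in> \<phi> ` C" using \<phi>_bij by (simp add: bij_betw_def)
    then obtain J where J: "J \<in> C" "\<phi> J = Some u" by auto
    have Jreg: "regular_r_ideal r J" using J bot by (auto simp: C_def)
    then have Ji: "r_ideal r J" by (rule regular_r_idealD)
    have "x \<in> J" if x: "n \<ge> 1" "x ^ n \<in> J" for x n
    proof -
      \<comment> \<open>Adjoining \<open>x\<close> keeps the \<open>n\<close>-th power inside
        \<open>J\<close>, so \<open>n * h M\<close> is at least \<open>u M\<close>. As
        \<open>u\<close> takes only the values 0 and 1, already \<open>h M\<close> is at least
        \<open>u M\<close>, which means \<open>A \<subseteq> J\<close>.\<close>
      define A where "A = r (insert x J)"
      have JA: "insert x J \<subseteq> A" by (simp add: A_def r_extensive)
      have Areg: "regular_r_ideal r A" using regular_r_ideal_mono[OF Jreg] JA by (simp add: A_def)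
      obtain h where h: "\<phi> A = Some h" using Some_ex[OF Areg] by blast
      have pow: "\<phi> (r (A ^ m)) = Some (\<lambda>M\<in>regular_maximals. m * h M)" for m
      proof (induction m)
        case 0
        have "(\<lambda>M\<in>regular_maximals. 0) = (\<lambda>M\<in>regular_maximals. 0 * h M)" by (rule restrict_ext) simp
        then show ?case by (simp only: power_0 r_one \<phi>_one)
      next
        case (Suc m)
        have "\<phi> (r (A ^ Suc m)) = \<phi> (r (A * r (A ^ m)))" by simp
        also have "\<dots> = usc_add T (\<phi> A) (\<phi> (r (A ^ m)))"
          using regC Areg regular_r_ideal_pow by (intro \<phi>_mult) auto
        also have "\<dots> = Some (\<lambda>M\<in>regular_maximals. Suc m * h M)"
          by (simp add: Suc.IH h topT cong: restrict_cong)
        finally show ?case .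
      qed
      have "{x ^ i} * J ^ (n - i) \<subseteq> J" if "i \<le> n" for i
      proof (cases "i = n")
        case True
        then show ?thesis using x(2) by (auto simp: set_times_def set_one)
      next
        case False
        then have "n - i = Suc (n - i - 1)" using that by simp
        then have "J ^ (n - i) = J * J ^ (n - i - 1)" by (metis power_Suc)
        then have "J ^ (n - i) \<subseteq> J" using r_ideal_times_subset(1)[OF Ji, of J] by simp
        then show ?thesis by (rule r_ideal_times_subset(2)[OF Ji])
      qed
      then have "(\<Union>i\<le>n. {x ^ i} * J ^ (n - i)) \<subseteq> J" by blast
      then have "insert x J ^ n \<subseteq> J" using insert_pow_subset[of x J n] by (rule subset_trans[rotated])
      then have "r (A ^ n) \<subseteq> J" using Ji by (simp add: A_def r_least)
      then have "usc_le T (\<phi> (r (A ^ n))) (\<phi> J)"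
        using \<phi>_le regC[OF regular_r_ideal_pow[OF Areg]] J(1) by blast
      then have "n * h M \<ge> u M" if "M \<in> regular_maximals" for M using that by (simp add: pow J(2) topT)
      then have "h M \<ge> u M" if "M \<in> regular_maximals" for M
        using that by (cases "h M") (fastforce simp: u_def)+
      then have "A \<subseteq> J" using \<phi>_le[OF regC[OF Areg] J(1)] by (simp add: h J(2) topT)
      then show ?thesis using JA by blast
    qed
    then have "radical_r_ideal r J" unfolding radical_r_ideal_def using Ji by blast
    then show ?thesis using Jreg J(2) unfolding u_def by blast
  qed
  obtain f where f: "\<phi> I = Some f" "f \<in> usc_functions T" using Some_ex[OF I] by blast
  obtain N where N: "f M \<le> N" if "M \<in> regular_maximals" for M using usc_bounded f(2) unfolding T_def by blast
  \<comment> \<open>The layers of \<open>f\<close>: each \<open>M\<close> lies in exactly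
    \<open>f M\<close> of these superlevel sets, and by the bound \<open>N\<close> the first
    \<open>N\<close> layers already sum to \<open>f\<close>.\<close>
  have "\<forall>k. \<exists>J. regular_r_ideal r J \<and> radical_r_ideal r J \<and>
      \<phi> J = Some (\<lambda>M\<in>regular_maximals. if M \<in> {M \<in> regular_maximals. Suc k \<le> f M} then 1 else 0)"
    using usc_compact f(2) unfolding T_def[symmetric] by (intro allI ind) simp
  then obtain J where J: "\<And>k. regular_r_ideal r (J k)" "\<And>k. radical_r_ideal r (J k)"
      "\<And>k. \<phi> (J k) = Some (\<lambda>M\<in>regular_maximals. if M \<in> {M \<in> regular_maximals. Suc k \<le> f M} then 1 else 0)"
    by metis
  have prod_reg: "regular_r_ideal r (r_product r (map J [0..<n]))" for n
    using J(1) by (intro regular_r_product) auto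
  have "\<phi> (r_product r (map J [0..<n])) = Some (\<lambda>M\<in>regular_maximals. min n (f M))" for n
  proof (induction n)
    case 0
    have "(\<lambda>M\<in>regular_maximals. 0) = (\<lambda>M\<in>regular_maximals. min 0 (f M))" by (rule restrict_ext) simp
    then show ?case by (simp only: upt_0 list.map r_product_Nil \<phi>_one upt_conv_Nil order_refl)
  next
    case (Suc n)
    have "\<phi> (r_product r (map J [0..<Suc n])) = \<phi> (r (r_product r (map J [0..<n]) * J n))"
      using J(1) by (simp add: r_product_append r_product_singleton regular_r_idealD)
    also have "\<dots> = usc_add T (\<phi> (r_product r (map J [0..<n]))) (\<phi> (J n))"
      using regC prod_reg J(1) by (intro \<phi>_mult) auto
    also have "\<dots> = Some (\<lambda>M\<in>regular_maximals. min (Suc n) (f M))"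
      by (auto simp: Suc.IH J(3) topT intro!: restrict_ext)
    finally show ?case .
  qed
  then have "\<phi> (r_product r (map J [0..<N])) = Some (\<lambda>M\<in>regular_maximals. min N (f M))" .
  also have "(\<lambda>M\<in>regular_maximals. min N (f M)) = f"
    using f(2) N by (intro extensionalityI[of _ regular_maximals]) (auto simp: usc_functions_def topT)
  finally have "\<phi> (r_product r (map J [0..<N])) = \<phi> I" using f(1) by simp
  then have "r_product r (map J [0..<N]) = I"
    using bij_betw_imp_inj_on[OF \<phi>_bij] regC prod_reg I by (meson inj_onD)
  then show ?thesis
    unfolding r_product_of_radicals_def using J(2) by (intro exI[of _ "map J [0..<N]"]) auto
qed

end

section \<open>Compactness of the sets of regular maximal ideals above a regular ideal\<close>

context invertible_radical_system
begin

text \<open>The usual compactness argument for spectra, with \<open>comaximal_complement\<close>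
  turning the condition that \<open>A\<close> lies in \<open>M\<close> into the condition that
  \<open>S\<close> does not. Finitarity then extracts finitely many members of the cover.\<close>

lemma compactin_maximals_above:
  assumes J: "regular_r_ideal r J"
  shows "compactin (r_max_inv_reg r) (maximals_above J)"
  unfolding compactin_def
proof (intro conjI allI impI)
  show "maximals_above J \<subseteq> topspace (r_max_inv_reg r)" by auto
  fix \<U> assume \<U>: "(\<forall>U\<in>\<U>. openin (r_max_inv_reg r) U) \<and> maximals_above J \<subseteq> \<Union>\<U>"
  have Ji: "r_ideal r J" using J by (rule regular_r_idealD)
  obtain y where y: "y \<in> J" "regular_element r y" using J by (auto simp: regular_r_ideal_def)
  define R where "R = radical (y *o (UNIV :: 'a set))"
  have yinv: "r_invertible r (y *o UNIV)" using y(2) by (rule r_invertible_principal)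
  have R: "r_invertible r R" "radical_r_ideal r R"
    using radical_invertible r_invertible_regular r_invertible_fin_generated radical_r_ideal_radical
      r_invertibleD yinv by (auto simp: R_def)
  have RM: "R \<subseteq> M" if "M \<in> regular_maximals" "J \<subseteq> M" for M
    unfolding R_def using that y(1) regular_maximalsD[OF that(1)]
    by (intro radical_least prime_radical) (auto simp: elt_set_times_def intro: r_ideal_mult')
  \<comment> \<open>Each \<open>S\<close> stands for one member of the cover, which contains all
    regular maximal ideals above \<open>R\<close> but not above \<open>S\<close>. A finite subcover
    arises from finitely many \<open>S\<close> whose join with \<open>J\<close> contains
    \<open>1\<close>.\<close>
  define \<S> where "\<S> = {S. \<exists>U\<in>\<U>. \<forall>M\<in>regular_maximals. R \<subseteq> M \<and> \<not> S \<subseteq> M \<longrightarrow> M \<in> U}"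
  have "r (J \<union> \<Union>\<S>) = UNIV"
  proof (rule eq_UNIV_if_no_r_maximal)
    fix M assume M: "r_maximal r M" "r (J \<union> \<Union>\<S>) \<subseteq> M"
    then have JM: "J \<subseteq> M" and SM: "\<Union>\<S> \<subseteq> M" using r_extensive[of "J \<union> \<Union>\<S>"] by auto
    have MX: "M \<in> regular_maximals"
      using M(1) regular_r_ideal_mono[OF J JM] by (simp add: regular_maximals_def r_maximal_def)
    note Mi = regular_maximalsD(4)[OF MX]
    obtain U where U: "U \<in> \<U>" "M \<in> U" using \<U> MX JM by blast
    then have "openin (r_max_inv_reg r) U" using \<U> by blast
    then obtain A where A: "regular_r_ideal r A" "r_fin_generated r A" "A \<subseteq> M" "maximals_above A \<subseteq> U"
      using fin_generated_basic_open[OF _ U(2)] by metis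
    define B where "B = r (A \<union> R)"
    have AB: "A \<subseteq> B" "R \<subseteq> B" using r_extensive[of "A \<union> R"] by (auto simp: B_def)
    have Breg: "regular_r_ideal r B" using regular_r_ideal_mono[OF A(1) AB(1)] by (simp add: B_def)
    have Bfg: "r_fin_generated r B"
      unfolding B_def using A(2) R(1) by (blast intro: r_fin_generated_Un r_invertible_fin_generated)
    have RB: "R \<subseteq> radical B" using AB(2) subset_radical[of B] by blast
    obtain S where S: "r_ideal r S" "R = r (radical B * S)" "r (radical B \<union> S) = UNIV"
      using comaximal_complement[OF R Breg Bfg RB] by blast
    have "N \<in> U" if N: "N \<in> regular_maximals" "R \<subseteq> N \<and> \<not> S \<subseteq> N" for N
    proof -
      have "r (radical B * S) \<subseteq> N" using N(2) S(2) by simp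
      then have "radical B \<subseteq> N" using prime_r_times_subset[OF regular_maximalsD(3)[OF N(1)]] N(2) by blast
      then have "N \<in> maximals_above A" using N(1) AB(1) subset_radical[of B] by blast
      then show ?thesis using A(4) by blast
    qed
    then have "S \<in> \<S>" using U(1) unfolding \<S>_def by blast
    then have "S \<subseteq> M" using SM by blast
    moreover have "B \<subseteq> M" using A(3) RM[OF MX JM] Mi by (simp add: B_def r_least)
    then have "radical B \<subseteq> M" using regular_maximalsD(3)[OF MX] by (intro radical_least prime_radical)
    ultimately have "r (radical B \<union> S) \<subseteq> M" using Mi by (simp add: r_least)
    then show False using S(3) M(1) by (auto simp: r_maximal_def)
  qed simp
  then have "{1} \<subseteq> r (J \<union> \<Union>\<S>)" by simp
  then obtain E where E: "finite E" "E \<subseteq> J \<union> \<Union>\<S>" "1 \<in> r E" using r_finite[of "{1}" "J \<union> \<Union>\<S>"] by auto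
  have "finite (E - J)" "E - J \<subseteq> \<Union>\<S>" using E by auto
  then obtain \<S>' where \<S>': "finite \<S>'" "\<S>' \<subseteq> \<S>" "E - J \<subseteq> \<Union>\<S>'" by (rule finite_subset_Union)
  have "\<forall>S\<in>\<S>. \<exists>U. U \<in> \<U> \<and> (\<forall>M\<in>regular_maximals. R \<subseteq> M \<and> \<not> S \<subseteq> M \<longrightarrow> M \<in> U)" unfolding \<S>_def by blast
  then obtain u where u: "\<And>S. S \<in> \<S> \<Longrightarrow> u S \<in> \<U>"
      "\<And>S M. S \<in> \<S> \<Longrightarrow> M \<in> regular_maximals \<Longrightarrow> R \<subseteq> M \<Longrightarrow> \<not> S \<subseteq> M \<Longrightarrow> M \<in> u S"
    by metis
  have "maximals_above J \<subseteq> \<Union>(u ` \<S>')"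
  proof
    fix M assume "M \<in> maximals_above J"
    then have M: "M \<in> regular_maximals" "J \<subseteq> M" by auto
    have "\<exists>S\<in>\<S>'. \<not> S \<subseteq> M"
    proof (rule ccontr)
      assume "\<not> ?thesis"
      then have "E \<subseteq> M" using \<S>'(3) M(2) by blast
      then have "1 \<in> M" using E(3) r_least[OF regular_maximalsD(4)[OF M(1)], of E] by blast
      then show False using prime_one regular_maximalsD(3)[OF M(1)] by blast
    qed
    then show "M \<in> \<Union>(u ` \<S>')" using u(2) M(1) RM[OF M] \<S>'(2) by blast
  qed
  then show "\<exists>\<F>. finite \<F> \<and> \<F> \<subseteq> \<U> \<and> maximals_above J \<subseteq> \<Union>\<F>"
    using \<S>' u(1) by (intro exI[of _ "u ` \<S>'"]) auto
qed

section \<open>The isomorphism with upper semicontinuous functions\<close>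

definition chain_of :: "'a set \<Rightarrow> 'a set list" where
  "chain_of I = (SOME As. radical_chain As \<and> I = r_product r As)"

lemma chain_of:
  assumes "regular_r_ideal r I"
  shows "radical_chain (chain_of I)" "r_product r (chain_of I) = I"
  using someI_ex[OF radical_chain_exists[OF assms]] by (auto simp: chain_of_def)

text \<open>Counts may be read off from any factorization into radical ideals, ordered or
  not.\<close>

lemma factor_count_chain_of_r_product:
  assumes "\<And>A. A \<in> set As \<Longrightarrow> radical_r_ideal r A" "regular_r_ideal r (r_product r As)" "M \<in> regular_maximals"
  shows "factor_count M (chain_of (r_product r As)) = factor_count M As"
  using factor_count_mono[of As "chain_of (r_product r As)" M] factor_count_mono[of "chain_of (r_product r As)" As M]
    chain_of[OF assms(2)] assms radical_chainD by (metis order_antisym order_refl)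

lemma factor_count_chain_of_times:
  assumes "regular_r_ideal r I" "regular_r_ideal r J" "M \<in> regular_maximals"
  shows "factor_count M (chain_of (r (I * J))) = factor_count M (chain_of I) + factor_count M (chain_of J)"
proof -
  have eq: "r_product r (chain_of I @ chain_of J) = r (I * J)"
    using chain_of(2) assms by (simp add: r_product_append)
  have "factor_count M (chain_of (r_product r (chain_of I @ chain_of J))) = factor_count M (chain_of I @ chain_of J)"
    using assms chain_of(1) radical_chainD
    by (intro factor_count_chain_of_r_product) (auto simp: eq regular_r_ideal_times)
  then show ?thesis by (simp add: eq)
qed

lemma subset_iff_factor_count:
  assumes "regular_r_ideal r I" "regular_r_ideal r J"
  shows "I \<subseteq> J \<longleftrightarrow> (\<forall>M\<in>regular_maximals. factor_count M (chain_of J) \<le> factor_count M (chain_of I))"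
  using factor_count_mono[of "chain_of I" "chain_of J"] radical_chain_product_mono[of "chain_of I" "chain_of J"]
    chain_of[OF assms(1)] chain_of[OF assms(2)] assms radical_chainD by metis

lemma factor_count_usc:
  assumes I: "regular_r_ideal r I"
  shows "(\<lambda>M\<in>regular_maximals. factor_count M (chain_of I)) \<in> usc_functions (r_max_inv_reg r)"
proof -
  have "compactin (r_max_inv_reg r) {M \<in> regular_maximals. k \<le> factor_count M (chain_of I)}" if "k \<ge> 1" for k
  proof (cases "k \<le> length (chain_of I)")
    case True
    \<comment> \<open>Members are indexed from 0, so the count is at least \<open>k\<close> exactly
      when the member of index \<open>k - 1\<close> lies in \<open>M\<close>.\<close>
    define A where "A = chain_of I ! (k - 1)"
    have l: "k - 1 < length (chain_of I)" using True \<open>k \<ge> 1\<close> by simp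
    then have A: "A \<in> set (chain_of I)" by (simp add: A_def)
    then have Ai: "r_ideal r A" using chain_of(1)[OF I] radical_chainD radical_r_idealD by blast
    have "I \<subseteq> A" using r_product_subset[OF A Ai] chain_of(2)[OF I] by simp
    then have "regular_r_ideal r A" using regular_r_ideal_mono I Ai by blast
    moreover have "A \<subseteq> M \<longleftrightarrow> k \<le> factor_count M (chain_of I)" for M
      using radical_chain_nth_subset_iff[OF chain_of(1)[OF I] l, of M] \<open>k \<ge> 1\<close> unfolding A_def by linarith
    ultimately show ?thesis using compactin_maximals_above[of A] by simp
  next
    case False
    then have "\<not> k \<le> factor_count M (chain_of I)" for M
      using length_filter_le[of "\<lambda>A. A \<subseteq> M" "chain_of I"] by linarith
    then show ?thesis by simp
  qed
  then show ?thesis by (simp add: usc_functions_def cong: conj_cong)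
qed

text \<open>Counts add under \<open>r\<close>-products and reverse inclusion, just as
  \<open>usc_le\<close> reverses the pointwise order. For surjectivity, the intersections of the
  superlevel sets of \<open>f\<close> serve as factors. The assumption \<open>ne\<close> keeps
  \<open>r {}\<close> apart from the regular ideals.\<close>

theorem isomorphic_usc_lattice:
  assumes ne: "r {} \<noteq> UNIV"
  shows "mult_lattice_isomorphic (reg_ideal_lattice r) (usc_lattice (r_max_inv_reg r))"
proof -
  define T where "T = r_max_inv_reg r"
  have topT: "topspace T = regular_maximals" by (simp add: T_def)
  define \<psi> where "\<psi> = (\<lambda>I. \<lambda>M\<in>regular_maximals. factor_count M (chain_of I))"
  define \<phi> where "\<phi> = (\<lambda>I. if I = r {} then None else Some (\<psi> I))"
  define C where "C = {I. regular_r_ideal r I} \<union> {r {}}"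
  have C: "carrier (reg_ideal_lattice r) = C" by (simp add: reg_ideal_lattice_def C_def)
  have reg: "\<phi> I = Some (\<psi> I)" if "regular_r_ideal r I" for I
    using that ne regular_r_empty by (auto simp: \<phi>_def)
  have bot: "\<phi> (r {}) = None" by (simp add: \<phi>_def)
  have le: "I \<subseteq> J \<longleftrightarrow> usc_le T (\<phi> I) (\<phi> J)" if "I \<in> C" "J \<in> C" for I J
  proof (cases "I = r {}")
    case True
    then show ?thesis using that r_empty_subset[of J] by (auto simp: bot C_def dest: regular_r_idealD)
  next
    case False
    then have I: "regular_r_ideal r I" using that by (auto simp: C_def)
    show ?thesis
    proof (cases "J = r {}")
      case True
      then have "\<not> I \<subseteq> J" using I ne regular_r_empty regular_r_ideal_mono[of I J] by auto
      then show ?thesis by (simp add: True bot reg[OF I])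
    next
      case False
      then have J: "regular_r_ideal r J" using that by (auto simp: C_def)
      then show ?thesis using subset_iff_factor_count[OF I J] by (simp add: reg I J topT \<psi>_def)
    qed
  qed
  have mult: "\<phi> (r (I * J)) = usc_add T (\<phi> I) (\<phi> J)" if "I \<in> C" "J \<in> C" for I J
  proof (cases "I = r {} \<or> J = r {}")
    case True
    moreover have "{} * X = {}" "X * {} = {}" for X :: "'a set" by (auto simp: set_times_def)
    ultimately have "r (I * J) = r {}" by auto
    then show ?thesis using True by (cases "\<phi> I") (auto simp: bot)
  next
    case False
    then have "regular_r_ideal r I" "regular_r_ideal r J" using that by (auto simp: C_def)
    then show ?thesis
      using factor_count_chain_of_times
      by (auto simp: reg regular_r_ideal_times topT \<psi>_def intro!: restrict_ext)
  qed
  have inj: "inj_on \<phi> C"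
  proof (rule inj_onI)
    fix I J assume "I \<in> C" "J \<in> C" "\<phi> I = \<phi> J"
    moreover have "usc_le T x x" for x by (cases x) auto
    ultimately show "I = J" using le[of I J] le[of J I] by auto
  qed
  have "\<phi> ` C = Some ` usc_functions T \<union> {None}"
  proof
    show "\<phi> ` C \<subseteq> Some ` usc_functions T \<union> {None}"
      using factor_count_usc by (auto simp: C_def reg bot \<psi>_def T_def)
    have "Some f \<in> \<phi> ` C" if f: "f \<in> usc_functions T" for f
    proof -
      obtain N where N: "f M \<le> N" if "M \<in> regular_maximals" for M
        using usc_bounded f unfolding T_def by blast
      define J where "J = (\<lambda>k. \<Inter>{M \<in> regular_maximals. Suc k \<le> f M})"
      have K: "compactin (r_max_inv_reg r) {M \<in> regular_maximals. Suc k \<le> f M}" for k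
        using usc_compact[of f "Suc k"] f by (simp add: T_def)
      have J: "regular_r_ideal r (J k)" "radical_r_ideal r (J k)" for k
        using compact_eq_maximals_above[OF K] by (auto simp: J_def)
      have JM: "J k \<subseteq> M \<longleftrightarrow> Suc k \<le> f M" if "M \<in> regular_maximals" for k M
        using compact_eq_maximals_above(2)[OF K, of k] that unfolding J_def by blast
      define As where "As = map J [0..<N]"
      have Areg: "regular_r_ideal r (r_product r As)" using J(1) by (intro regular_r_product) (auto simp: As_def)
      have "factor_count M (map J [0..<n]) = min n (f M)" if "M \<in> regular_maximals" for M n
        by (induction n) (auto simp: JM[OF that])
      then have "factor_count M As = f M" if "M \<in> regular_maximals" for M
        using N that by (simp add: As_def min_absorb2)
      moreover have "factor_count M (chain_of (r_product r As)) = factor_count M As"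
        if "M \<in> regular_maximals" for M
        using J(2) Areg that by (intro factor_count_chain_of_r_product) (auto simp: As_def)
      ultimately have "\<psi> (r_product r As) = f"
        using f by (intro extensionalityI[of _ regular_maximals]) (auto simp: \<psi>_def usc_functions_def topT)
      then have "\<phi> (r_product r As) = Some f" using reg[OF Areg] by simp
      then show ?thesis using Areg by (force simp: C_def)
    qed
    moreover have "None \<in> \<phi> ` C" using bot by (force simp: C_def)
    ultimately show "Some ` usc_functions T \<union> {None} \<subseteq> \<phi> ` C" by blast
  qed
  then have "bij_betw \<phi> C (Some ` usc_functions T \<union> {None})" using inj by (simp add: bij_betw_def)
  moreover from this have "\<phi> \<in> C \<rightarrow> Some ` usc_functions T \<union> {None}" by (rule bij_betw_imp_funcset)
  ultimately have "\<phi> \<in> iso (reg_ideal_lattice r) (usc_lattice T)"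
    using mult unfolding iso_def hom_def
    by (simp add: C) (simp add: reg_ideal_lattice_def usc_lattice_def)
  moreover have "\<phi> UNIV = Some (\<lambda>M\<in>regular_maximals. 0)"
  proof -
    have "factor_count M (chain_of (r_product r [])) = factor_count M []" if "M \<in> regular_maximals" for M
      using that regular_r_ideal_UNIV by (intro factor_count_chain_of_r_product) auto
    then show ?thesis unfolding reg[OF regular_r_ideal_UNIV] \<psi>_def by (simp cong: restrict_cong)
  qed
  then have "\<phi> \<one>\<^bsub>reg_ideal_lattice r\<^esub> = \<one>\<^bsub>usc_lattice T\<^esub>"
    by (simp add: reg_ideal_lattice_def usc_lattice_def topT)
  moreover have "\<forall>x \<in> carrier (reg_ideal_lattice r). \<forall>y \<in> carrier (reg_ideal_lattice r).
      lat_le (reg_ideal_lattice r) x y \<longleftrightarrow> lat_le (usc_lattice T) (\<phi> x) (\<phi> y)"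
    unfolding C using le by (simp add: reg_ideal_lattice_def usc_lattice_def)
  ultimately show ?thesis unfolding mult_lattice_isomorphic_def T_def by blast
qed

lemma r_Pruefer: "r_Pruefer r"
  unfolding r_Pruefer_def using fin_generated_chain_of_invertibles r_invertible_r_product by metis

end

text \<open>Condition (5) is the hub: (1) implies (2), (2) implies (3), (3) implies (5), and (5)
  implies (4), (6) and (7), each of which leads back to (1) or (5). If \<open>r {} = UNIV\<close>,
  then \<open>UNIV\<close> is the only \<open>r\<close>-ideal and \<open>reg_ideal_lattice r\<close>
  has one element, while the other lattice has two, the zero function and \<open>None\<close>. Then
  (6) fails although (1) holds, so (6) is compared only for
  \<open>r {} \<noteq> UNIV\<close>.\<close>

theorem theorem8p4:
  fixes r :: "'a::comm_monoid_mult set \<Rightarrow> 'a set"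
  assumes "\<exists>x y :: 'a. x \<noteq> y"
    and "weak_ideal_system r"
    and "finitary r"
    and "modular r"
    and "\<And>I. regular_r_ideal r I \<Longrightarrow> \<exists>\<A>. (\<forall>J \<in> \<A>. r_invertible r J) \<and> I = r (\<Union>\<A>)"
  defines "c1 \<equiv> \<forall>I. regular_r_ideal r I \<longrightarrow> r_product_of_radicals r I"
    and "c2 \<equiv> (\<forall>P. regular_r_ideal r P \<and> prime_r_ideal r P \<longrightarrow> r_maximal r P) \<and>
               (\<forall>I. r_invertible r I \<longrightarrow> r_product_of_radicals r I)"
    and "c3 \<equiv> \<forall>P. regular_r_ideal r P \<and> prime_r_ideal r P \<longrightarrow>
               r_maximal r P \<and> (\<exists>J. r_invertible r J \<and> radical_r_ideal r J \<and> J \<subseteq> P)"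
    and "c4 \<equiv> \<forall>I. regular_r_ideal r I \<longrightarrow>
               (\<exists>!Js. (\<forall>J \<in> set Js. radical_r_ideal r J \<and> J \<noteq> UNIV) \<and>
                      sorted_wrt (\<subseteq>) Js \<and> I = r_product r Js)"
    and "c5 \<equiv> \<forall>I. regular_r_ideal r I \<and> r_fin_generated r I \<longrightarrow> r_invertible r (radical I)"
    and "c6 \<equiv> mult_lattice_isomorphic (reg_ideal_lattice r) (usc_lattice (r_max_inv_reg r))"
    and "c7 \<equiv> r_Pruefer r \<and>
               (\<forall>I. regular_r_ideal r I \<and> r_fin_generated r I \<longrightarrow> r_fin_generated r (radical I))"
  shows "(c1 \<longleftrightarrow> c2) \<and> (c1 \<longleftrightarrow> c3) \<and> (c1 \<longleftrightarrow> c4) \<and> (c1 \<longleftrightarrow> c5) \<and>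
         (r {} \<noteq> UNIV \<longrightarrow> (c1 \<longleftrightarrow> c6)) \<and> (c1 \<longleftrightarrow> c7)"
proof -
  interpret weak_ideal_system r by fact
  interpret finitary_ideal_system r by unfold_locales fact
  note gen = assms(5)
  have "c1 \<Longrightarrow> c2"
    unfolding c1_def c2_def
    using regular_prime_r_maximal_if_radical_factorization[OF assms(4) gen] r_invertible_regular by blast
  moreover have "c2 \<Longrightarrow> c3"
    unfolding c3_def
  proof (intro allI impI)
    fix P assume c2 and P: "regular_r_ideal r P \<and> prime_r_ideal r P"
    obtain y where y: "y \<in> P" "regular_element r y" using P by (auto simp: regular_r_ideal_def)
    have inv: "r_invertible r (y *o UNIV)" using y(2) by (rule r_invertible_principal)
    then obtain Js where Js: "\<And>J. J \<in> set Js \<Longrightarrow> radical_r_ideal r J" "y *o UNIV = r_product r Js"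
      using \<open>c2\<close> unfolding c2_def r_product_of_radicals_def by metis
    have "y *o UNIV \<subseteq> P" using P y(1) by (auto simp: elt_set_times_def intro: r_ideal_mult' prime_r_idealD)
    then have "prod_list Js \<subseteq> P" using Js(2) prod_list_subset_r_product[of Js] by simp
    then obtain J where J: "J \<in> set Js" "J \<subseteq> P" using prime_prod_list P by blast
    moreover have "r_invertible r J"
      using r_invertible_r_product_factor[OF _ J(1)] inv Js radical_r_idealD J(1) by simp
    ultimately show "r_maximal r P \<and> (\<exists>J. r_invertible r J \<and> radical_r_ideal r J \<and> J \<subseteq> P)"
      using \<open>c2\<close> P Js(1) unfolding c2_def by blast
  qed
  moreover have "c3 \<Longrightarrow> c5"
    unfolding c3_def c5_def using radical_invertible_if_dim_one by blast
  moreover have "c4 \<Longrightarrow> c1"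
    unfolding c1_def c4_def r_product_of_radicals_def by metis
  moreover have "c7 \<Longrightarrow> c5"
    unfolding c5_def c7_def r_Pruefer_def
    using regular_r_ideal_mono subset_radical r_ideal_radical regular_r_idealD by metis
  moreover have "r {} \<noteq> UNIV \<Longrightarrow> c6 \<Longrightarrow> c1"
    unfolding c1_def c6_def using radical_factorization_if_isomorphic by blast
  moreover have "c4 \<and> (r {} \<noteq> UNIV \<longrightarrow> c6) \<and> c7" if c5
  proof -
    interpret invertible_radical_system r
      using \<open>c5\<close> by unfold_locales (simp add: c5_def)
    have c4
      unfolding c4_def
    proof (intro allI impI)
      fix I assume I: "regular_r_ideal r I"
      have "\<exists>!Js. radical_chain Js \<and> I = r_product r Js"
        using radical_chain_exists[OF I] radical_chain_unique I by metis
      then show "\<exists>!Js. (\<forall>J\<in>set Js. radical_r_ideal r J \<and> J \<noteq> UNIV) \<and> sorted_wrt (\<subseteq>) Js \<and> I = r_product r Js"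
        unfolding radical_chain_def by (simp add: conj_assoc)
    qed
    moreover have "r {} \<noteq> UNIV \<longrightarrow> c6" unfolding c6_def using isomorphic_usc_lattice by blast
    moreover have c7
      unfolding c7_def using r_Pruefer radical_invertible r_invertible_fin_generated by blast
    ultimately show ?thesis by blast
  qed
  ultimately show ?thesis by blast
qed

end
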